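(* Let $\alpha>1$, $k\in\mathbb{N}$, $m\in\mathbb{N}_0$ with $m\ge 1+\frac{k}{2}$, and $f\in\mathcal{M}_{\alpha,m}$. Then for all $s$ in the strip $0<\operatorname{Re}(s)<1$, $$\zeta^k(s)f^*(s)=\int_0^\infty\left(\sum_{n=1}^\infty d_k(n)f(nx)-\int_0^\infty f(xy)P_{k-1}(\ln y)\,dy\right)x^{s-1}\,dx.$$
   Context: For $\alpha>1$ and $m\in\mathbb{N}_0$, the class $\mathcal{M}_{\alpha,m}$ consists of the functions $f$ defined on $[0,\infty)$ such that $f\in\mathcal{C}^{(m)}([0,\infty))$ and $f^{(j)}(x)=\mathcal{O}(x^{-\alpha-j})$ as $x\to\infty$, for all $j=0,1,\dots,m$. $f^*(s)=\int_0^\infty f(x)x^{s-1}dx$ is the Mellin transform of $f$. $\zeta$ is the Riemann zeta function. $d_k(n)$ is the number of ways of writing $n$ as an ordered product of $k$ natural numbers (so $\zeta^k(s)=\sum_{n\ge1}d_k(n)n^{-s}$ for $\operatorname{Re}s>1$). $P_{k-1}$ is the polynomial of degree $k-1$ determined by $P_{k-1}(\ln y)=\operatorname*{res}_{s=1}\big(\zeta^k(s)y^{s-1}\big)$ for $y>0$, so that $\operatorname*{res}_{s=1}(\zeta^k(s)f^*(s)x^{-s})=\int_0^\infty f(xy)P_{k-1}(\ln y)dy$; e.g. $P_0=1$, $P_1(t)=t+2\gamma$ with $\gamma$ the Euler–Mascheroni constant. *)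

theory Defs
  imports "HOL-Complex_Analysis.Complex_Analysis"
begin

text \<open>Riemann zeta function: the analytic continuation to the punctured plane of the
  Dirichlet series sum n^(-s), Re s > 1 (unique by the identity theorem).\<close>
definition riemann_zeta :: "complex \<Rightarrow> complex" where
  "riemann_zeta = (SOME g. g holomorphic_on (- {1}) \<and>
      (\<forall>s. 1 < Re s \<longrightarrow> (\<lambda>n. 1 / (of_nat (Suc n)) powr s) sums g s))"

definition divisor_k :: "nat \<Rightarrow> nat \<Rightarrow> nat" where
  "divisor_k k n = card {xs :: nat list. length xs = k \<and> prod_list xs = n}"

text \<open>P_{k-1}(ln y) = res_{s=1} (zeta^k(s) y^(s-1)), for y > 0.\<close>
definition P_kernel :: "nat \<Rightarrow> real \<Rightarrow> complex" where
  "P_kernel k y = residue (\<lambda>s. riemann_zeta s ^ k * (of_real y) powr (s - 1)) 1"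

definition mellin :: "(real \<Rightarrow> complex) \<Rightarrow> complex \<Rightarrow> complex" where
  "mellin f s = integral {0<..} (\<lambda>x. f x * (of_real x) powr (s - 1))"

definition M_class :: "real \<Rightarrow> nat \<Rightarrow> (real \<Rightarrow> complex) set" where
  "M_class \<alpha> m = {f. \<exists>g :: nat \<Rightarrow> real \<Rightarrow> complex.
      (\<forall>x\<ge>0. g 0 x = f x) \<and>
      (\<forall>j\<le>m. continuous_on {0..} (g j)) \<and>
      (\<forall>j<m. \<forall>x\<ge>0. (g j has_vector_derivative g (Suc j) x) (at x within {0..})) \<and>
      (\<forall>j\<le>m. \<exists>C X. \<forall>x\<ge>X. norm (g j x) \<le> C * x powr (- \<alpha> - real j))}"

end

(* The kernel K(x) = (1 - x)_+^(m-1) has the Mellin transform b(s) = B(s, m) = O(|s|^(-m)). By Perron's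
formula and a shift of the line of integration past the pole at s = 1, the bracket of the theorem for
f = K is the inverse Mellin transform of zeta^k(s) b(s) along every line Re s = c with 0 < c < 1:
the residue at 1 is exactly the integral against P_{k-1}. The integral converges absolutely because
zeta(c + it) = O(|t|^theta) for some theta < 1/2 and m >= 1 + k/2, so the bracket is O(x^(-c)) for all
c in (0, 1), and Fourier inversion gives the theorem for K. Taylor's formula at infinity writes f as
a superposition of dilates of K, and Fubini's theorem carries the identity over to f.

The bound for zeta comes from the three lines lemma, between Re s = 1 (Euler-Maclaurin) and Re s = 0
(functional equation and |Gamma(1 + it)|^2 = pi t / sinh(pi t)). The functional equation is proved
first for real s in (-1, 0), from the partial fractions of the hyperbolic cotangent. *)

theory Submission
  imports Defs "HOL-Real_Asymp.Real_Asymp" "HOL-Probability.Characteristic_Functions"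
begin

text \<open>The condition m >= 1 + k/2 is tied to convexity: at Re s = c the zeta function is
  O(|t|^\<theta>) with \<theta> exceeding (1 - c)/2 by as little as desired, hence strictly below
  1/2 for every c > 0, and zeta^k times a transform of order |t|^(-m) is then integrable on that
  line. The obstacle is that f is known only through bounds on finitely many derivatives. Contour
  arguments are therefore confined to the explicit kernel with exponent M = m - 1, and f enters only
  through a density built from its m-th derivative. With x = e^y dilations become translations,
  superpositions of dilates become convolutions, and Mellin transforms become two-sided Laplace
  transforms, so absolute convergence and Fubini suffice. P_{k-1} is never computed as a polynomial:
  its residue is kept as an integral over a circle about 1, whose radius appears as a small loss in
  exponents. Since \<open>riemann_zeta\<close> is selected by a property on the whole punctured
  plane, a continuation to that plane must be exhibited before anything is known about it; the
  functional equation thus serves existence as well as growth.\<close>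

section \<open>Continuation of the zeta function to the half-plane \<open>Re s > -1\<close>\<close>

text \<open>\<open>s - 1\<close> times the error of the trapezoidal rule for \<open>x\<^sup>-\<^sup>s\<close> on \<open>[n+1, n+2]\<close>.\<close>

definition trap_term :: "nat \<Rightarrow> complex \<Rightarrow> complex" where
  "trap_term n s = (s - 1) * (of_nat (Suc n) powr (-s) + of_nat (Suc (Suc n)) powr (-s)) / 2
     + of_nat (Suc (Suc n)) powr (1 - s) - of_nat (Suc n) powr (1 - s)"

text \<open>Two integrations by parts against the Peano kernel (u^2 - u)/2, packaged as the explicit
  antiderivative \<open>H\<close>. Multiplying through by s - 1 clears the denominator of the
  primitive x^(1-s)/(1-s), so that s = 1 needs no separate treatment.\<close>

lemma trapezoid_powr:
  fixes s :: complex and a :: real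
  assumes "a > 0"
  shows "((\<lambda>u. - (s - 1) * s * (s + 1) * of_real ((u\<^sup>2 - u) / 2) * of_real (a + u) powr (- s - 2))
     has_integral ((s - 1) * (of_real a powr (-s) + of_real (a + 1) powr (-s)) / 2
       + of_real (a + 1) powr (1 - s) - of_real a powr (1 - s))) {0..1}"
proof -
  define H :: "complex \<Rightarrow> complex" where
    "H z = (s - 1) * s * ((z\<^sup>2 - z) / 2) * (of_real a + z) powr (- s - 1)
       + (s - 1) * (z - 1 / 2) * (of_real a + z) powr (- s) + (of_real a + z) powr (1 - s)" for z
  have der: "((\<lambda>u. H (of_real u)) has_vector_derivative
      - (s - 1) * s * (s + 1) * of_real ((u\<^sup>2 - u) / 2) * of_real (a + u) powr (- s - 2)) (at u within {0..1})"
    if "u \<in> {0..1}" for u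
  proof -
    define y :: complex where "y = of_real a + of_real u"
    have y: "y \<notin> \<real>\<^sub>\<le>\<^sub>0" "y \<noteq> 0"
      using that assms by (auto simp: y_def complex_nonpos_Reals_iff simp flip: of_real_add)
    define P :: "complex \<Rightarrow> complex \<Rightarrow> complex" where "P w z = (of_real a + z) powr w" for w z
    have d: "(P w has_field_derivative w * y powr (w - 1)) (at (of_real u))" for w
      using y unfolding y_def P_def by (auto intro!: derivative_eq_intros)
    have e: "y powr (- 2 - s) = y powr (- s - 2)" by (rule arg_cong[of _ _ "(powr) y"]) simp
    have Py: "P w (of_real u) = y powr w" for w by (simp add: P_def y_def)
    have HP: "H = (\<lambda>z. (s - 1) * s * ((z\<^sup>2 - z) / 2) * P (- s - 1) z
       + (s - 1) * (z - 1 / 2) * P (- s) z + P (1 - s) z)"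
      by (simp add: H_def P_def fun_eq_iff)
    have "(H has_field_derivative
        (s - 1) * s * ((2 * of_real u - 1) / 2) * y powr (- s - 1)
        + (s - 1) * s * ((of_real u ^ 2 - of_real u) / 2) * ((- s - 1) * y powr (- s - 2))
        + (s - 1) * y powr (- s) + (s - 1) * (of_real u - 1 / 2) * ((- s) * y powr (- s - 1))
        + (1 - s) * y powr (- s)) (at (of_real u))"
      unfolding HP
      by (rule derivative_eq_intros d refl | simp)+
         (simp add: Py e algebra_simps diff_divide_distrib add_divide_distrib power2_eq_square)
    also have "(s - 1) * s * ((2 * of_real u - 1) / 2) * y powr (- s - 1)
        + (s - 1) * s * ((of_real u ^ 2 - of_real u) / 2) * ((- s - 1) * y powr (- s - 2))
        + (s - 1) * y powr (- s) + (s - 1) * (of_real u - 1 / 2) * ((- s) * y powr (- s - 1))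
        + (1 - s) * y powr (- s) =
        - (s - 1) * s * (s + 1) * of_real ((u\<^sup>2 - u) / 2) * y powr (- s - 2)"
      by (simp add: algebra_simps diff_divide_distrib add_divide_distrib)
    finally show ?thesis
      unfolding y_def of_real_add by (intro has_vector_derivative_real_field) (simp add: y_def)
  qed
  have "((\<lambda>u. - (s - 1) * s * (s + 1) * of_real ((u\<^sup>2 - u) / 2) * of_real (a + u) powr (- s - 2))
     has_integral H (of_real 1) - H (of_real 0)) {0..1}"
    by (intro fundamental_theorem_of_calculus der) auto
  also have "H (of_real 1) - H (of_real 0) = (s - 1) * (of_real a powr (-s) + of_real (a + 1) powr (-s)) / 2
       + of_real (a + 1) powr (1 - s) - of_real a powr (1 - s)"
    by (simp add: H_def field_simps)
  finally show ?thesis .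
qed

text \<open>The gain of two powers of n is what makes the series converge for Re s > -1; the price
  is a factor cubic in s.\<close>

lemma norm_trap_term_le:
  assumes "Re s \<ge> -2"
  shows "norm (trap_term n s) \<le> norm (s - 1) * norm s * norm (s + 1) * real (Suc n) powr (- Re s - 2)"
proof -
  have hi: "((\<lambda>u. - (s - 1) * s * (s + 1) * of_real ((u\<^sup>2 - u) / 2) * of_real (real (Suc n) + u) powr (- s - 2))
     has_integral trap_term n s) {0..1}"
    using trapezoid_powr[of "real (Suc n)" s] by (simp add: trap_term_def add_ac)
  have "norm (trap_term n s) \<le> (norm (s - 1) * norm s * norm (s + 1) * real (Suc n) powr (- Re s - 2)) * Henstock_Kurzweil_Integration.content {0..1::real}"
  proof (rule has_integral_bound_real[OF _ finite.emptyI hi])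
    fix u :: real assume "u \<in> {0..1} - {}"
    hence u: "u \<ge> 0" "u \<le> 1" by auto
    have 1: "norm (of_real ((u\<^sup>2 - u) / 2) :: complex) \<le> 1"
    proof -
      have "0 \<le> u\<^sup>2" "u\<^sup>2 \<le> 1" using u by (auto intro: power_le_one)
      moreover have "u - u\<^sup>2 \<le> 2" using u \<open>0 \<le> u\<^sup>2\<close> by linarith
      ultimately show ?thesis unfolding norm_of_real using u by (simp add: abs_le_iff)
    qed
    have "norm (of_real (real (Suc n) + u) powr (- s - 2)) = (real (Suc n) + u) powr (- Re s - 2)"
      using u by (subst norm_powr_real_powr) auto
    also have "\<dots> \<le> real (Suc n) powr (- Re s - 2)"
      using u assms by (intro powr_mono2') auto
    finally have 2: "norm (of_real (real (Suc n) + u) powr (- s - 2)) \<le> real (Suc n) powr (- Re s - 2)" .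
    have "norm (- (s - 1) * s * (s + 1) * of_real ((u\<^sup>2 - u) / 2) * of_real (real (Suc n) + u) powr (- s - 2))
      = (norm (s - 1) * norm s * norm (s + 1)) * (norm (of_real ((u\<^sup>2 - u) / 2) :: complex) *
         norm (of_real (real (Suc n) + u) powr (- s - 2)))"
      by (simp only: norm_mult norm_minus_cancel mult.assoc)
    also have "\<dots> \<le> (norm (s - 1) * norm s * norm (s + 1)) * (1 * real (Suc n) powr (- Re s - 2))"
      by (intro mult_left_mono mult_mono 1 2) auto
    finally show "norm (- (s - 1) * s * (s + 1) * of_real ((u\<^sup>2 - u) / 2) * of_real (real (Suc n) + u) powr (- s - 2))
      \<le> norm (s - 1) * norm s * norm (s + 1) * real (Suc n) powr (- Re s - 2)" by simp
  qed auto
  thus ?thesis by simp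
qed

lemma norm_powr_diff_le:
  assumes "Re s \<ge> 0" "a > 0"
  shows "norm (of_real (a + 1) powr (1 - s) - of_real a powr (1 - s)) \<le> norm (s - 1) * a powr (- Re s)"
proof -
  have der: "((\<lambda>u. (\<lambda>z. (of_real a + z) powr (1 - s)) (of_real u)) has_vector_derivative
      (1 - s) * of_real (a + u) powr (- s)) (at u within {0..1})" if "u \<in> {0..1}" for u
  proof (rule has_vector_derivative_real_field)
    have y: "complex_of_real a + of_real u \<notin> \<real>\<^sub>\<le>\<^sub>0"
      using that assms by (auto simp: complex_nonpos_Reals_iff)
    show "((\<lambda>z. (of_real a + z) powr (1 - s)) has_field_derivative (1 - s) * of_real (a + u) powr (- s)) (at (of_real u))"
      using y by (auto intro!: derivative_eq_intros)
  qed
  have hi: "((\<lambda>u. (1 - s) * of_real (a + u) powr (- s)) has_integral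
     of_real (a + 1) powr (1 - s) - of_real a powr (1 - s)) {0..1}"
    using fundamental_theorem_of_calculus[OF _ der] by simp
  have "norm (of_real (a + 1) powr (1 - s) - of_real a powr (1 - s))
      \<le> (norm (s - 1) * a powr (- Re s)) * Henstock_Kurzweil_Integration.content {0..1::real}"
  proof (rule has_integral_bound_real[OF _ finite.emptyI hi])
    fix u :: real assume "u \<in> {0..1} - {}"
    hence u: "u \<ge> 0" "u \<le> 1" by auto
    have "norm ((1 - s) * of_real (a + u) powr (- s)) = norm (s - 1) * (a + u) powr (- Re s)"
      using u assms by (subst norm_mult, subst norm_powr_real_powr) (auto simp: norm_minus_commute)
    also have "\<dots> \<le> norm (s - 1) * a powr (- Re s)"
      using u assms by (intro mult_left_mono powr_mono2') auto
    finally show "norm ((1 - s) * of_real (a + u) powr (- s)) \<le> norm (s - 1) * a powr (- Re s)" .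
  qed auto
  thus ?thesis by simp
qed

text \<open>The opposite trade-off to \<open>norm_trap_term_le\<close>: estimating the pieces of the
  trapezoidal rule separately is only linear in s, but gains no power of n. Near Re s = 1 the two
  bounds are interpolated.\<close>

lemma norm_trap_term_le':
  assumes "Re s \<ge> 0"
  shows "norm (trap_term n s) \<le> 2 * norm (s - 1) * real (Suc n) powr (- Re s)"
proof -
  have 1: "norm (of_nat (Suc (Suc n)) powr (1 - s) - of_nat (Suc n) powr (1 - s)) \<le> norm (s - 1) * real (Suc n) powr (- Re s)"
    using norm_powr_diff_le[OF assms, of "real (Suc n)"] by (simp add: add_ac)
  have n: "norm (of_nat (Suc k) powr (-s)) = real (Suc k) powr (- Re s)" for k
    using norm_powr_real_powr[of "of_nat (Suc k)" "-s"] by (simp del: of_nat_Suc)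
  have "norm (of_nat (Suc n) powr (-s) + of_nat (Suc (Suc n)) powr (-s)) \<le> real (Suc n) powr (- Re s) + real (Suc (Suc n)) powr (- Re s)"
    by (rule order.trans[OF norm_triangle_ineq]) (simp only: n order.refl)
  also have "\<dots> \<le> 2 * real (Suc n) powr (- Re s)"
    using powr_mono2'[of "- Re s" "real (Suc n)" "real (Suc (Suc n))"] assms by simp
  finally have 2: "norm (of_nat (Suc n) powr (-s) + of_nat (Suc (Suc n)) powr (-s)) \<le> 2 * real (Suc n) powr (- Re s)" .
  have "norm (trap_term n s) \<le> norm ((s - 1) / 2 * (of_nat (Suc n) powr (-s) + of_nat (Suc (Suc n)) powr (-s)))
     + norm (of_nat (Suc (Suc n)) powr (1 - s) - of_nat (Suc n) powr (1 - s))"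
    unfolding trap_term_def
    by (rule order.trans[OF _ norm_triangle_ineq]) (simp add: algebra_simps add_divide_distrib diff_divide_distrib)
  also have "\<dots> \<le> norm (s - 1) / 2 * (2 * real (Suc n) powr (- Re s)) + norm (s - 1) * real (Suc n) powr (- Re s)"
    using 2 by (intro add_mono 1) (simp only: norm_mult norm_divide, intro mult_mono, auto)
  finally show ?thesis by simp
qed

lemma summable_powr_Suc: "x < -1 \<Longrightarrow> summable (\<lambda>n. real (Suc n) powr x)"
  by (subst summable_Suc_iff[of "\<lambda>n. real n powr x"]) (simp add: summable_real_powr_iff)

text \<open>Equal to \<open>(s - 1) \<zeta>(s)\<close> by the Euler--Maclaurin formula.\<close>

definition reg_zeta :: "complex \<Rightarrow> complex" where
  "reg_zeta s = (s + 1) / 2 + (\<Sum>n. trap_term n s)"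

lemma summable_trap_term:
  assumes "Re s > -1"
  shows "summable (\<lambda>n. norm (trap_term n s))" "summable (\<lambda>n. trap_term n s)"
proof -
  show 1: "summable (\<lambda>n. norm (trap_term n s))"
    by (rule summable_comparison_test'[OF summable_mult[OF summable_powr_Suc[of "- Re s - 2"]], where N = 0])
      (use assms norm_trap_term_le[of s] in auto)
  show "summable (\<lambda>n. trap_term n s)" by (rule summable_norm_cancel[OF 1])
qed

lemma holomorphic_trap_term: "trap_term n holomorphic_on A"
  unfolding trap_term_def by (intro holomorphic_intros) auto

lemma holomorphic_reg_zeta: "reg_zeta holomorphic_on {s. Re s > -1}"
proof -
  have "(\<lambda>s. \<Sum>n. trap_term n s) holomorphic_on {s. Re s > -1}"
  proof (rule holomorphic_uniform_sequence[where f = "\<lambda>N s. \<Sum>n<N. trap_term n s"])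
    fix x assume x: "x \<in> {s. Re s > -1}"
    \<comment> \<open>Half the distance to the line Re s = -1, so that on the disc the terms are
      O(n^(-1-d)) uniformly.\<close>
    define d where "d = (Re x + 1) / 2"
    have d: "d > 0" using x by (simp add: d_def)
    have re: "Re s \<ge> -1 + d" if "s \<in> cball x d" for s
      using that complex_Re_le_cmod[of "x - s"] by (auto simp: dist_norm d_def field_simps)
    define B where "B = (norm x + d + 1)"
    have "uniform_limit (cball x d) (\<lambda>N s. \<Sum>n<N. trap_term n s) (\<lambda>s. \<Sum>n. trap_term n s) sequentially"
    proof (rule Weierstrass_m_test)
      show "norm (trap_term n s) \<le> B ^ 3 * real (Suc n) powr (- 1 - d)" if s: "s \<in> cball x d" for n s
      proof -
        have ns: "norm s \<le> norm x + d" using s norm_triangle_sub[of s x] by (simp add: dist_norm norm_minus_commute)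
        have "norm (trap_term n s) \<le> norm (s - 1) * norm s * norm (s + 1) * real (Suc n) powr (- Re s - 2)"
          using re[OF s] d by (intro norm_trap_term_le) auto
        also have "\<dots> \<le> (B * B * B) * real (Suc n) powr (- 1 - d)"
        proof -
          have "norm (s - 1) \<le> B" "norm s \<le> B" "norm (s + 1) \<le> B" "B \<ge> 0"
            using ns norm_triangle_ineq4[of s 1] norm_triangle_ineq[of s 1] d by (auto simp: B_def)
          thus ?thesis using re[OF s] by (intro mult_mono powr_mono) auto
        qed
        finally show ?thesis by (simp add: power3_eq_cube)
      qed
      show "summable (\<lambda>n. B ^ 3 * real (Suc n) powr (- 1 - d))"
        using d by (intro summable_mult summable_powr_Suc) auto
    qed
    moreover have "cball x d \<subseteq> {s. Re s > -1}" using re d by force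
    ultimately show "\<exists>d>0. cball x d \<subseteq> {s. Re s > -1} \<and>
        uniform_limit (cball x d) (\<lambda>N s. \<Sum>n<N. trap_term n s) (\<lambda>s. \<Sum>n. trap_term n s) sequentially"
      using d by blast
  qed (auto intro!: open_halfspace_Re_gt holomorphic_on_sum holomorphic_trap_term)
  thus ?thesis unfolding reg_zeta_def by (intro holomorphic_intros) auto
qed

text \<open>The powers with exponent 1 - s telescope, and an interior node belongs to two
  neighbouring trapezoids, so that half weights survive only at the two ends.\<close>

lemma sum_trap_term:
  "(\<Sum>n<N. trap_term n s) = (s - 1) * ((\<Sum>n<N. of_nat (Suc n) powr (-s)) - 1 / 2 + of_nat (Suc N) powr (-s) / 2)
     + of_nat (Suc N) powr (1 - s) - 1"
proof (induction N)
  case (Suc N)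
  have "T + ((s - 1) * (a + b) / 2 + d - c) = (s - 1) * ((S + a) - 1 / 2 + b / 2) + d - 1"
    if "T = (s - 1) * (S - 1 / 2 + a / 2) + c - 1" for a b c d S T
    unfolding that by (simp add: algebra_simps add_divide_distrib diff_divide_distrib)
  from this[OF Suc.IH] show ?case by (simp only: sum.lessThan_Suc trap_term_def)
qed (simp add: field_simps)

lemma reg_zeta_dirichlet:
  assumes "Re s > 1"
  shows "(\<lambda>n. 1 / of_nat (Suc n) powr s) sums (reg_zeta s / (s - 1))"
proof -
  have s: "s \<noteq> 1" using assms by auto
  have t0: "(\<lambda>N. of_nat (Suc N) powr w) \<longlonglongrightarrow> 0" if "Re w < 0" for w
  proof (rule tendsto_norm_zero_cancel)
    have "(\<lambda>N. real (Suc N) powr Re w) \<longlonglongrightarrow> 0"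
      using that by real_asymp
    thus "(\<lambda>N. norm (of_nat (Suc N) powr w)) \<longlonglongrightarrow> 0"
      using norm_powr_real_powr[of "of_nat (Suc N)" w for N] by (simp del: of_nat_Suc)
  qed
  have "(\<lambda>N. \<Sum>n<N. trap_term n s) \<longlonglongrightarrow> (\<Sum>n. trap_term n s)"
    using summable_trap_term(2)[of s] assms summable_LIMSEQ by auto
  hence "(\<lambda>N. ((\<Sum>n<N. trap_term n s) - of_nat (Suc N) powr (1 - s) + 1) / (s - 1) + 1 / 2 - of_nat (Suc N) powr (-s) / 2)
     \<longlonglongrightarrow> ((\<Sum>n. trap_term n s) - 0 + 1) / (s - 1) + 1 / 2 - 0 / 2"
    using assms s by (intro tendsto_intros t0) auto
  also have "(\<lambda>N. ((\<Sum>n<N. trap_term n s) - of_nat (Suc N) powr (1 - s) + 1) / (s - 1) + 1 / 2 - of_nat (Suc N) powr (-s) / 2)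
     = (\<lambda>N. \<Sum>n<N. of_nat (Suc n) powr (-s))"
    using s by (simp add: sum_trap_term field_simps fun_eq_iff)
  also have "((\<Sum>n. trap_term n s) - 0 + 1) / (s - 1) + 1 / 2 - 0 / 2 = reg_zeta s / (s - 1)"
    using s by (simp add: reg_zeta_def field_simps)
  finally show ?thesis by (simp add: sums_def powr_minus_divide)
qed

text \<open>Each term is at most the weighted geometric mean, with weights 1 - l and l for l =
  \<delta>/2, of the bounds t/N and (t/N)^3 (up to a constant). This equals t^(1+\<delta>)
  N^(-1-2l): summable in N at the cost of an arbitrarily small power of t. The constant 162
  dominates both 6 and 27, which come from |s|, |s+1|, |s-1| <= 3t.\<close>

lemma reg_zeta_bound_right:
  assumes "\<delta> > 0" "\<delta> \<le> 1"
  obtains C where "C > 0" "\<And>s. 1 \<le> Re s \<Longrightarrow> Re s \<le> 2 \<Longrightarrow> norm (reg_zeta s) \<le> C * (1 + \<bar>Im s\<bar>) powr (1 + \<delta>)"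
proof -
  define l where "l = \<delta> / 2"
  have l: "l > 0" "l < 1" using assms by (auto simp: l_def)
  define S where "S = (\<Sum>n. real (Suc n) powr (-1 - 2 * l))"
  have summ: "summable (\<lambda>n. real (Suc n) powr (-1 - 2 * l))" using l by (intro summable_powr_Suc) auto
  have S: "S \<ge> 0" unfolding S_def by (intro suminf_nonneg summ) auto
  show ?thesis
  proof (rule that[of "2 + 2 * 9 * 9 * S"])
    show "2 + 2 * 9 * 9 * S > 0" using S by simp
    fix s assume s: "1 \<le> Re s" "Re s \<le> 2"
    define t where "t = 1 + \<bar>Im s\<bar>"
    have t: "t \<ge> 1" by (simp add: t_def)
    have ns: "norm s \<le> 3 * t" "norm (s + 1) \<le> 3 * t" "norm (s - 1) \<le> 3 * t"
      using cmod_le[of s] cmod_le[of "s + 1"] cmod_le[of "s - 1"] s by (auto simp: t_def)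
    have T: "norm (trap_term n s) \<le> 2 * 9 * 9 * t powr (1 + \<delta>) * real (Suc n) powr (-1 - 2 * l)" for n
    proof -
      define N where "N = real (Suc n)"
      have N: "N \<ge> 1" by (simp add: N_def)
      have p: "N powr (- Re s) \<le> N powr (-1)" "N powr (- Re s - 2) \<le> N powr (-3)" using N s powr_mono[of "- Re s" "-1" N] powr_mono[of "- Re s - 2" "-3" N] by auto
      define A where "A = norm (trap_term n s)"
      have a1: "A \<le> 162 * (t powr 1 * N powr (-1))"
      proof -
        have "A \<le> 2 * norm (s - 1) * N powr (- Re s)" unfolding A_def N_def using s by (intro norm_trap_term_le') auto
        also have "\<dots> \<le> 2 * (3 * t) * N powr (-1)" using ns p t by (intro mult_mono) auto
        also have "\<dots> \<le> 162 * (t powr 1 * N powr (-1))" using t mult_right_mono[of "2 * (3 * t)" "162 * t" "N powr (-1)"] by simp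
        finally show ?thesis .
      qed
      have a2: "A \<le> 162 * (t powr 3 * N powr (-3))"
      proof -
        have "A \<le> norm (s - 1) * norm s * norm (s + 1) * N powr (- Re s - 2)" unfolding A_def N_def using s by (intro norm_trap_term_le) auto
        also have "\<dots> \<le> (3 * t) * (3 * t) * (3 * t) * N powr (-3)" using ns p t by (intro mult_mono) auto
        also have "\<dots> = 27 * (t powr 3 * N powr (-3))" using t by (simp add: power3_eq_cube)
        also have "\<dots> \<le> 162 * (t powr 3 * N powr (-3))" by (intro mult_right_mono) auto
        finally show ?thesis .
      qed
      define B where "B = A / 162"
      have B: "B \<ge> 0" "B \<le> t powr 1 * N powr (-1)" "B \<le> t powr 3 * N powr (-3)"
      proof -
        have "B \<le> X" if "A \<le> 162 * X" for X using that by (simp add: B_def)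
        from this[OF a1] this[OF a2] show "B \<le> t powr 1 * N powr (-1)" "B \<le> t powr 3 * N powr (-3)" .
      qed (simp add: B_def A_def)
      have pm: "(t powr x * N powr y) powr z = t powr (x * z) * N powr (y * z)" for x y z
        by (subst powr_mult) (auto simp: powr_powr)
      have "B = B powr ((1 - l) + l)" using B by simp
      also have "\<dots> = B powr (1 - l) * B powr l" by (rule powr_add)
      also have "\<dots> \<le> (t powr 1 * N powr (-1)) powr (1 - l) * (t powr 3 * N powr (-3)) powr l"
        by (intro mult_mono powr_mono2 B) (use l in auto)
      also have "\<dots> = t powr ((1 - l) + 3 * l) * N powr (- (1 - l) + (-3) * l)"
        unfolding pm powr_add by simp
      also have "\<dots> = t powr (1 + \<delta>) * N powr (-1 - 2 * l)"
        by (intro arg_cong2[where f = "(*)"] arg_cong2[where f = "(powr)"] refl) (simp_all add: l_def)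
      finally have "A \<le> 162 * (t powr (1 + \<delta>) * N powr (-1 - 2 * l))"
        by (simp add: B_def)
      thus ?thesis by (simp add: A_def N_def)
    qed
    have "norm (\<Sum>n. trap_term n s) \<le> (\<Sum>n. norm (trap_term n s))"
      using s by (intro summable_norm summable_trap_term) auto
    also have "\<dots> \<le> (\<Sum>n. 2 * 9 * 9 * t powr (1 + \<delta>) * real (Suc n) powr (-1 - 2 * l))"
      using s T by (intro suminf_le summable_trap_term summable_mult summ) auto
    also have "\<dots> = 2 * 9 * 9 * t powr (1 + \<delta>) * S"
      unfolding S_def by (intro suminf_mult summ)
    finally have 1: "norm (\<Sum>n. trap_term n s) \<le> 2 * 9 * 9 * t powr (1 + \<delta>) * S" .
    have "norm ((s + 1) / 2) \<le> 2 * t" using ns t by (simp add: norm_divide)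
    also have "\<dots> \<le> 2 * t powr (1 + \<delta>)" using t assms powr_mono[of 1 "1 + \<delta>" t] by simp
    finally have 2: "norm ((s + 1) / 2) \<le> 2 * t powr (1 + \<delta>)" .
    show "norm (reg_zeta s) \<le> (2 + 2 * 9 * 9 * S) * (1 + \<bar>Im s\<bar>) powr (1 + \<delta>)"
      unfolding reg_zeta_def using norm_triangle_ineq[of "(s + 1) / 2" "\<Sum>n. trap_term n s"] 1 2
      by (simp add: t_def algebra_simps)
  qed
qed

text \<open>The exponent 3 is far from optimal. The bound serves as the a priori polynomial growth
  that lets a Gaussian factor force decay at the ends of the strip, and it covers small heights on
  the imaginary axis.\<close>

lemma reg_zeta_bound_strip:
  obtains C where "C > 0" "\<And>s. 0 \<le> Re s \<Longrightarrow> Re s \<le> 1 \<Longrightarrow> norm (reg_zeta s) \<le> C * (1 + \<bar>Im s\<bar>) ^ 3"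
proof -
  define S where "S = (\<Sum>n. real (Suc n) powr (-2))"
  have summ: "summable (\<lambda>n. real (Suc n) powr (-2))" by (intro summable_powr_Suc) auto
  have S: "S \<ge> 0" unfolding S_def by (intro suminf_nonneg summ) auto
  show ?thesis
  proof (rule that[of "2 + 8 * S"])
    show "2 + 8 * S > 0" using S by simp
    fix s assume s: "0 \<le> Re s" "Re s \<le> 1"
    define t where "t = 1 + \<bar>Im s\<bar>"
    have t: "t \<ge> 1" by (simp add: t_def)
    have ns: "norm s \<le> 2 * t" "norm (s + 1) \<le> 2 * t" "norm (s - 1) \<le> 2 * t"
      using cmod_le[of s] cmod_le[of "s + 1"] cmod_le[of "s - 1"] s by (auto simp: t_def)
    have T: "norm (trap_term n s) \<le> 8 * t ^ 3 * real (Suc n) powr (-2)" for n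
    proof -
      have "norm (trap_term n s) \<le> norm (s - 1) * norm s * norm (s + 1) * real (Suc n) powr (- Re s - 2)"
        using s by (intro norm_trap_term_le) auto
      also have "\<dots> \<le> (2 * t) * (2 * t) * (2 * t) * real (Suc n) powr (-2)"
        using ns t s by (intro mult_mono powr_mono) auto
      finally show ?thesis by (simp add: power3_eq_cube)
    qed
    have "norm (\<Sum>n. trap_term n s) \<le> (\<Sum>n. norm (trap_term n s))"
      using s by (intro summable_norm summable_trap_term) auto
    also have "\<dots> \<le> (\<Sum>n. 8 * t ^ 3 * real (Suc n) powr (-2))"
      using s T by (intro suminf_le summable_trap_term summable_mult summ) auto
    also have "\<dots> = 8 * t ^ 3 * S"
      unfolding S_def by (intro suminf_mult summ)
    finally have 1: "norm (\<Sum>n. trap_term n s) \<le> 8 * t ^ 3 * S" .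
    have "norm ((s + 1) / 2) \<le> 2 * t ^ 1" using ns t by (simp add: norm_divide)
    also have "\<dots> \<le> 2 * t ^ 3" using t by (intro mult_left_mono power_increasing) auto
    finally have 2: "norm ((s + 1) / 2) \<le> 2 * t ^ 3" .
    show "norm (reg_zeta s) \<le> (2 + 8 * S) * (1 + \<bar>Im s\<bar>) ^ 3"
      unfolding reg_zeta_def using norm_triangle_ineq[of "(s + 1) / 2" "\<Sum>n. trap_term n s"] 1 2
      by (simp add: t_def algebra_simps)
  qed
qed

section \<open>The functional equation\<close>

text \<open>The logarithmic derivative of the reflection formula at an imaginary argument.\<close>

lemma coth_partial_fractions:
  fixes x :: real
  assumes "x > 0"
  shows "(\<lambda>k. 2 * x / (x\<^sup>2 + (2 * pi * real (Suc k))\<^sup>2)) sums (1 / (exp x - 1) + 1 / 2 - 1 / x)"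
proof -
  \<comment> \<open>At this point sin(pi z) is i sinh(x/2), so sine and cosine become expressions in
    E = exp(x/2).\<close>
  define z :: complex where "z = \<i> * of_real (x / (2 * pi))"
  have z: "z \<noteq> 0" "Re z = 0" using assms by (auto simp: z_def complex_eq_iff)
  have n1: "1 + z \<notin> \<int>\<^sub>\<le>\<^sub>0" "1 - z \<notin> \<int>\<^sub>\<le>\<^sub>0"
    using z by (auto simp: complex_eq_iff elim!: nonpos_Ints_cases')
  have n2: "1 + z \<noteq> 0" "1 - z \<noteq> 0" using n1 by auto
  have refl1: "w * (rGamma (1 + w) * rGamma (1 - w)) = sin (of_real pi * w) / of_real pi" for w :: complex
    using rGamma_reflection_complex[of w] rGamma_plus1[of w] by (simp add: add_ac flip: mult.assoc)
  define S where "S = sin (of_real pi * z)"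
  define C where "C = cos (of_real pi * z)"
  define D where "D = Digamma (1 + z) - Digamma (1 - z)"
  \<comment> \<open>The function w / (Gamma(1+w) Gamma(1-w)) is differentiated twice over: through
    the digamma function, and through its closed form sin(pi w)/pi. Comparing the results expresses
    \<open>D\<close> by the cotangent.\<close>
  have "((\<lambda>w. w * (rGamma (1 + w) * rGamma (1 - w))) has_field_derivative
     rGamma (1 + z) * rGamma (1 - z) - z * (rGamma (1 + z) * rGamma (1 - z)) * D) (at z)"
    using n1 by (auto intro!: derivative_eq_intros simp: D_def algebra_simps)
  moreover have "((\<lambda>w. w * (rGamma (1 + w) * rGamma (1 - w))) has_field_derivative C) (at z)"
    unfolding refl1 by (auto intro!: derivative_eq_intros simp: C_def)
  ultimately have "rGamma (1 + z) * rGamma (1 - z) - z * (rGamma (1 + z) * rGamma (1 - z)) * D = C"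
    by (rule DERIV_unique)
  hence "z * (rGamma (1 + z) * rGamma (1 - z) - z * (rGamma (1 + z) * rGamma (1 - z)) * D) = z * C" by simp
  hence "z * (rGamma (1 + z) * rGamma (1 - z)) - z * (z * (rGamma (1 + z) * rGamma (1 - z))) * D = z * C"
    by (simp only: right_diff_distrib mult.assoc)
  hence 1: "S / of_real pi - z * (S / of_real pi) * D = z * C"
    unfolding refl1 S_def .
  define E :: complex where "E = exp (of_real (x / 2))"
  have E: "E \<noteq> 0" by (simp add: E_def)
  have E2: "E * E = of_real (exp x)" by (simp add: E_def flip: exp_add exp_of_real)
  have expz: "exp (\<i> * (of_real pi * z)) = inverse E" "exp (- (\<i> * (of_real pi * z))) = E"
    by (simp_all add: z_def E_def exp_minus)
  have SC: "S = (inverse E - E) / (2 * \<i>)" "C = (inverse E + E) / 2"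
    unfolding S_def C_def sin_exp_eq cos_exp_eq using expz by simp_all
  have ex: "exp x \<noteq> 1" using assms by simp
  hence EE: "E * E \<noteq> 1" unfolding E2 by (metis of_real_eq_1_iff)
  have S0: "S \<noteq> 0" using E EE by (auto simp: SC field_simps)
  have D: "D = 1 / z - of_real pi * C / S"
    using 1 S0 z by (simp add: field_simps)
  \<comment> \<open>In the difference of the two digamma series the terms 1/(k+1) cancel, and the
    pair 1/(N-z) - 1/(N+z) with N = k + 1 equals 2z/(N^2 - z^2). Here -z^2 = x^2/(4 pi^2), and the
    factor -i/(2 pi) makes the result real.\<close>
  have sums1: "(\<lambda>k. (inverse (of_nat (Suc k)) - inverse (1 - z + of_nat k)) - (inverse (of_nat (Suc k)) - inverse (1 + z + of_nat k)))
     sums ((\<Sum>k. inverse (of_nat (Suc k)) - inverse (1 - z + of_nat k)) - (\<Sum>k. inverse (of_nat (Suc k)) - inverse (1 + z + of_nat k)))"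
    by (intro sums_diff summable_sums summable_Digamma n2)
  have "(\<lambda>k. (inverse (1 - z + of_nat k) - inverse (1 + z + of_nat k))) sums D"
  proof -
    have "(\<lambda>k. - ((inverse (of_nat (Suc k)) - inverse (1 - z + of_nat k)) - (inverse (of_nat (Suc k)) - inverse (1 + z + of_nat k))))
     sums D" using sums_minus[OF sums1] by (simp add: D_def Digamma_def)
    thus ?thesis by (simp add: algebra_simps)
  qed
  hence "(\<lambda>k. (- \<i> / (2 * of_real pi)) * ((inverse (1 - z + of_nat k) - inverse (1 + z + of_nat k)))) sums ((- \<i> / (2 * of_real pi)) * D)"
    by (rule sums_mult)
  also have "(\<lambda>k. (- \<i> / (2 * of_real pi)) * ((inverse (1 - z + of_nat k) - inverse (1 + z + of_nat k))))
     = (\<lambda>k. of_real (2 * x / (x\<^sup>2 + (2 * pi * real (Suc k))\<^sup>2)))"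
  proof
    fix k
    define N :: complex where "N = 1 + of_nat k"
    have nz: "N - z \<noteq> 0" "N + z \<noteq> 0"
      using z by (auto simp: complex_eq_iff N_def add_eq_0_iff)
    have zz: "z * z = - (of_real x)\<^sup>2 / (4 * of_real pi ^ 2)"
      by (simp add: z_def power2_eq_square field_simps)
    have pos: "x\<^sup>2 + (2 * pi * real (Suc k))\<^sup>2 \<noteq> 0" using assms by (simp add: add_nonneg_eq_0_iff)
    have "(- \<i> / (2 * of_real pi)) * ((inverse (1 - z + of_nat k) - inverse (1 + z + of_nat k)))
       = (- \<i> / (2 * of_real pi)) * (2 * z / (N * N - z * z))"
      using nz by (simp add: N_def field_simps)
    also have "\<dots> = of_real (2 * x / (x\<^sup>2 + (2 * pi * real (Suc k))\<^sup>2))"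
    proof -
      have q: "N * N - z * z = of_real ((x\<^sup>2 + (2 * pi * real (Suc k))\<^sup>2) / (4 * pi\<^sup>2))"
        unfolding zz N_def by (simp add: field_simps power2_eq_square)
      show ?thesis unfolding q using pos
        by (simp add: z_def divide_simps del: of_real_add of_real_power) (simp add: field_simps power2_eq_square)
    qed
    finally show "(- \<i> / (2 * of_real pi)) * ((inverse (1 - z + of_nat k) - inverse (1 + z + of_nat k)))
      = of_real (2 * x / (x\<^sup>2 + (2 * pi * real (Suc k))\<^sup>2))" .
  qed
  also have "(- \<i> / (2 * of_real pi)) * D = of_real (1 / (exp x - 1) + 1 / 2 - 1 / x)"
  proof -
    have "C / S = \<i> * ((1 + E * E) / (1 - E * E))"
      using E EE by (simp add: SC field_simps)
    hence CS: "C / S = \<i> * of_real ((1 + exp x) / (1 - exp x))" unfolding E2 by simp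
    have "(- \<i> / (2 * of_real pi)) * D = - (\<i> / (2 * of_real pi * z)) + \<i> / 2 * (C / S)"
      unfolding D by (simp add: field_simps)
    also have "\<i> / (2 * of_real pi * z) = of_real (1 / x)"
      using assms by (simp add: z_def field_simps)
    also have "- of_real (1 / x) + \<i> / 2 * (C / S) = of_real (- (1 / x) - (1 + exp x) / (1 - exp x) / 2)"
    proof -
      define r where "r = (1 + exp x) / (1 - exp x)"
      show ?thesis unfolding CS r_def[symmetric] by simp
    qed
    also have "- (1 / x) - (1 + exp x) / (1 - exp x) / 2 = 1 / (exp x - 1) + 1 / 2 - 1 / x"
      using ex assms by (simp add: divide_simps) (simp add: algebra_simps)
    finally show ?thesis .
  qed
  finally show ?thesis by (simp only: sums_of_real_iff)
qed

section \<open>Gamma and exponential integrals for the Tonelli argument\<close>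

lemma Gamma_scaled_has_integral:
  fixes p c :: real
  assumes "p > 0" "c > 0"
  shows "((\<lambda>t. t powr (p - 1) * exp (- c * t)) has_integral Gamma p * c powr (- p)) {0<..}"
proof -
  have "((\<lambda>t. t powr (p - 1) / exp t) has_integral Gamma p) {0<..}"
  proof -
    have "((\<lambda>t. t powr (p - 1) / exp t) has_integral Gamma p) {0..}" by (rule Gamma_integral_real) fact
    hence "((\<lambda>t. if t \<in> {0<..} then t powr (p - 1) / exp t else 0) has_integral Gamma p) {0..}"
      by (rule has_integral_spike [of "{0}", rotated 2]) auto
    thus ?thesis by (subst (asm) has_integral_restrict) auto
  qed
  hence "(\<lambda>t. t powr (p - 1) / exp t) absolutely_integrable_on {0<..} \<and> integral {0<..} (\<lambda>t. t powr (p - 1) / exp t) = Gamma p"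
    by (auto intro!: nonnegative_absolutely_integrable_1 simp: has_integral_iff)
  moreover have "(\<lambda>t. c * t) ` {0<..} = {0<..}"
  proof -
    have "x \<in> (\<lambda>t. c * t) ` {0<..}" if "x > 0" for x
      using that assms by (intro image_eqI[of _ _ "x / c"]) auto
    thus ?thesis using assms by auto
  qed
  ultimately have "(\<lambda>t. \<bar>c\<bar> * ((c * t) powr (p - 1) / exp (c * t))) absolutely_integrable_on {0<..} \<and>
     integral {0<..} (\<lambda>t. \<bar>c\<bar> * ((c * t) powr (p - 1) / exp (c * t))) = Gamma p"
    using assms by (subst has_absolute_integral_change_of_variables_1'[where g = "\<lambda>t. c * t"])
       (auto intro!: derivative_eq_intros inj_onI)
  hence "((\<lambda>t. \<bar>c\<bar> * ((c * t) powr (p - 1) / exp (c * t))) has_integral Gamma p) {0<..}"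
    using has_integral_iff set_lebesgue_integral_eq_integral(1) by blast
  hence "((\<lambda>t. c powr (-p) * (\<bar>c\<bar> * ((c * t) powr (p - 1) / exp (c * t)))) has_integral c powr (-p) * Gamma p) {0<..}"
    by (rule has_integral_mult_right)
  also have "?this \<longleftrightarrow> ?thesis"
    unfolding mult.commute[of "c powr (-p)" "Gamma p"]
  proof (rule has_integral_cong)
    fix t :: real assume "t \<in> {0<..}"
    hence "c powr (- p) * (\<bar>c\<bar> * ((c * t) powr (p - 1) / exp (c * t))) =
       (c powr (- p) * c powr 1 * c powr (p - 1)) * t powr (p - 1) * exp (- c * t)"
      using assms by (simp add: powr_mult exp_minus field_simps)
    also have "c powr (- p) * c powr 1 * c powr (p - 1) = 1"
      using assms unfolding powr_add[symmetric] by simp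
    finally show "c powr (- p) * (\<bar>c\<bar> * ((c * t) powr (p - 1) / exp (c * t))) = t powr (p - 1) * exp (- c * t)"
      by simp
  qed
  finally show ?thesis .
qed

text \<open>The substitution t = x^2 in the scaled Gamma integral. It evaluates the inner integral
  once 1/(x^2 + a^2) has been written as a Laplace integral in v.\<close>

lemma Gamma_square_has_integral:
  fixes \<sigma> v :: real
  assumes "\<sigma> > -1" "v > 0"
  shows "((\<lambda>x. 2 * x powr \<sigma> * exp (- v * x\<^sup>2)) has_integral Gamma ((\<sigma> + 1) / 2) * v powr (- (\<sigma> + 1) / 2)) {0<..}"
proof -
  define p where "p = (\<sigma> + 1) / 2"
  have p: "p > 0" using assms by (simp add: p_def)
  have "(\<lambda>t. t powr (p - 1) * exp (- v * t)) absolutely_integrable_on {0<..} \<and>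
     integral {0<..} (\<lambda>t. t powr (p - 1) * exp (- v * t)) = Gamma p * v powr (- p)"
    using Gamma_scaled_has_integral[OF p assms(2)]
    by (auto intro!: nonnegative_absolutely_integrable_1 simp: has_integral_iff)
  moreover have "(\<lambda>t::real. t\<^sup>2) ` {0<..} = {0<..}"
  proof -
    have "x \<in> (\<lambda>t. t\<^sup>2) ` {0<..}" if "x > 0" for x :: real
      using that by (intro image_eqI[of _ _ "sqrt x"]) auto
    thus ?thesis by auto
  qed
  ultimately have "(\<lambda>t. \<bar>2 * t\<bar> * ((t\<^sup>2) powr (p - 1) * exp (- v * t\<^sup>2))) absolutely_integrable_on {0<..} \<and>
     integral {0<..} (\<lambda>t. \<bar>2 * t\<bar> * ((t\<^sup>2) powr (p - 1) * exp (- v * t\<^sup>2))) = Gamma p * v powr (- p)"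
    by (subst has_absolute_integral_change_of_variables_1'[where g = "\<lambda>t. t\<^sup>2"])
       (auto intro!: derivative_eq_intros inj_onI)
  hence "((\<lambda>t. \<bar>2 * t\<bar> * ((t\<^sup>2) powr (p - 1) * exp (- v * t\<^sup>2))) has_integral Gamma p * v powr (- p)) {0<..}"
    using has_integral_iff set_lebesgue_integral_eq_integral(1) by blast
  also have "?this \<longleftrightarrow> ?thesis"
    unfolding p_def minus_divide_left
  proof (rule has_integral_cong)
    fix t :: real assume t: "t \<in> {0<..}"
    have "t powr 1 * (t powr 2) powr ((\<sigma> + 1) / 2 - 1) = t powr \<sigma>"
      unfolding powr_powr powr_add[symmetric] by (simp add: field_simps)
    thus "\<bar>2 * t\<bar> * ((t\<^sup>2) powr ((\<sigma> + 1) / 2 - 1) * exp (- v * t\<^sup>2)) = 2 * t powr \<sigma> * exp (- v * t\<^sup>2)"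
      using t by simp
  qed
  finally show ?thesis .
qed

text \<open>The Laplace transform of the Peano kernel on one period. Divided by 1 - e^(-x), which
  sums over all periods, the numerator becomes 1/(e^x - 1) + 1/2 - 1/x.\<close>

lemma exp_parabola_has_integral:
  fixes x :: real
  assumes "x > 0"
  shows "((\<lambda>u. (u - u\<^sup>2) / 2 * exp (- x * u)) has_integral ((1 + exp (-x)) / 2 - (1 - exp (-x)) / x) / x\<^sup>2) {0..1}"
proof -
  define H where "H u = - (((u - u\<^sup>2) / 2) / x + ((1 - 2 * u) / 2) / x^2 - 1 / x^3) * exp (- x * u)" for u
  have "((\<lambda>u. (u - u\<^sup>2) / 2 * exp (- x * u)) has_integral H 1 - H 0) {0..1}"
  proof (intro fundamental_theorem_of_calculus)
    fix u :: real
    have "(H has_field_derivative (u - u\<^sup>2) / 2 * exp (- x * u)) (at u within {0..1})"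
      unfolding H_def using assms
      by (auto intro!: derivative_eq_intros simp: field_simps power2_eq_square power3_eq_cube)
    thus "(H has_vector_derivative (u - u\<^sup>2) / 2 * exp (- x * u)) (at u within {0..1})"
      by (simp add: has_real_derivative_iff_has_vector_derivative)
  qed auto
  also have "H 1 - H 0 = ((1 + exp (-x)) / 2 - (1 - exp (-x)) / x) / x\<^sup>2"
    using assms by (simp add: H_def field_simps power2_eq_square power3_eq_cube)
  finally show ?thesis .
qed

text \<open>\<open>c\<^sub>n\<close> is the remainder integral of the trapezoidal rule on \<open>[n, n+1]\<close>; the interval \<open>[0, 1]\<close>,
  which is admissible only for \<open>\<sigma> < 0\<close>, absorbs the rational part \<open>(s+1)/2\<close> of \<^const>\<open>reg_zeta\<close>.\<close>

lemma trap_coeff: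
  fixes \<sigma> :: real
  assumes \<sigma>: "-1 < \<sigma>" "\<sigma> < 0"
  obtains c where "\<And>n. ((\<lambda>u. (u - u\<^sup>2) / 2 * (real n + u) powr (- \<sigma> - 2)) has_integral c n) {0<..<1}"
    "\<And>n. c n \<ge> 0" "summable c" "reg_zeta (of_real \<sigma>) = of_real ((\<sigma> - 1) * \<sigma> * (\<sigma> + 1) * (\<Sum>n. c n))"
proof -
  define c where "c n = integral {0..1} (\<lambda>u. (u - u\<^sup>2) / 2 * (real n + u) powr (- \<sigma> - 2))" for n
  define K where "K = (\<sigma> - 1) * \<sigma> * (\<sigma> + 1)"
  have K: "K \<noteq> 0" using \<sigma> by (auto simp: K_def)
  \<comment> \<open>On the interval starting at 0 the integrand has the singularity u^(-\<sigma>-1),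
    integrable precisely because \<sigma> < 0. Multiplied by (\<sigma>-1)\<sigma>(\<sigma>+1), the
    value becomes (\<sigma>+1)/2.\<close>
  have c0: "((\<lambda>u. (u - u\<^sup>2) / 2 * (real 0 + u) powr (- \<sigma> - 2)) has_integral 1 / (2 * \<sigma> * (\<sigma> - 1))) {0..1}"
  proof -
    have "((\<lambda>u. (u powr (- \<sigma> - 1) - u powr (- \<sigma>)) / 2) has_integral
       (1 powr (- \<sigma> - 1 + 1) / (- \<sigma> - 1 + 1) - 1 powr (- \<sigma> + 1) / (- \<sigma> + 1)) / 2) {0..1}"
      using \<sigma> by (intro has_integral_divide has_integral_diff has_integral_powr_from_0) auto
    also have "(1 powr (- \<sigma> - 1 + 1) / (- \<sigma> - 1 + 1) - 1 powr (- \<sigma> + 1) / (- \<sigma> + 1)) / 2 = 1 / (2 * \<sigma> * (\<sigma> - 1))"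
      using \<sigma> by (simp add: field_simps)
    also have "((\<lambda>u. (u powr (- \<sigma> - 1) - u powr (- \<sigma>)) / 2) has_integral 1 / (2 * \<sigma> * (\<sigma> - 1))) {0..1} \<longleftrightarrow> ?thesis"
    proof (rule has_integral_cong)
      fix u :: real assume u: "u \<in> {0..1}"
      have "u powr 1 * u powr (- \<sigma> - 2) = u powr (- \<sigma> - 1)" "u powr 2 * u powr (- \<sigma> - 2) = u powr (- \<sigma>)"
        unfolding powr_add[symmetric] by (rule arg_cong[of _ _ "(powr) u"], simp)+
      thus "(u powr (- \<sigma> - 1) - u powr (- \<sigma>)) / 2 = (u - u\<^sup>2) / 2 * (real 0 + u) powr (- \<sigma> - 2)"
        using u by (cases "u = 0") (auto simp: algebra_simps diff_divide_distrib)
    qed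
    finally show ?thesis .
  qed
  have c1: "((\<lambda>u. (u - u\<^sup>2) / 2 * (real (Suc n) + u) powr (- \<sigma> - 2)) has_integral c (Suc n)) {0..1}" for n
    unfolding c_def
    by (intro integrable_integral integrable_continuous_real continuous_intros) auto
  have hi: "((\<lambda>u. (u - u\<^sup>2) / 2 * (real n + u) powr (- \<sigma> - 2)) has_integral c n) {0..1}" for n
    using c0 c1 by (cases n) (auto simp: c_def has_integral_iff)
  have T: "trap_term n (of_real \<sigma>) = of_real (K * c (Suc n))" for n
  proof -
    have "((\<lambda>u. of_real (K * ((u - u\<^sup>2) / 2 * (real (Suc n) + u) powr (- \<sigma> - 2)))) has_integral
       complex_of_real (K * c (Suc n))) {0..1}"
      using has_integral_linear[OF has_integral_mult_right[OF c1[of n], of K] bounded_linear_of_real[where ?'a = complex]]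
      by (simp add: o_def)
    moreover have "((\<lambda>u. of_real (K * ((u - u\<^sup>2) / 2 * (real (Suc n) + u) powr (- \<sigma> - 2)))) has_integral
       trap_term n (of_real \<sigma>)) {0..1}"
    proof -
      have "((\<lambda>u. - (of_real \<sigma> - 1) * of_real \<sigma> * (of_real \<sigma> + 1) * of_real ((u\<^sup>2 - u) / 2) * of_real (real (Suc n) + u) powr (- of_real \<sigma> - 2))
         has_integral trap_term n (of_real \<sigma>)) {0..1}"
        using trapezoid_powr[of "real (Suc n)" "of_real \<sigma>"] by (simp add: trap_term_def add_ac)
      thus ?thesis
      proof (rule has_integral_eq[rotated])
        fix u :: real assume u: "u \<in> {0..1}"
        have "complex_of_real (real (Suc n) + u) powr (- of_real \<sigma> - 2) = of_real ((real (Suc n) + u) powr (- \<sigma> - 2))"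
          using u powr_of_real[of "real (Suc n) + u" "- \<sigma> - 2"] by simp
        thus "- (of_real \<sigma> - 1) * of_real \<sigma> * (of_real \<sigma> + 1) * of_real ((u\<^sup>2 - u) / 2) * of_real (real (Suc n) + u) powr (- of_real \<sigma> - 2)
          = complex_of_real (K * ((u - u\<^sup>2) / 2 * (real (Suc n) + u) powr (- \<sigma> - 2)))"
          by (simp only:) (simp add: K_def algebra_simps diff_divide_distrib del: of_nat_Suc)
      qed
    qed
    ultimately show ?thesis by (rule has_integral_unique[symmetric])
  qed
  have "summable (\<lambda>n. trap_term n (of_real \<sigma>))" using \<sigma> by (intro summable_trap_term) auto
  hence "summable (\<lambda>n. K * c (Suc n))" unfolding T by (subst (asm) summable_of_real_iff)
  hence "summable (\<lambda>n. c (Suc n))" using K by (subst (asm) summable_cmult_iff) auto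
  hence sm: "summable c" by (subst (asm) summable_Suc_iff)
  show ?thesis
  proof (rule that[of c])
    show "((\<lambda>u. (u - u\<^sup>2) / 2 * (real n + u) powr (- \<sigma> - 2)) has_integral c n) {0<..<1}" for n
      using hi[of n] by (simp add: has_integral_Icc_iff_Ioo)
    show "c n \<ge> 0" for n
      by (rule has_integral_nonneg[OF hi]) (auto simp: power2_eq_square mult_left_le)
    show "summable c" by fact
    have "reg_zeta (of_real \<sigma>) = (of_real \<sigma> + 1) / 2 + (\<Sum>n. of_real (K * c (Suc n)))"
      by (simp only: reg_zeta_def T)
    also have "(\<Sum>n. complex_of_real (K * c (Suc n))) = of_real (K * (\<Sum>n. c (Suc n)))"
      using sm by (subst suminf_mult[symmetric]) (auto simp: summable_Suc_iff suminf_of_real intro!: suminf_of_real[symmetric] summable_mult)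
    also have "(\<Sum>n. c (Suc n)) = (\<Sum>n. c n) - c 0" using suminf_split_head[OF sm] .
    also have "c 0 = 1 / (2 * \<sigma> * (\<sigma> - 1))" using c0 by (simp add: c_def has_integral_iff)
    also have "(of_real \<sigma> + 1) / 2 + complex_of_real (K * ((\<Sum>n. c n) - 1 / (2 * \<sigma> * (\<sigma> - 1)))) = 
       of_real ((\<sigma> + 1) / 2 + K * ((\<Sum>n. c n) - 1 / (2 * \<sigma> * (\<sigma> - 1))))" by simp
    also have "(\<sigma> + 1) / 2 + K * ((\<Sum>n. c n) - 1 / (2 * \<sigma> * (\<sigma> - 1))) = K * (\<Sum>n. c n)"
    proof -
      have "K * (1 / (2 * \<sigma> * (\<sigma> - 1))) = (\<sigma> + 1) / 2" using \<sigma> by (simp add: K_def)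
      thus ?thesis by (simp add: right_diff_distrib)
    qed
    finally show "reg_zeta (of_real \<sigma>) = of_real ((\<sigma> - 1) * \<sigma> * (\<sigma> + 1) * (\<Sum>n. c n))" by (simp add: K_def)
  qed
qed

text \<open>All terms are nonnegative for real \<open>\<sigma>\<close>, so Tonelli's theorem justifies every interchange; the complex
  functional equation then follows by the identity theorem.\<close>

lemma Gamma_trap_coeff_sum:
  fixes \<sigma> :: real and c :: "nat \<Rightarrow> real"
  assumes \<sigma>: "-1 < \<sigma>" "\<sigma> < 0"
    and c: "\<And>n. ((\<lambda>u. (u - u\<^sup>2) / 2 * (real n + u) powr (- \<sigma> - 2)) has_integral c n) {0<..<1}"
    "\<And>n. c n \<ge> 0" "summable c"
  shows "Gamma (\<sigma> + 2) * (\<Sum>n. c n) =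
    Gamma ((1 + \<sigma>) / 2) * Gamma ((1 - \<sigma>) / 2) * (\<Sum>k. (2 * pi * real (Suc k)) powr (\<sigma> - 1))"
proof -
  let ?GG = "Gamma ((1 + \<sigma>) / 2) * Gamma ((1 - \<sigma>) / 2)"
  define w :: "real \<Rightarrow> real" where "w u = (u - u\<^sup>2) / 2" for u
  have w: "w u \<ge> 0" if "u \<in> {0<..<1}" for u using that by (auto simp: w_def power2_eq_square mult_left_le)
  have [measurable]: "w \<in> borel_measurable borel" unfolding w_def by measurable
  define a where "a k = 2 * pi * real (Suc k)" for k
  have a: "a k > 0" for k by (simp add: a_def)
  \<comment> \<open>Integrating over x produces Gamma(\<sigma>+2) (n+u)^(-\<sigma>-2) times the
    Peano kernel, whose integral over u is \<open>c n\<close> with the Gamma factor; the indicators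
    record the domains of u and x.\<close>
  define h where "h n u x = ennreal (w u * x powr (\<sigma> + 1) * exp (- x * (real n + u))) * indicator {0<..<1} u * indicator {0<..} x" for n u x
  have "(\<Sum>n. \<integral>\<^sup>+u. (\<integral>\<^sup>+x. h n u x \<partial>lborel) \<partial>lborel) = (\<Sum>n. ennreal (Gamma (\<sigma> + 2) * c n))"
  proof (intro suminf_cong)
    fix n
    have "(\<integral>\<^sup>+x. h n u x \<partial>lborel) = ennreal (Gamma (\<sigma> + 2) * (w u * (real n + u) powr (- \<sigma> - 2))) * indicator {0<..<1} u" for u
    proof (cases "u \<in> {0<..<1}")
      case True
      have "(\<integral>\<^sup>+x. h n u x \<partial>lborel) = (\<integral>\<^sup>+x. ennreal (w u * (x powr ((\<sigma> + 2) - 1) * exp (- (real n + u) * x))) * indicator {0<..} x \<partial>lborel)"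
        using True by (intro nn_integral_cong) (simp add: h_def mult_ac algebra_simps)
      also have "\<dots> = ennreal (w u * (Gamma (\<sigma> + 2) * (real n + u) powr (- (\<sigma> + 2))))"
        using True \<sigma> w[OF True]
        by (intro nn_integral_has_integral_lebesgue' has_integral_mult_right Gamma_scaled_has_integral) auto
      finally show ?thesis using True by (simp add: algebra_simps)
    qed (simp add: h_def)
    hence "(\<integral>\<^sup>+u. (\<integral>\<^sup>+x. h n u x \<partial>lborel) \<partial>lborel) =
       (\<integral>\<^sup>+u. ennreal (Gamma (\<sigma> + 2) * (w u * (real n + u) powr (- \<sigma> - 2))) * indicator {0<..<1} u \<partial>lborel)"
      by simp
    also have "\<dots> = ennreal (Gamma (\<sigma> + 2) * c n)"
      using \<sigma> w by (intro nn_integral_has_integral_lebesgue' has_integral_mult_right c(1)[of n, folded w_def])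
        (auto intro!: mult_nonneg_nonneg Gamma_real_nonneg)
    finally show "(\<integral>\<^sup>+u. (\<integral>\<^sup>+x. h n u x \<partial>lborel) \<partial>lborel) = ennreal (Gamma (\<sigma> + 2) * c n)" .
  qed
  also have "\<dots> = ennreal (Gamma (\<sigma> + 2) * (\<Sum>n. c n))"
    using \<sigma> c by (subst suminf_ennreal2) (auto intro!: summable_mult suminf_mult arg_cong[of _ _ ennreal])
  finally have L: "(\<Sum>n. \<integral>\<^sup>+u. (\<integral>\<^sup>+x. h n u x \<partial>lborel) \<partial>lborel) = ennreal (Gamma (\<sigma> + 2) * (\<Sum>n. c n))" .

  \<comment> \<open>The same nonnegative quantity with u integrated first: the sum over n is then
    geometric in e^(-x), and the outcome expands in partial fractions.\<close>
  have "(\<Sum>n. \<integral>\<^sup>+u. (\<integral>\<^sup>+x. h n u x \<partial>lborel) \<partial>lborel) = (\<Sum>n. \<integral>\<^sup>+x. (\<integral>\<^sup>+u. h n u x \<partial>lborel) \<partial>lborel)"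
    unfolding h_def by (intro suminf_cong lborel_pair.Fubini') measurable
  also have "\<dots> = (\<integral>\<^sup>+x. (\<Sum>n. (\<integral>\<^sup>+u. h n u x \<partial>lborel)) \<partial>lborel)"
    unfolding h_def by (subst nn_integral_suminf) auto
  also have "\<dots> = (\<integral>\<^sup>+x. (\<Sum>k. ennreal (2 * x powr \<sigma> / (x\<^sup>2 + (a k)\<^sup>2)) * indicator {0<..} x) \<partial>lborel)"
  proof (intro nn_integral_cong)
    fix x :: real
    show "(\<Sum>n. (\<integral>\<^sup>+u. h n u x \<partial>lborel)) = (\<Sum>k. ennreal (2 * x powr \<sigma> / (x\<^sup>2 + (a k)\<^sup>2)) * indicator {0<..} x)"
    proof (cases "x > 0")
      case True
      define e0 where "e0 = (1 + exp (-x)) / 2 - (1 - exp (-x)) / x"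
      have 1: "(\<integral>\<^sup>+u. h n u x \<partial>lborel) = ennreal (x powr (\<sigma> + 1) * exp (-x) ^ n * (e0 / x\<^sup>2))" for n
      proof -
        have "(\<integral>\<^sup>+u. h n u x \<partial>lborel) = (\<integral>\<^sup>+u. ennreal (x powr (\<sigma> + 1) * exp (-x) ^ n * (w u * exp (- x * u))) * indicator {0<..<1} u \<partial>lborel)"
          using True by (intro nn_integral_cong)
            (simp add: h_def mult_ac algebra_simps exp_add exp_diff exp_minus exp_of_nat_mult[symmetric] divide_simps)
        also have "\<dots> = ennreal (x powr (\<sigma> + 1) * exp (-x) ^ n * (e0 / x\<^sup>2))"
          using exp_parabola_has_integral[OF True] w
          by (intro nn_integral_has_integral_lebesgue' has_integral_mult_right)
             (auto intro!: mult_nonneg_nonneg simp: e0_def has_integral_Icc_iff_Ioo simp flip: w_def)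
        finally show ?thesis .
      qed
      have e0: "e0 \<ge> 0"
      proof -
        have "e0 / x\<^sup>2 \<ge> 0"
          by (rule has_integral_nonneg[OF exp_parabola_has_integral[OF True, folded e0_def]])
             (auto simp: power2_eq_square mult_left_le intro!: mult_nonneg_nonneg)
        thus ?thesis using True by (simp add: zero_le_divide_iff)
      qed
      have "(\<lambda>n. x powr (\<sigma> + 1) * exp (-x) ^ n * (e0 / x\<^sup>2)) sums (x powr (\<sigma> + 1) * (1 / (1 - exp (-x))) * (e0 / x\<^sup>2))"
        using True by (intro sums_mult sums_mult2 geometric_sums) auto
      hence "(\<Sum>n. (\<integral>\<^sup>+u. h n u x \<partial>lborel)) = ennreal (x powr (\<sigma> + 1) * (1 / (1 - exp (-x))) * (e0 / x\<^sup>2))"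
        unfolding 1 by (rule suminf_ennreal_eq[rotated]) (use e0 True in auto)
      also have "x powr (\<sigma> + 1) * (1 / (1 - exp (-x))) * (e0 / x\<^sup>2) = (x powr (\<sigma> + 1) / x\<^sup>2) * (1 / (exp x - 1) + 1 / 2 - 1 / x)"
      proof -
        have "exp x \<noteq> 1" using True by simp
        hence "e0 / (1 - exp (-x)) = 1 / (exp x - 1) + 1 / 2 - 1 / x"
          using True by (simp add: e0_def exp_minus divide_simps) (simp add: algebra_simps)
        moreover have "x powr (\<sigma> + 1) * (1 / (1 - exp (-x))) * (e0 / x\<^sup>2) = (x powr (\<sigma> + 1) / x\<^sup>2) * (e0 / (1 - exp (-x)))"
          by simp
        ultimately show ?thesis by (simp only:)
      qed
      also have "x powr (\<sigma> + 1) / x\<^sup>2 = x powr \<sigma> / x"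
        using True by (simp add: powr_add power2_eq_square)
      also have "ennreal (x powr \<sigma> / x * (1 / (exp x - 1) + 1 / 2 - 1 / x)) = (\<Sum>k. ennreal (x powr \<sigma> / x * (2 * x / (x\<^sup>2 + (a k)\<^sup>2))))"
        unfolding a_def using True
        by (intro suminf_ennreal_eq[symmetric] sums_mult coth_partial_fractions) auto
      also have "\<dots> = (\<Sum>k. ennreal (2 * x powr \<sigma> / (x\<^sup>2 + (a k)\<^sup>2)))"
        using True by (simp add: mult_ac)
      finally show ?thesis using True by simp
    qed (simp add: h_def)
  qed
  also have "\<dots> = (\<Sum>k. \<integral>\<^sup>+x. ennreal (2 * x powr \<sigma> / (x\<^sup>2 + (a k)\<^sup>2)) * indicator {0<..} x \<partial>lborel)"
    by (subst nn_integral_suminf) auto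
  also have "\<dots> = (\<Sum>k. ennreal (?GG * a k powr (\<sigma> - 1)))"
  proof (intro suminf_cong)
    fix k
    \<comment> \<open>Integrating over v gives back the fraction with denominator x^2 + a_k^2.
      Integrating over x first leaves a Gaussian moment, after which the v-integral is a Gamma
      integral; this is how the product of two Gamma values arises.\<close>
    define g where "g x v = ennreal (2 * x powr \<sigma> * exp (- v * (x\<^sup>2 + (a k)\<^sup>2))) * indicator {0<..} x * indicator {0<..} v" for x v
    have "(\<integral>\<^sup>+x. ennreal (2 * x powr \<sigma> / (x\<^sup>2 + (a k)\<^sup>2)) * indicator {0<..} x \<partial>lborel) = (\<integral>\<^sup>+x. (\<integral>\<^sup>+v. g x v \<partial>lborel) \<partial>lborel)"
    proof (intro nn_integral_cong)
      fix x :: real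
      show "ennreal (2 * x powr \<sigma> / (x\<^sup>2 + (a k)\<^sup>2)) * indicator {0<..} x = (\<integral>\<^sup>+v. g x v \<partial>lborel)"
      proof (cases "x > 0")
        case True
        hence p: "x\<^sup>2 + (a k)\<^sup>2 > 0" by (simp add: add_pos_nonneg)
        have "(\<integral>\<^sup>+v. g x v \<partial>lborel) = (\<integral>\<^sup>+v. ennreal (2 * x powr \<sigma> * (v powr (1 - 1) * exp (- (x\<^sup>2 + (a k)\<^sup>2) * v))) * indicator {0<..} v \<partial>lborel)"
          using True by (intro nn_integral_cong) (auto simp: g_def algebra_simps split: split_indicator)
        also have "\<dots> = ennreal (2 * x powr \<sigma> * (Gamma 1 * (x\<^sup>2 + (a k)\<^sup>2) powr (-1)))"
          using p by (intro nn_integral_has_integral_lebesgue' has_integral_mult_right Gamma_scaled_has_integral) auto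
        finally show ?thesis using True p by (simp add: powr_minus_divide)
      qed (simp add: g_def)
    qed
    also have "\<dots> = (\<integral>\<^sup>+v. (\<integral>\<^sup>+x. g x v \<partial>lborel) \<partial>lborel)"
      unfolding g_def by (intro lborel_pair.Fubini') measurable
    also have "\<dots> = (\<integral>\<^sup>+v. ennreal (Gamma ((\<sigma> + 1) / 2) * (v powr ((1 - \<sigma>) / 2 - 1) * exp (- (a k)\<^sup>2 * v))) * indicator {0<..} v \<partial>lborel)"
    proof (intro nn_integral_cong)
      fix v :: real
      show "(\<integral>\<^sup>+x. g x v \<partial>lborel) = ennreal (Gamma ((\<sigma> + 1) / 2) * (v powr ((1 - \<sigma>) / 2 - 1) * exp (- (a k)\<^sup>2 * v))) * indicator {0<..} v"
      proof (cases "v > 0")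
        case True
        have "(\<integral>\<^sup>+x. g x v \<partial>lborel) = (\<integral>\<^sup>+x. ennreal (exp (- (a k)\<^sup>2 * v) * (2 * x powr \<sigma> * exp (- v * x\<^sup>2))) * indicator {0<..} x \<partial>lborel)"
          using True by (intro nn_integral_cong) (auto simp: g_def algebra_simps exp_diff exp_minus divide_simps split: split_indicator)
        also have "\<dots> = ennreal (exp (- (a k)\<^sup>2 * v) * (Gamma ((\<sigma> + 1) / 2) * v powr (- (\<sigma> + 1) / 2)))"
          using True \<sigma> by (intro nn_integral_has_integral_lebesgue' has_integral_mult_right Gamma_square_has_integral) auto
        also have "- (\<sigma> + 1) / 2 = (1 - \<sigma>) / 2 - 1" by (simp add: field_simps)
        finally show ?thesis using True by (simp add: mult_ac)
      qed (simp add: g_def)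
    qed
    also have "\<dots> = ennreal (Gamma ((\<sigma> + 1) / 2) * (Gamma ((1 - \<sigma>) / 2) * ((a k)\<^sup>2) powr (- ((1 - \<sigma>) / 2))))"
      using \<sigma> a[of k] by (intro nn_integral_has_integral_lebesgue' has_integral_mult_right Gamma_scaled_has_integral)
        (auto intro!: mult_nonneg_nonneg Gamma_real_nonneg)
    also have "((a k)\<^sup>2) powr (- ((1 - \<sigma>) / 2)) = (a k powr 2) powr (- ((1 - \<sigma>) / 2))"
      using a[of k] by simp
    also have "\<dots> = a k powr (\<sigma> - 1)" unfolding powr_powr by (rule arg_cong[of _ _ "(powr) (a k)"]) (simp add: diff_divide_distrib)
    finally show "(\<integral>\<^sup>+x. ennreal (2 * x powr \<sigma> / (x\<^sup>2 + (a k)\<^sup>2)) * indicator {0<..} x \<partial>lborel)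
      = ennreal (?GG * a k powr (\<sigma> - 1))"
      by (simp add: add_ac mult_ac)
  qed
  also have "\<dots> = ennreal (?GG * (\<Sum>k. a k powr (\<sigma> - 1)))"
  proof (rule suminf_ennreal_eq)
    have "summable (\<lambda>k. (2 * pi) powr (\<sigma> - 1) * real (Suc k) powr (\<sigma> - 1))"
      using \<sigma> by (intro summable_mult summable_powr_Suc) auto
    hence "summable (\<lambda>k. a k powr (\<sigma> - 1))" by (simp add: a_def powr_mult)
    thus "(\<lambda>k. ?GG * a k powr (\<sigma> - 1)) sums
      (?GG * (\<Sum>k. a k powr (\<sigma> - 1)))"
      by (intro sums_mult summable_sums)
    show "0 \<le> ?GG * a k powr (\<sigma> - 1)" for k
      using \<sigma> by (auto intro!: mult_nonneg_nonneg Gamma_real_nonneg)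
  qed
  finally have "ennreal (Gamma (\<sigma> + 2) * (\<Sum>n. c n)) = ennreal (?GG * (\<Sum>k. a k powr (\<sigma> - 1)))"
    unfolding L .
  moreover have "Gamma (\<sigma> + 2) * (\<Sum>n. c n) \<ge> 0"
    using \<sigma> c by (auto intro!: mult_nonneg_nonneg Gamma_real_nonneg suminf_nonneg)
  moreover have "?GG * (\<Sum>k. a k powr (\<sigma> - 1)) \<ge> 0"
  proof -
    have "summable (\<lambda>k. (2 * pi) powr (\<sigma> - 1) * real (Suc k) powr (\<sigma> - 1))"
      using \<sigma> by (intro summable_mult summable_powr_Suc) auto
    hence "summable (\<lambda>k. a k powr (\<sigma> - 1))" by (simp add: a_def powr_mult)
    thus ?thesis using \<sigma> by (auto intro!: mult_nonneg_nonneg Gamma_real_nonneg suminf_nonneg)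
  qed
  ultimately show ?thesis by (simp add: a_def)
qed

text \<open>Since 1 - \<sigma> > 1, the sum over k is the Dirichlet series at 1 - s, and the product
  of Gamma values at (1+\<sigma>)/2 and (1-\<sigma>)/2 is pi / cos(pi \<sigma>/2) by reflection. The
  equation is multiplied out, with Gamma at s + 2, so that both sides remain holomorphic beyond the
  real segment.\<close>

lemma zeta_FE_real:
  fixes \<sigma> :: real
  assumes \<sigma>: "-1 < \<sigma>" "\<sigma> < 0"
  defines "s \<equiv> complex_of_real \<sigma>"
  shows "Gamma (s + 2) * reg_zeta s * (2 * cos (of_real pi * s / 2)) =
    - (s - 1) * (s + 1) * (2 * of_real pi) powr s * reg_zeta (1 - s)"
proof -
  obtain c where c: "\<And>n. ((\<lambda>u. (u - u\<^sup>2) / 2 * (real n + u) powr (- \<sigma> - 2)) has_integral c n) {0<..<1}"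
    "\<And>n. c n \<ge> 0" "summable c" "reg_zeta (of_real \<sigma>) = of_real ((\<sigma> - 1) * \<sigma> * (\<sigma> + 1) * (\<Sum>n. c n))"
    by (rule trap_coeff[OF \<sigma>]) (rule that)
  define A where "A = (\<Sum>n. c n)"
  define Zt where "Zt = (\<Sum>k. real (Suc k) powr (\<sigma> - 1))"
  have sm: "summable (\<lambda>k. real (Suc k) powr (\<sigma> - 1))" using \<sigma> by (intro summable_powr_Suc) auto
  have "(\<Sum>k. (2 * pi * real (Suc k)) powr (\<sigma> - 1)) = (\<Sum>k. (2 * pi) powr (\<sigma> - 1) * real (Suc k) powr (\<sigma> - 1))"
    by (simp add: powr_mult)
  also have "\<dots> = (2 * pi) powr (\<sigma> - 1) * Zt" unfolding Zt_def by (intro suminf_mult sm)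
  finally have 1: "Gamma (\<sigma> + 2) * A = Gamma ((1 + \<sigma>) / 2) * Gamma ((1 - \<sigma>) / 2) * ((2 * pi) powr (\<sigma> - 1) * Zt)"
    unfolding A_def using Gamma_trap_coeff_sum[OF \<sigma> c(1-3)] by simp
  have ZZ: "reg_zeta (1 - s) = of_real (- \<sigma> * Zt)"
  proof -
    have "(\<lambda>n. 1 / of_nat (Suc n) powr (1 - s)) sums (reg_zeta (1 - s) / (1 - s - 1))"
      using \<sigma> by (intro reg_zeta_dirichlet) (auto simp: s_def)
    moreover have "(\<lambda>n. 1 / of_nat (Suc n) powr (1 - s)) = (\<lambda>n. complex_of_real (real (Suc n) powr (\<sigma> - 1)))"
    proof
      fix n
      have "1 / of_nat (Suc n) powr (1 - s) = of_real (real (Suc n)) powr of_real (\<sigma> - 1)"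
        using powr_minus_divide[of "of_nat (Suc n)" "1 - s"] by (simp add: s_def del: of_nat_Suc)
      also have "\<dots> = of_real (real (Suc n) powr (\<sigma> - 1))" by (rule powr_of_real) simp
      finally show "1 / of_nat (Suc n) powr (1 - s) = complex_of_real (real (Suc n) powr (\<sigma> - 1))" .
    qed
    moreover have "(\<lambda>n. complex_of_real (real (Suc n) powr (\<sigma> - 1))) sums of_real Zt"
      unfolding Zt_def sums_of_real_iff using sm by (rule summable_sums)
    ultimately have "reg_zeta (1 - s) / (1 - s - 1) = of_real Zt" using sums_unique2 by metis
    moreover have "s \<noteq> 0" using \<sigma> by (simp add: s_def)
    ultimately have "reg_zeta (1 - s) = of_real Zt * (1 - s - 1)"
      using nonzero_divide_eq_eq[of "1 - s - 1" "reg_zeta (1 - s)" "of_real Zt"] by simp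
    thus ?thesis by (simp add: s_def)
  qed
  define z :: complex where "z = (1 + s) / 2"
  have refl: "of_real (Gamma ((1 + \<sigma>) / 2) * Gamma ((1 - \<sigma>) / 2)) * cos (of_real pi * s / 2) = of_real pi"
  proof -
    have g: "Gamma z * Gamma (1 - z) = of_real (Gamma ((1 + \<sigma>) / 2) * Gamma ((1 - \<sigma>) / 2))"
    proof -
      have "z = of_real ((1 + \<sigma>) / 2)" "1 - z = of_real ((1 - \<sigma>) / 2)" by (auto simp: z_def s_def field_simps)
      thus ?thesis unfolding of_real_mult by (simp only: Gamma_complex_of_real)
    qed
    have sn: "sin (of_real pi * z) = cos (of_real pi * s / 2)"
    proof -
      have s1: "sin (complex_of_real (pi / 2)) = 1" by (simp only: sin_of_real sin_pi_half of_real_1)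
      have c1: "cos (complex_of_real (pi / 2)) = 0" by (simp only: cos_of_real cos_pi_half of_real_0)
      have "of_real pi * z = complex_of_real (pi / 2) + of_real pi * s / 2" by (simp add: z_def field_simps)
      thus ?thesis by (simp only: sin_add s1 c1) simp
    qed
    have "cos (of_real pi * s / 2) = of_real (cos (pi * \<sigma> / 2))" by (simp add: s_def flip: cos_of_real)
    moreover have "cos (pi * \<sigma> / 2) > 0"
    proof (rule cos_gt_zero_pi)
      have "- pi < pi * \<sigma>" using \<sigma> mult_strict_left_mono[of "-1" \<sigma> pi] by simp
      thus "- (pi / 2) < pi * \<sigma> / 2" by simp
      have "pi * \<sigma> < 0" using \<sigma> by (simp add: mult_pos_neg)
      thus "pi * \<sigma> / 2 < pi / 2" using pi_gt_zero by linarith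
    qed
    ultimately have "cos (of_real pi * s / 2) \<noteq> 0" by simp
    thus ?thesis using Gamma_reflection_complex[of z] unfolding g sn by simp
  qed
  have G: "Gamma (s + 2) = of_real (Gamma (\<sigma> + 2))"
  proof -
    have "s + 2 = of_real (\<sigma> + 2)" by (simp add: s_def)
    thus ?thesis by (simp only: Gamma_complex_of_real)
  qed
  have P: "(2 * of_real pi) powr s = of_real ((2 * pi) powr \<sigma>)"
    using powr_of_real[of "2 * pi" \<sigma>] by (simp add: s_def)
  have P2: "(2 * pi) powr \<sigma> = (2 * pi) powr (\<sigma> - 1) * (2 * pi)"
    by (simp add: powr_diff)
  have "Gamma (s + 2) * reg_zeta s * (2 * cos (of_real pi * s / 2)) =
    of_real ((\<sigma> - 1) * \<sigma> * (\<sigma> + 1)) * of_real (Gamma (\<sigma> + 2) * A) * (2 * cos (of_real pi * s / 2))"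
    unfolding G unfolding s_def c(4) A_def[symmetric] by (simp only: of_real_mult mult_ac)
  also have "\<dots> = of_real ((\<sigma> - 1) * \<sigma> * (\<sigma> + 1)) * (2 * of_real ((2 * pi) powr (\<sigma> - 1) * Zt)) * 
     (of_real (Gamma ((1 + \<sigma>) / 2) * Gamma ((1 - \<sigma>) / 2)) * cos (of_real pi * s / 2))"
    unfolding 1 by (simp only: of_real_mult mult_ac)
  also have "\<dots> = - (s - 1) * (s + 1) * (2 * of_real pi) powr s * reg_zeta (1 - s)"
  proof -
    define a where "a = (2 * pi) powr (\<sigma> - 1)"
    show ?thesis unfolding refl ZZ P P2 a_def[symmetric] by (simp add: s_def algebra_simps)
  qed
  finally show ?thesis .
qed

text \<open>The strip is where both s and 1 - s lie in the half-plane of \<open>reg_zeta\<close>,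
  and Gamma(s+2) has no pole there. The identity theorem applies because the real segment (-1, 0)
  accumulates at -1/2.\<close>

lemma zeta_FE:
  assumes s: "-1 < Re s" "Re s < 2"
  shows "Gamma (s + 2) * reg_zeta s * (2 * cos (of_real pi * s / 2)) =
    - (s - 1) * (s + 1) * (2 * of_real pi) powr s * reg_zeta (1 - s)"
proof -
  define S :: "complex set" where "S = {s. -1 < Re s} \<inter> {s. Re s < 2}"
  define U :: "complex set" where "U = of_real ` {-1<..<0::real}"
  have op: "open S" unfolding S_def by (intro open_Int open_halfspace_Re_gt open_halfspace_Re_lt)
  have cn: "connected S" unfolding S_def by (intro convex_connected convex_Int convex_halfspace_Re_gt convex_halfspace_Re_lt)
  have nz: "z + 2 \<notin> \<int>\<^sub>\<le>\<^sub>0" if "z \<in> S" for z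
    using that by (auto simp: S_def complex_eq_iff elim!: nonpos_Ints_cases')
  define F where "F s = Gamma (s + 2) * reg_zeta s * (2 * cos (of_real pi * s / 2)) -
    (- (s - 1) * (s + 1) * (2 * of_real pi) powr s * reg_zeta (1 - s))" for s
  have holZ: "(\<lambda>s. reg_zeta (1 - s)) holomorphic_on S"
    by (rule holomorphic_on_compose_gen[of "\<lambda>s. 1 - s" S reg_zeta, unfolded o_def, OF _ holomorphic_reg_zeta])
       (auto intro!: holomorphic_intros simp: S_def)
  have holF: "F holomorphic_on S" unfolding F_def
    using nz by (intro holomorphic_intros holZ holomorphic_on_subset[OF holomorphic_reg_zeta]) (auto simp: S_def)
  have lp: "of_real (-1/2) islimpt U"
  proof -
    have "(-1/2::real) islimpt {-1<..<0}" by (intro interior_limit_point) (simp add: interior_open)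
    moreover have "eventually (\<lambda>x. complex_of_real x \<noteq> of_real (-1/2)) (at (-1/2))"
      by (simp only: eventually_at_filter of_real_eq_iff) simp
    ultimately show ?thesis unfolding U_def by (intro islimpt_isCont_image) auto
  qed
  have "F s = 0"
  proof (rule analytic_continuation[OF holF op cn _ _ lp])
    show "U \<subseteq> S" by (auto simp: U_def S_def)
    show "of_real (-1/2) \<in> S" by (simp add: S_def)
    show "F z = 0" if "z \<in> U" for z using that zeta_FE_real by (auto simp: U_def F_def)
    show "s \<in> S" using s by (simp add: S_def)
  qed
  thus ?thesis by (simp add: F_def)
qed

text \<open>For \<open>Re s \<le> -1\<close> the functional equation serves as the definition.\<close>

definition zeta_num :: "complex \<Rightarrow> complex" where
  "zeta_num s = (if Re s > -1 then reg_zeta s else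
     (1 - s) * (2 * of_real pi) powr s * reg_zeta (1 - s) * Gamma (1 - s) * sin (of_real pi * s / 2) / (of_real pi * s))"

text \<open>On the overlap -1 < Re s < 0 the right-hand side is the functional equation solved for
  \<open>reg_zeta s\<close>: reflection and the doubling formula for the sine trade division by
  Gamma(s) cos(pi s/2) for multiplication by Gamma(1-s) sin(pi s/2). Hence the two pieces of
  \<open>zeta_num\<close> glue holomorphically.\<close>

lemma zeta_num_left:
  assumes s: "Re s < 0"
  shows "zeta_num s = (1 - s) * (2 * of_real pi) powr s * reg_zeta (1 - s) * Gamma (1 - s) * sin (of_real pi * s / 2) / (of_real pi * s)"
proof (cases "Re s > -1")
  case True
  have nz: "s \<noteq> 0" "s + 1 \<noteq> 0" using True s by (auto simp: complex_eq_iff)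
  have ni: "s \<notin> \<int>"
  proof
    assume "s \<in> \<int>"
    then obtain n where "s = of_int n" by (auto elim: Ints_cases)
    thus False using True s by auto
  qed
  hence ni': "s \<notin> \<int>\<^sub>\<le>\<^sub>0" "s + 1 \<notin> \<int>\<^sub>\<le>\<^sub>0" using nonpos_Ints_subset_Ints
    by (auto dest: nonpos_Ints_Int)
  have G2: "Gamma (s + 2) = s * (s + 1) * Gamma s"
    using Gamma_plus1[of s] Gamma_plus1[of "s + 1"] ni' by (simp add: algebra_simps)
  have sn: "sin (of_real pi * s) = 2 * sin (of_real pi * s / 2) * cos (of_real pi * s / 2)"
    using sin_double[of "of_real pi * s / 2"] by simp
  have sn0: "sin (of_real pi * s) \<noteq> 0" 
  proof
    assume "sin (of_real pi * s) = 0"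
    then obtain n :: int where "of_real pi * s = of_real (of_int n * pi)" by (auto simp: sin_eq_0)
    hence "s = of_int n" by simp
    thus False using ni by simp
  qed
  have R: "Gamma s * Gamma (1 - s) * sin (of_real pi * s) = of_real pi"
    using Gamma_reflection_complex[of s] sn0 by (simp add: field_simps)
  define c where "c = cos (of_real pi * s / 2)"
  define d where "d = sin (of_real pi * s / 2)"
  define X where "X = (1 - s) * (2 * of_real pi) powr s * reg_zeta (1 - s)"
  have fe: "s * Gamma s * reg_zeta s * (2 * c) = X"
  proof -
    have "(s + 1) * (s * Gamma s * reg_zeta s * (2 * c)) = Gamma (s + 2) * reg_zeta s * (2 * c)" by (simp add: G2)
    also have "\<dots> = (s + 1) * X" unfolding c_def X_def
      by (subst zeta_FE) (use True s in auto)
    finally show ?thesis using nz by simp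
  qed
  have R': "Gamma s * Gamma (1 - s) * (2 * d * c) = of_real pi" using R unfolding sn c_def d_def by simp
  have "X * Gamma (1 - s) * d = s * reg_zeta s * (Gamma s * Gamma (1 - s) * (2 * d * c))"
    unfolding fe[symmetric] by simp
  also have "\<dots> = s * reg_zeta s * of_real pi" unfolding R' ..
  finally have "reg_zeta s = X * Gamma (1 - s) * d / (of_real pi * s)" using nz by (simp add: field_simps)
  thus ?thesis using True by (simp add: zeta_num_def X_def d_def)
qed (simp add: zeta_num_def)

lemma holomorphic_zeta_num: "zeta_num holomorphic_on UNIV"
proof -
  have "zeta_num holomorphic_on {s. Re s > -1} \<union> {s. Re s < 0}"
  proof (rule holomorphic_on_Un)
    show "zeta_num holomorphic_on {s. Re s > -1}"
      by (rule holomorphic_transform[OF holomorphic_reg_zeta]) (simp add: zeta_num_def)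
    have holZ: "(\<lambda>s. reg_zeta (1 - s)) holomorphic_on {s. Re s < 0}"
      by (rule holomorphic_on_compose_gen[of "\<lambda>s. 1 - s" _ reg_zeta, unfolded o_def, OF _ holomorphic_reg_zeta])
         (auto intro!: holomorphic_intros)
    have "(\<lambda>s. (1 - s) * (2 * of_real pi) powr s * reg_zeta (1 - s) * Gamma (1 - s) * sin (of_real pi * s / 2) / (of_real pi * s)) holomorphic_on {s. Re s < 0}"
      by (intro holomorphic_intros holZ) (auto simp: complex_eq_iff elim!: nonpos_Ints_cases')
    thus "zeta_num holomorphic_on {s. Re s < 0}"
      by (rule holomorphic_transform) (simp add: zeta_num_left)
  qed (auto intro: open_halfspace_Re_gt open_halfspace_Re_lt)
  also have "{s. Re s > -1} \<union> {s. Re s < 0} = UNIV" by auto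
  finally show ?thesis .
qed

text \<open>\<open>riemann_zeta\<close> is obtained by \<open>SOME\<close>, so its defining
  properties are available only after a witness is shown; \<open>zeta_num s / (s - 1)\<close> is
  that witness.\<close>

lemma riemann_zeta_props:
  "riemann_zeta holomorphic_on (- {1})"
  "Re s > 1 \<Longrightarrow> (\<lambda>n. 1 / of_nat (Suc n) powr s) sums riemann_zeta s"
proof -
  have "(\<lambda>s. zeta_num s / (s - 1)) holomorphic_on (- {1})"
    by (intro holomorphic_intros holomorphic_on_subset[OF holomorphic_zeta_num]) auto
  moreover have "\<forall>s. 1 < Re s \<longrightarrow> (\<lambda>n. 1 / of_nat (Suc n) powr s) sums (zeta_num s / (s - 1))"
    using reg_zeta_dirichlet by (auto simp: zeta_num_def)
  ultimately have "riemann_zeta holomorphic_on (- {1}) \<and>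
      (\<forall>s. 1 < Re s \<longrightarrow> (\<lambda>n. 1 / of_nat (Suc n) powr s) sums riemann_zeta s)"
    unfolding riemann_zeta_def
    by (intro someI[where P = "\<lambda>g. g holomorphic_on (- {1}) \<and> (\<forall>s. 1 < Re s \<longrightarrow> (\<lambda>n. 1 / of_nat (Suc n) powr s) sums g s)"]) auto
  thus "riemann_zeta holomorphic_on (- {1})"
    "Re s > 1 \<Longrightarrow> (\<lambda>n. 1 / of_nat (Suc n) powr s) sums riemann_zeta s" by auto
qed

text \<open>By the identity theorem on the connected punctured half-plane, the estimates for the
  explicit series become estimates for the chosen function.\<close>

lemma riemann_zeta_reg_zeta:
  assumes s: "Re s > -1" "s \<noteq> 1"
  shows "riemann_zeta s = reg_zeta s / (s - 1)"
proof -
  define S where "S = {s. Re s > -1} - {1::complex}"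
  have op: "open S" unfolding S_def by (intro open_delete open_halfspace_Re_gt)
  have cn: "connected S" unfolding S_def
    by (intro connected_open_delete open_halfspace_Re_gt convex_connected convex_halfspace_Re_gt) auto
  have hol: "(\<lambda>s. riemann_zeta s - reg_zeta s / (s - 1)) holomorphic_on S"
    by (intro holomorphic_intros holomorphic_on_subset[OF holomorphic_reg_zeta] holomorphic_on_subset[OF riemann_zeta_props(1)])
       (auto simp: S_def)
  have "riemann_zeta s - reg_zeta s / (s - 1) = 0"
  proof (rule analytic_continuation_open[of "{s. Re s > 1}" S, where f = "\<lambda>s. riemann_zeta s - reg_zeta s / (s - 1)" and g = "\<lambda>_. 0"])
    have "of_real 2 \<in> {s. Re s > 1}" by simp
    thus "{s. Re s > 1} \<noteq> {}" by blast
    show "riemann_zeta z - reg_zeta z / (z - 1) = 0" if "z \<in> {s. Re s > 1}" for z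
      using sums_unique2[OF riemann_zeta_props(2) reg_zeta_dirichlet] that by simp
  qed (use op cn hol s in \<open>auto simp: S_def open_halfspace_Re_gt\<close>)
  thus ?thesis by simp
qed

section \<open>Growth of the zeta function in the critical strip\<close>

lemma complex_of_real_sinh: "sinh (complex_of_real x) = of_real (sinh x)"
  and complex_of_real_cosh: "cosh (complex_of_real x) = of_real (cosh x)"
  by (simp_all add: sinh_field_def cosh_field_def exp_of_real flip: of_real_minus)

text \<open>The conjugate of Gamma(1+it) is Gamma(1-it), so the squared modulus is a product that
  the reflection formula evaluates.\<close>

lemma norm_Gamma_one_plus_imaginary:
  assumes "t \<noteq> 0"
  shows "norm (Gamma (1 + \<i> * of_real t)) ^ 2 = pi * t / sinh (pi * t)"
proof -
  define z where "z = \<i> * complex_of_real t"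
  have z: "z \<noteq> 0" using assms by (simp add: z_def)
  have nz: "z \<notin> \<int>\<^sub>\<le>\<^sub>0" using assms by (auto simp: z_def complex_eq_iff elim!: nonpos_Ints_cases')
  have Gp: "Gamma (1 + z) = z * Gamma z" using Gamma_plus1[OF nz] by (simp add: add_ac)
  have "of_real (norm (Gamma (1 + z)) ^ 2) = Gamma (1 + z) * cnj (Gamma (1 + z))"
    by (rule complex_norm_square)
  also have "cnj (Gamma (1 + z)) = Gamma (1 - z)" by (simp add: z_def cnj_Gamma)
  also have "Gamma (1 + z) * Gamma (1 - z) = z * Gamma z * Gamma (1 - z)" unfolding Gp ..
  also have "z * Gamma z * Gamma (1 - z) = z * (of_real pi / sin (of_real pi * z))"
    by (simp only: mult.assoc Gamma_reflection_complex)
  also have "sin (of_real pi * z) = \<i> * of_real (sinh (pi * t))"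
  proof -
    have "sin (of_real pi * z) = \<i> * sinh (of_real (pi * t))"
      using sinh_conv_sin[of "of_real (pi * t)"] by (simp add: z_def mult_ac)
    thus ?thesis by (simp only: complex_of_real_sinh)
  qed
  also have "z * (of_real pi / (\<i> * of_real (sinh (pi * t)))) = of_real (pi * t / sinh (pi * t))"
    using assms by (simp add: z_def)
  finally show ?thesis unfolding z_def of_real_eq_iff .
qed

text \<open>With y = pi t/2 the Gamma and cosine factors of the functional equation combine to
  |Gamma(1+it)|^2 (2 cosh y)^2 = 4 y coth y >= 4|y|. This is at least 1 + |t| for |t| > 1, so after
  a square root half a power is gained over the trivial factor |1 - s|, giving 2 + \<delta> - 1/2 in
  the exponent. For |t| <= 1 the cubic strip bound contributes the constant 2^3.\<close>

lemma reg_zeta_bound_imaginary: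
  assumes \<delta>: "\<delta> > 0" "\<delta> \<le> 1"
  obtains C where "C > 0" "\<And>t. norm (reg_zeta (\<i> * of_real t)) \<le> C * (1 + \<bar>t\<bar>) powr (3 / 2 + \<delta>)"
proof -
  obtain C1 where C1: "C1 > 0" "\<And>s. 1 \<le> Re s \<Longrightarrow> Re s \<le> 2 \<Longrightarrow> norm (reg_zeta s) \<le> C1 * (1 + \<bar>Im s\<bar>) powr (1 + \<delta>)"
    by (rule reg_zeta_bound_right[OF \<delta>]) (rule that)
  obtain C2 where C2: "C2 > 0" "\<And>s. 0 \<le> Re s \<Longrightarrow> Re s \<le> 1 \<Longrightarrow> norm (reg_zeta s) \<le> C2 * (1 + \<bar>Im s\<bar>) ^ 3"
    by (rule reg_zeta_bound_strip) (rule that)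
  show ?thesis
  proof (rule that[of "C1 + 8 * C2"])
    show "C1 + 8 * C2 > 0" using C1 C2 by simp
    fix t :: real
    define X where "X = 1 + \<bar>t\<bar>"
    have X: "X \<ge> 1" by (simp add: X_def)
    show "norm (reg_zeta (\<i> * of_real t)) \<le> (C1 + 8 * C2) * (1 + \<bar>t\<bar>) powr (3 / 2 + \<delta>)"
    proof (cases "\<bar>t\<bar> \<le> 1")
      case True
      have "norm (reg_zeta (\<i> * of_real t)) \<le> C2 * X ^ 3" using C2(2)[of "\<i> * of_real t"] by (simp add: X_def)
      also have "X ^ 3 \<le> 2 ^ 3" using True X by (intro power_mono) (auto simp: X_def)
      also have "C2 * 2 ^ 3 \<le> (C1 + 8 * C2) * 1" using C1 by simp
      also have "\<dots> \<le> (C1 + 8 * C2) * X powr (3 / 2 + \<delta>)"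
        using C1 C2 X \<delta> by (intro mult_left_mono ge_one_powr_ge_zero) auto
      finally show ?thesis using C2 by (simp add: X_def)
    next
      case False
      define s where "s = \<i> * complex_of_real t"
      define y where "y = pi * t / 2"
      have t0: "t \<noteq> 0" using False by auto
      have y0: "y \<noteq> 0" using t0 by (simp add: y_def)
      have nz: "1 + s \<notin> \<int>\<^sub>\<le>\<^sub>0" using t0 by (auto simp: s_def complex_eq_iff elim!: nonpos_Ints_cases')
      have "Gamma (s + 2) = (1 + s) * Gamma (1 + s)" using Gamma_plus1[OF nz] by (simp add: add_ac)
      hence "(1 + s) * (Gamma (1 + s) * reg_zeta s * (2 * cos (of_real pi * s / 2))) = (1 + s) * ((1 - s) * (2 * of_real pi) powr s * reg_zeta (1 - s))"
        using zeta_FE[of s] by (simp add: s_def algebra_simps)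
      moreover have "1 + s \<noteq> 0" using nz by auto
      ultimately have "Gamma (1 + s) * reg_zeta s * (2 * cos (of_real pi * s / 2)) = (1 - s) * (2 * of_real pi) powr s * reg_zeta (1 - s)"
        by simp
      hence "norm (Gamma (1 + s)) * norm (reg_zeta s) * (2 * norm (cos (of_real pi * s / 2))) = norm (1 - s) * norm ((2 * of_real pi) powr s) * norm (reg_zeta (1 - s))"
        by (metis norm_mult norm_numeral)
      also have "norm ((2 * of_real pi) powr s) = 1"
        using norm_powr_real_powr[of "2 * of_real pi" s] by (simp add: s_def)
      also have "norm (cos (of_real pi * s / 2)) = cosh y"
      proof -
        have "cos (of_real pi * s / 2) = cos (\<i> * of_real y)" by (simp add: s_def y_def mult_ac)
        also have "\<dots> = cosh (of_real y)" by (simp add: cosh_conv_cos)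
        also have "\<dots> = of_real (cosh y)" by (rule complex_of_real_cosh)
        finally show ?thesis by simp
      qed
      finally have "(norm (Gamma (1 + s)) * norm (reg_zeta s) * (2 * cosh y)) ^ 2 = (norm (1 - s) * norm (reg_zeta (1 - s))) ^ 2"
        by simp
      hence 1: "norm (Gamma (1 + s)) ^ 2 * (4 * cosh y ^ 2) * norm (reg_zeta s) ^ 2 = (norm (1 - s) * norm (reg_zeta (1 - s))) ^ 2"
        by (simp add: power_mult_distrib mult_ac)
      have "norm (Gamma (1 + s)) ^ 2 * (4 * cosh y ^ 2) = 4 * (y * cosh y / sinh y)"
      proof -
        have "norm (Gamma (1 + s)) ^ 2 = pi * t / sinh (pi * t)" unfolding s_def by (rule norm_Gamma_one_plus_imaginary) fact
        also have "pi * t = 2 * y" by (simp add: y_def)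
        also have "sinh (2 * y) = 2 * sinh y * cosh y" by (rule sinh_double)
        finally show ?thesis by (simp add: power2_eq_square)
      qed
      moreover have "y * cosh y / sinh y \<ge> \<bar>y\<bar>"
      proof (cases "y > 0")
        case True
        thus ?thesis using sinh_le_cosh_real[of y] by (simp add: pos_le_divide_eq)
      next
        case False
        hence "y < 0" using y0 by simp
        moreover have "y * cosh y \<le> y * (- sinh y)"
          using sinh_le_cosh_real[of "-y"] \<open>y < 0\<close> by (intro mult_left_mono_neg) auto
        ultimately show ?thesis by (simp add: neg_le_divide_eq)
      qed
      moreover have "4 * \<bar>y\<bar> \<ge> X"
      proof -
        have "2 * \<bar>t\<bar> \<le> pi * \<bar>t\<bar>" using pi_ge_two by (intro mult_right_mono) auto
        thus ?thesis using False by (simp add: y_def X_def abs_mult)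
      qed
      ultimately have "X * norm (reg_zeta s) ^ 2 \<le> norm (Gamma (1 + s)) ^ 2 * (4 * cosh y ^ 2) * norm (reg_zeta s) ^ 2"
        by (intro mult_right_mono) auto
      also have "\<dots> \<le> (X * (C1 * X powr (1 + \<delta>))) ^ 2"
        unfolding 1
      proof (intro power_mono mult_mono)
        show "norm (1 - s) \<le> X" using norm_triangle_ineq4[of 1 s] by (simp add: s_def X_def norm_mult)
        show "norm (reg_zeta (1 - s)) \<le> C1 * X powr (1 + \<delta>)" using C1(2)[of "1 - s"] by (simp add: s_def X_def)
      qed (use X in auto)
      finally have "X * norm (reg_zeta s) ^ 2 \<le> X * (C1 ^ 2 * (X * (X powr (1 + \<delta>)) ^ 2))"
        by (simp add: power2_eq_square mult_ac)
      hence "norm (reg_zeta s) ^ 2 \<le> C1 ^ 2 * (X * (X powr (1 + \<delta>)) ^ 2)" using X by simp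
      also have "X * (X powr (1 + \<delta>)) ^ 2 = (X powr (3 / 2 + \<delta>)) ^ 2"
      proof -
        have "X powr 1 * (X powr (1 + \<delta>) * X powr (1 + \<delta>)) = X powr (3 / 2 + \<delta>) * X powr (3 / 2 + \<delta>)"
          unfolding powr_add[symmetric] by (rule arg_cong[of _ _ "(powr) X"]) simp
        thus ?thesis using X by (simp add: power2_eq_square)
      qed
      also have "C1 ^ 2 * \<dots> = (C1 * X powr (3 / 2 + \<delta>)) ^ 2" by (simp add: power_mult_distrib)
      finally have "norm (reg_zeta s) \<le> C1 * X powr (3 / 2 + \<delta>)"
        by (rule power2_le_imp_le) (use C1 in auto)
      also have "\<dots> \<le> (C1 + 8 * C2) * X powr (3 / 2 + \<delta>)" using C2 by (intro mult_right_mono) auto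
      finally show ?thesis by (simp add: s_def X_def)
    qed
  qed
qed

text \<open>Dividing by the zero-free function M0^(1-s) M1^s, of modulus at least 1/B on the strip,
  normalises both boundary bounds to 1. Uniform decay of f makes the horizontal sides of a tall
  rectangle harmless, so the maximum modulus principle on that rectangle suffices.\<close>

lemma three_lines:
  fixes f :: "complex \<Rightarrow> complex"
  assumes hol: "f holomorphic_on U" and U: "{s. 0 \<le> Re s \<and> Re s \<le> 1} \<subseteq> U"
    and M: "M0 > 0" "M1 > 0"
    and b0: "\<And>s. Re s = 0 \<Longrightarrow> norm (f s) \<le> M0" and b1: "\<And>s. Re s = 1 \<Longrightarrow> norm (f s) \<le> M1"
    and decay: "\<And>e. e > 0 \<Longrightarrow> \<exists>R. \<forall>s. 0 \<le> Re s \<and> Re s \<le> 1 \<and> \<bar>Im s\<bar> \<ge> R \<longrightarrow> norm (f s) \<le> e"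
    and s0: "0 \<le> Re s0" "Re s0 \<le> 1"
  shows "norm (f s0) \<le> M0 powr (1 - Re s0) * M1 powr (Re s0)"
proof -
  define g where "g s = f s * exp (- ((1 - s) * of_real (ln M0) + s * of_real (ln M1)))" for s
  define B where "B = exp (\<bar>ln M0\<bar> + \<bar>ln M1\<bar>)"
  have ne: "norm (exp (- ((1 - s) * of_real (ln M0) + s * of_real (ln M1)))) = exp (- ((1 - Re s) * ln M0 + Re s * ln M1))" for s
    by (simp add: norm_exp_eq_Re)
  have B: "exp (- ((1 - Re s) * ln M0 + Re s * ln M1)) \<le> B" if "0 \<le> Re s" "Re s \<le> 1" for s
  proof -
    have "- ((1 - Re s) * ln M0) \<le> 1 * \<bar>ln M0\<bar>"
      using that mult_right_mono[of "1 - Re s" 1 "\<bar>ln M0\<bar>"] abs_ge_self[of "- ((1 - Re s) * ln M0)"] by (simp add: abs_mult)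
    moreover have "- (Re s * ln M1) \<le> 1 * \<bar>ln M1\<bar>"
      using that mult_right_mono[of "Re s" 1 "\<bar>ln M1\<bar>"] abs_ge_self[of "- (Re s * ln M1)"] by (simp add: abs_mult)
    ultimately show ?thesis by (simp add: B_def)
  qed
  have Bp: "B > 0" by (simp add: B_def)
  obtain R0 where R0: "\<And>s. 0 \<le> Re s \<Longrightarrow> Re s \<le> 1 \<Longrightarrow> \<bar>Im s\<bar> \<ge> R0 \<Longrightarrow> norm (f s) \<le> 1 / B"
    using decay[of "1 / B"] Bp by auto
  define R where "R = max R0 (\<bar>Im s0\<bar> + 1)"
  define S where "S = cbox (Complex 0 (- R)) (Complex 1 R)"
  have Sin: "z \<in> S \<longleftrightarrow> 0 \<le> Re z \<and> Re z \<le> 1 \<and> -R \<le> Im z \<and> Im z \<le> R" for z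
    by (auto simp: S_def in_cbox_complex_iff)
  have SU: "S \<subseteq> U" using U by (auto simp: Sin)
  have holg: "g holomorphic_on U" unfolding g_def by (intro holomorphic_intros hol)
  have "norm (g s0) \<le> 1"
  proof (rule maximum_modulus_frontier[of g S])
    show "g holomorphic_on interior S" using holg interior_subset SU by (blast intro: holomorphic_on_subset)
    have "closure S = S" by (simp add: S_def closure_closed)
    thus "continuous_on (closure S) g" using holg SU holomorphic_on_imp_continuous_on holomorphic_on_subset by metis
    show "bounded S" by (simp add: S_def bounded_cbox)
    show "s0 \<in> S" using s0 by (auto simp: Sin R_def)
    fix z assume "z \<in> frontier S"
    hence z: "z \<in> S" "z \<notin> box (Complex 0 (- R)) (Complex 1 R)"
      by (auto simp: frontier_def S_def closure_closed interior_cbox)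
    hence zr: "0 \<le> Re z" "Re z \<le> 1" by (auto simp: Sin)
    from z have "Re z = 0 \<or> Re z = 1 \<or> \<bar>Im z\<bar> = R" by (auto simp: Sin in_box_complex_iff)
    thus "norm (g z) \<le> 1"
    proof (elim disjE)
      assume a: "Re z = 0"
      have "norm (g z) = norm (f z) / M0" using M unfolding g_def norm_mult ne by (simp add: a exp_minus divide_inverse)
      thus ?thesis using b0[OF a] M by simp
    next
      assume a: "Re z = 1"
      have "norm (g z) = norm (f z) / M1" using M unfolding g_def norm_mult ne by (simp add: a exp_minus divide_inverse)
      thus ?thesis using b1[OF a] M by simp
    next
      assume a: "\<bar>Im z\<bar> = R"
      have "norm (g z) \<le> 1 / B * B"
        unfolding g_def norm_mult ne using a zr by (intro mult_mono R0 B) (auto simp: R_def B_def)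
      thus ?thesis using Bp by simp
    qed
  qed
  hence "norm (f s0) * exp (- ((1 - Re s0) * ln M0 + Re s0 * ln M1)) \<le> 1"
    unfolding g_def norm_mult ne .
  moreover have "x \<le> exp w" if "x * exp (- w) \<le> 1" for x w :: real
    using that by (simp add: exp_minus divide_inverse[symmetric])
  ultimately have "norm (f s0) \<le> exp ((1 - Re s0) * ln M0 + Re s0 * ln M1)" by blast
  thus ?thesis using M by (simp add: powr_def exp_add)
qed

text \<open>Squaring e^(v^2/2) >= 1 + v^2/2 gives a quartic lower bound for the exponential, enough
  to absorb a cube.\<close>

lemma cubic_times_gaussian_le:
  fixes v :: real
  assumes "v \<ge> 0"
  shows "(1 + v) ^ 3 * exp (- (v\<^sup>2)) \<le> 64"
proof -
  have "exp (v\<^sup>2) = exp (v\<^sup>2 / 2) ^ 2" by (simp flip: exp_of_nat_mult)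
  also have "\<dots> \<ge> (1 + v\<^sup>2 / 2) ^ 2" by (intro power_mono exp_ge_add_one_self) auto
  finally have e: "exp (v\<^sup>2) \<ge> (1 + v\<^sup>2 / 2) ^ 2" .
  have "(1 + v) ^ 3 \<le> 64 * (1 + v\<^sup>2 / 2) ^ 2"
  proof -
    show ?thesis
    proof (cases "v \<le> 1")
      case True
      hence "(1 + v) ^ 3 \<le> 2 ^ 3" using assms by (intro power_mono) auto
      also have "\<dots> \<le> 64 * 1 ^ 2" by simp
      also have "\<dots> \<le> 64 * (1 + v\<^sup>2 / 2) ^ 2" by (intro mult_left_mono power_mono) auto
      finally show ?thesis .
    next
      case False
      hence "(1 + v) ^ 3 \<le> (2 * v) ^ 3" by (intro power_mono) auto
      also have "\<dots> = 8 * v ^ 3" by (simp add: power_mult_distrib)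
      also have "\<dots> \<le> 8 * v ^ 4" using False by (intro mult_left_mono power_increasing) auto
      also have "\<dots> = 32 * (v\<^sup>2 / 2) ^ 2" by (simp add: power_divide)
      also have "\<dots> \<le> 64 * (1 + v\<^sup>2 / 2) ^ 2" by (intro mult_mono power_mono) auto
      finally show ?thesis .
    qed
  qed
  also have "\<dots> \<le> 64 * exp (v\<^sup>2)" using e by simp
  finally show ?thesis by (simp add: exp_minus field_simps)
qed

text \<open>Peetre's inequality: a polynomial weight at t is transferred to T at the cost of a power
  of the distance, which the Gaussian then absorbs.\<close>

lemma one_plus_abs_mult: "1 + \<bar>t\<bar> \<le> (1 + \<bar>T\<bar>) * (1 + \<bar>t - T\<bar>)" for t T :: real
proof -
  have "\<bar>t\<bar> \<le> \<bar>T\<bar> + \<bar>t - T\<bar>" by simp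
  moreover have "0 \<le> \<bar>T\<bar> * \<bar>t - T\<bar>" by simp
  ultimately have "1 + \<bar>t\<bar> \<le> 1 + \<bar>T\<bar> + \<bar>t - T\<bar> + \<bar>T\<bar> * \<bar>t - T\<bar>" by linarith
  thus ?thesis by (simp add: distrib_left distrib_right add_ac)
qed

lemma powr_times_gaussian_le:
  fixes t T p :: real
  assumes "0 \<le> p" "p \<le> 3"
  shows "(1 + \<bar>t\<bar>) powr p * exp (- ((t - T)\<^sup>2)) \<le> 64 * (1 + \<bar>T\<bar>) powr p"
proof -
  have "(1 + \<bar>t\<bar>) powr p \<le> ((1 + \<bar>T\<bar>) * (1 + \<bar>t - T\<bar>)) powr p"
    using one_plus_abs_mult assms by (intro powr_mono2) auto
  also have "\<dots> = (1 + \<bar>T\<bar>) powr p * (1 + \<bar>t - T\<bar>) powr p" by (simp add: powr_mult)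
  also have "\<dots> \<le> (1 + \<bar>T\<bar>) powr p * (1 + \<bar>t - T\<bar>) powr 3"
    using assms by (intro mult_left_mono powr_mono) auto
  also have "(1 + \<bar>t - T\<bar>) powr 3 = (1 + \<bar>t - T\<bar>) ^ 3" by simp
  finally have "(1 + \<bar>t\<bar>) powr p * exp (- ((t - T)\<^sup>2)) \<le> ((1 + \<bar>T\<bar>) powr p * (1 + \<bar>t - T\<bar>) ^ 3) * exp (- ((t - T)\<^sup>2))"
    by (rule mult_right_mono) auto
  also have "\<dots> = (1 + \<bar>T\<bar>) powr p * ((1 + \<bar>t - T\<bar>) ^ 3 * exp (- (\<bar>t - T\<bar>\<^sup>2)))" by simp
  also have "\<dots> \<le> (1 + \<bar>T\<bar>) powr p * 64" by (intro mult_left_mono cubic_times_gaussian_le) auto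
  finally show ?thesis by simp
qed

text \<open>Convexity: the three lines lemma is applied to \<open>(s - 1) \<zeta>(s) exp ((s - iT)\<^sup>2)\<close>, where the Gaussian
  factor localises the bounds on the two boundary lines near height \<open>T\<close>.\<close>

lemma zeta_growth:
  assumes c: "0 < c" "c < 1"
  obtains \<theta> C where "0 \<le> \<theta>" "\<theta> < 1 / 2" "C > 0"
    "\<And>s. c \<le> Re s \<Longrightarrow> Re s \<le> 2 \<Longrightarrow> norm (reg_zeta s) \<le> C * (1 + \<bar>Im s\<bar>) powr (1 + \<theta>)"
proof -
  \<comment> \<open>With this choice the final exponent \<theta> = (1-c)/2 + \<delta> equals 1/2 -
    c/4, strictly below 1/2.\<close>
  define \<delta> where "\<delta> = c / 4"
  have \<delta>: "\<delta> > 0" "\<delta> \<le> 1" using c by (auto simp: \<delta>_def)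
  obtain C1 where C1: "C1 > 0" "\<And>s. 1 \<le> Re s \<Longrightarrow> Re s \<le> 2 \<Longrightarrow> norm (reg_zeta s) \<le> C1 * (1 + \<bar>Im s\<bar>) powr (1 + \<delta>)"
    by (rule reg_zeta_bound_right[OF \<delta>]) (rule that)
  obtain C0 where C0: "C0 > 0" "\<And>t. norm (reg_zeta (\<i> * of_real t)) \<le> C0 * (1 + \<bar>t\<bar>) powr (3 / 2 + \<delta>)"
    by (rule reg_zeta_bound_imaginary[OF \<delta>]) (rule that)
  obtain C2 where C2: "C2 > 0" "\<And>s. 0 \<le> Re s \<Longrightarrow> Re s \<le> 1 \<Longrightarrow> norm (reg_zeta s) \<le> C2 * (1 + \<bar>Im s\<bar>) ^ 3"
    by (rule reg_zeta_bound_strip) (rule that)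
  \<comment> \<open>The factor 64 comes from moving the weight to height T under the Gaussian, and e
    bounds exp((Re s)^2) on the strip.\<close>
  define K where "K = (C0 + C1) * (64 * exp 1)"
  define \<theta> where "\<theta> = (1 - c) / 2 + \<delta>"
  have K: "K > 0" using C0 C1 by (simp add: K_def)
  have C1K: "C1 \<le> K"
  proof -
    have "C1 * 1 \<le> (C0 + C1) * (64 * exp 1)"
      using C0 C1 exp_ge_add_one_self[of 1] by (intro mult_mono) auto
    thus ?thesis by (simp add: K_def)
  qed
  have strip: "norm (reg_zeta s0) \<le> K * (1 + \<bar>Im s0\<bar>) powr (1 + \<delta> + (1 - Re s0) / 2)" if s0: "0 \<le> Re s0" "Re s0 \<le> 1" for s0
  proof -
    define T where "T = Im s0"
    define X where "X = 1 + \<bar>T\<bar>"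
    have X: "X \<ge> 1" by (simp add: X_def)
    define f where "f s = reg_zeta s * exp ((s - \<i> * of_real T) ^ 2)" for s
    have nf: "norm (f s) = norm (reg_zeta s) * (exp ((Re s)\<^sup>2) * exp (- ((Im s - T)\<^sup>2)))" for s
      by (simp add: f_def norm_mult norm_exp_eq_Re power2_eq_square flip: exp_add)
    have re: "exp ((Re s)\<^sup>2) \<le> exp 1" if "0 \<le> Re s" "Re s \<le> 1" for s
      using that by (simp add: power_le_one)
    have "norm (f s0) \<le> (K * X powr (3 / 2 + \<delta>)) powr (1 - Re s0) * (K * X powr (1 + \<delta>)) powr (Re s0)"
    proof (rule three_lines[where U = "{s. Re s > -1}"])
      show "f holomorphic_on {s. Re s > -1}" unfolding f_def
        by (intro holomorphic_intros holomorphic_reg_zeta)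
      show "norm (f s) \<le> K * X powr (3 / 2 + \<delta>)" if "Re s = 0" for s
      proof -
        have s: "s = \<i> * of_real (Im s)" using that by (simp add: complex_eq_iff)
        have "norm (f s) \<le> (C0 * (1 + \<bar>Im s\<bar>) powr (3 / 2 + \<delta>)) * (exp 1 * exp (- ((Im s - T)\<^sup>2)))"
          unfolding nf using C0(1) C0(2)[of "Im s"] s that re[of s] by (intro mult_mono) auto
        also have "\<dots> = C0 * exp 1 * ((1 + \<bar>Im s\<bar>) powr (3 / 2 + \<delta>) * exp (- ((Im s - T)\<^sup>2)))" by simp
        also have "\<dots> \<le> C0 * exp 1 * (64 * X powr (3 / 2 + \<delta>))"
          unfolding X_def using C0 \<delta> by (intro mult_left_mono powr_times_gaussian_le) auto
        also have "\<dots> \<le> K * X powr (3 / 2 + \<delta>)" using C1 by (simp add: K_def algebra_simps)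
        finally show ?thesis .
      qed
      show "norm (f s) \<le> K * X powr (1 + \<delta>)" if "Re s = 1" for s
      proof -
        have "norm (f s) \<le> (C1 * (1 + \<bar>Im s\<bar>) powr (1 + \<delta>)) * (exp 1 * exp (- ((Im s - T)\<^sup>2)))"
          unfolding nf using C1(1) C1(2)[of s] that re[of s] by (intro mult_mono) auto
        also have "\<dots> = C1 * exp 1 * ((1 + \<bar>Im s\<bar>) powr (1 + \<delta>) * exp (- ((Im s - T)\<^sup>2)))" by simp
        also have "\<dots> \<le> C1 * exp 1 * (64 * X powr (1 + \<delta>))"
          unfolding X_def using C1 \<delta> by (intro mult_left_mono powr_times_gaussian_le) auto
        also have "\<dots> \<le> K * X powr (1 + \<delta>)" using C0 by (simp add: K_def algebra_simps)
        finally show ?thesis .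
      qed
      show "\<exists>R. \<forall>s. 0 \<le> Re s \<and> Re s \<le> 1 \<and> R \<le> \<bar>Im s\<bar> \<longrightarrow> norm (f s) \<le> e" if e: "e > 0" for e
      proof -
        have "((\<lambda>v::real. (1 + v) ^ 3 * exp (- (v\<^sup>2))) \<longlongrightarrow> 0) at_top" by real_asymp
        moreover have "e / (C2 * exp 1 * X ^ 3) > 0" using e C2 X by simp
        ultimately have "eventually (\<lambda>v::real. (1 + v) ^ 3 * exp (- (v\<^sup>2)) < e / (C2 * exp 1 * X ^ 3)) at_top"
          by (rule order_tendstoD)
        then obtain V where V: "\<And>v::real. v \<ge> V \<Longrightarrow> (1 + v) ^ 3 * exp (- (v\<^sup>2)) < e / (C2 * exp 1 * X ^ 3)"
          by (auto simp: eventually_at_top_linorder)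
        have "norm (f s) \<le> e" if s: "0 \<le> Re s" "Re s \<le> 1" "V + \<bar>T\<bar> \<le> \<bar>Im s\<bar>" for s
        proof -
          have v: "\<bar>Im s - T\<bar> \<ge> V" using s by linarith
          have "norm (f s) \<le> (C2 * (1 + \<bar>Im s\<bar>) ^ 3) * (exp 1 * exp (- ((Im s - T)\<^sup>2)))"
            unfolding nf using C2(1) C2(2)[of s] s re[of s] by (intro mult_mono) auto
          also have "\<dots> \<le> (C2 * (X * (1 + \<bar>Im s - T\<bar>)) ^ 3) * (exp 1 * exp (- ((Im s - T)\<^sup>2)))"
            unfolding X_def using C2 one_plus_abs_mult by (intro mult_right_mono mult_left_mono power_mono) auto
          also have "\<dots> = (C2 * exp 1 * X ^ 3) * ((1 + \<bar>Im s - T\<bar>) ^ 3 * exp (- (\<bar>Im s - T\<bar>\<^sup>2)))"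
            by (simp add: power_mult_distrib)
          also have "\<dots> \<le> (C2 * exp 1 * X ^ 3) * (e / (C2 * exp 1 * X ^ 3))"
            using V[OF v] C2 X by (intro mult_left_mono) auto
          also have "\<dots> = e" using C2 X by simp
          finally show ?thesis .
        qed
        thus ?thesis by blast
      qed
    qed (use K X s0 in auto)
    also have "\<dots> = K powr ((1 - Re s0) + Re s0) * X powr ((3 / 2 + \<delta>) * (1 - Re s0) + (1 + \<delta>) * Re s0)"
    proof -
      have kx: "(K * X powr a) powr x = K powr x * X powr (a * x)" for a x
        using K X by (simp add: powr_mult powr_powr)
      show ?thesis unfolding kx powr_add[of K] powr_add[of X "(3 / 2 + \<delta>) * (1 - Re s0)"] by (simp only: mult_ac)
    qed
    also have "\<dots> = K * X powr (1 + \<delta> + (1 - Re s0) / 2)"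
      using K by (simp add: field_simps)
    finally have "norm (f s0) \<le> K * X powr (1 + \<delta> + (1 - Re s0) / 2)" .
    moreover have "norm (reg_zeta s0) * 1 \<le> norm (f s0)"
      unfolding nf by (intro mult_left_mono) (auto simp: T_def)
    ultimately show ?thesis by (simp add: X_def T_def)
  qed
  show ?thesis
  proof (rule that[of \<theta> K])
    show "0 \<le> \<theta>" "\<theta> < 1 / 2" using c by (auto simp: \<theta>_def \<delta>_def field_simps)
    fix s assume s: "c \<le> Re s" "Re s \<le> 2"
    show "norm (reg_zeta s) \<le> K * (1 + \<bar>Im s\<bar>) powr (1 + \<theta>)"
    proof (cases "Re s \<le> 1")
      case True
      have "norm (reg_zeta s) \<le> K * (1 + \<bar>Im s\<bar>) powr (1 + \<delta> + (1 - Re s) / 2)" using s c True by (intro strip) auto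
      also have "\<dots> \<le> K * (1 + \<bar>Im s\<bar>) powr (1 + \<theta>)"
        using K s by (intro mult_left_mono powr_mono) (auto simp: \<theta>_def)
      finally show ?thesis .
    next
      case False
      have "norm (reg_zeta s) \<le> C1 * (1 + \<bar>Im s\<bar>) powr (1 + \<delta>)" using s False by (intro C1(2)) auto
      also have "\<dots> \<le> K * (1 + \<bar>Im s\<bar>) powr (1 + \<theta>)"
        using K C1K c by (intro mult_mono powr_mono) (auto simp: \<theta>_def)
      finally show ?thesis .
    qed
  qed (rule K)
qed

section \<open>Fourier inversion\<close>

lemma integrable_exp_minus_abs:
  fixes \<delta> :: real assumes "\<delta> > 0"
  shows "integrable lborel (\<lambda>x::real. exp (- \<delta> * \<bar>x\<bar>))"
proof -
  have *: "((\<lambda>x. exp (- \<delta> * x)) has_integral (1 / \<delta>)) {0..}"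
    using has_integral_exp_minus_to_infinity[OF assms, of 0] by simp
  have 1: "set_integrable lebesgue {0..} (\<lambda>x::real. exp (- \<delta> * x))"
    using * by (intro nonnegative_absolutely_integrable_1) (auto simp: has_integral_iff)
  hence 3: "integrable lborel (\<lambda>x::real. indicator {0..} x *\<^sub>R exp (- \<delta> * x))"
    unfolding set_integrable_def by (subst (asm) integrable_completion) auto
  have 4: "integrable lborel (\<lambda>x::real. indicator {0..} (-x) *\<^sub>R exp (- \<delta> * (-x)))"
    using lborel_integrable_real_affine[OF 3, of "-1" 0] by simp
  show ?thesis
    by (rule Bochner_Integration.integrable_bound[OF Bochner_Integration.integrable_add[OF 3 4]])
       (auto intro!: AE_I2 split: split_indicator)
qed

lemma integrable_one_plus_abs_powr:
  fixes p :: real assumes "p > 1"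
  shows "integrable lborel (\<lambda>x::real. (1 + \<bar>x\<bar>) powr (- p))"
proof -
  have *: "((\<lambda>x. x powr (- p)) has_integral - (1 powr (- p + 1)) / (- p + 1)) {1..}"
    using assms by (intro has_integral_powr_to_inf) auto
  have 1: "set_integrable lebesgue {1..} (\<lambda>x::real. x powr (- p))"
    using * by (intro nonnegative_absolutely_integrable_1) (auto simp: has_integral_iff)
  hence 2: "integrable lborel (\<lambda>x::real. indicator {1..} x *\<^sub>R x powr (- p))"
    unfolding set_integrable_def by (subst (asm) integrable_completion) auto
  have 3: "integrable lborel (\<lambda>x::real. indicator {1..} (1 + x) *\<^sub>R (1 + x) powr (- p))"
    using lborel_integrable_real_affine[OF 2, of 1 1] by simp
  have 4: "integrable lborel (\<lambda>x::real. indicator {1..} (1 - x) *\<^sub>R (1 - x) powr (- p))"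
    using lborel_integrable_real_affine[OF 2, of "-1" 1] by simp
  show ?thesis
    by (rule Bochner_Integration.integrable_bound[OF Bochner_Integration.integrable_add[OF 3 4]])
       (auto intro!: AE_I2 split: split_indicator)
qed

lemma std_normal_fourier:
  "integrable lborel (\<lambda>x. complex_of_real (std_normal_density x) * iexp (t * x))"
  "(LINT x|lborel. complex_of_real (std_normal_density x) * iexp (t * x)) = exp (- (of_real t)\<^sup>2 / 2)"
proof -
  show int: "integrable lborel (\<lambda>x. complex_of_real (std_normal_density x) * iexp (t * x))"
    by (rule Bochner_Integration.integrable_bound[OF integrable_normal_moment[where k = 0 and \<sigma> = 1 and \<mu> = 0]])
       (auto intro!: AE_I2 simp: norm_mult)
  have "char std_normal_distribution t = (LINT x|lborel. std_normal_density x *\<^sub>R iexp (t * x))"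
    unfolding char_def by (subst integral_density) auto
  thus "(LINT x|lborel. complex_of_real (std_normal_density x) * iexp (t * x)) = exp (- (of_real t)\<^sup>2 / 2)"
    unfolding char_std_normal_distribution by (simp add: scaleR_conv_of_real exp_of_real[symmetric])
qed

text \<open>Gauss-Weierstrass summation. Inserting g(\<epsilon>t) for the normal density g makes the
  double integral absolutely convergent, and Fubini turns it into a Gaussian average of h around x0
  at scale \<epsilon>. As \<epsilon> tends to 0, dominated convergence acts on both sides: through
  integrability of H on one, through boundedness and continuity of h on the other.\<close>

theorem fourier_inversion:
  fixes h H :: "real \<Rightarrow> complex"
  assumes int: "integrable lborel h" and cont: "continuous_on UNIV h" and bdd: "\<And>x. norm (h x) \<le> B"
    and H: "\<And>t. H t = (LINT x|lborel. h x * iexp (t * x))" and intH: "integrable lborel H"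
  shows "h x0 = (LINT t|lborel. H t * iexp (- (t * x0))) / (2 * of_real pi)"
proof -
  define g where "g = std_normal_density"
  have g0: "g x \<ge> 0" for x by (simp add: g_def)
  have [measurable]: "g \<in> borel_measurable borel" "h \<in> borel_measurable borel" "H \<in> borel_measurable borel"
    using int intH cont by (auto simp: g_def borel_measurable_continuous_onI)
  have gint: "integrable lborel g" unfolding g_def by (intro integrable_normal_density) auto
  have gone: "(LINT x|lborel. g x) = 1" unfolding g_def by (intro integral_normal_density) auto
  have key: "(LINT t|lborel. H t * iexp (- (t * x0)) * of_real (g (\<epsilon> * t))) =
     of_real (sqrt (2 * pi)) * (LINT z|lborel. h (x0 + \<epsilon> * z) * of_real (g z))" if \<epsilon>: "\<epsilon> > 0" for \<epsilon>
  proof -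
    let ?F = "\<lambda>t x. h x * iexp (t * (x - x0)) * of_real (g (\<epsilon> * t))"
    have ge: "integrable lborel (\<lambda>t. g (\<epsilon> * t))"
      using lborel_integrable_real_affine[OF gint, of \<epsilon> 0] \<epsilon> by simp
    have ip: "integrable (lborel \<Otimes>\<^sub>M lborel) (\<lambda>(t, x). ?F t x)"
    proof (rule lborel_pair.Fubini_integrable)
      show "integrable lborel (\<lambda>t. LINT x|lborel. norm (case (t, x) of (t, x) \<Rightarrow> ?F t x))"
        using ge g0 by (auto simp: norm_mult)
      show "AE t in lborel. integrable lborel (\<lambda>x. case (t, x) of (t, x) \<Rightarrow> ?F t x)"
      proof (rule AE_I2)
        fix t
        have "integrable lborel (\<lambda>x. norm (h x) * g (\<epsilon> * t))" using int by auto
        thus "integrable lborel (\<lambda>x. case (t, x) of (t, x) \<Rightarrow> ?F t x)"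
          by (rule Bochner_Integration.integrable_bound) (auto simp: norm_mult g0)
      qed
    qed measurable
    have "(LINT t|lborel. H t * iexp (- (t * x0)) * of_real (g (\<epsilon> * t))) = 
       (LINT t|lborel. (LINT x|lborel. ?F t x))"
    proof (intro Bochner_Integration.integral_cong refl)
      fix t
      have "H t * iexp (- (t * x0)) * of_real (g (\<epsilon> * t)) = (LINT x|lborel. h x * iexp (t * x) * (iexp (- (t * x0)) * of_real (g (\<epsilon> * t))))"
        unfolding H mult.assoc[of "integral\<^sup>L _ _"] by (rule integral_mult_left_zero[symmetric])
      also have "\<dots> = (LINT x|lborel. ?F t x)"
        by (intro Bochner_Integration.integral_cong refl) (simp add: exp_add[symmetric] algebra_simps exp_diff exp_minus divide_simps)
      finally show "H t * iexp (- (t * x0)) * of_real (g (\<epsilon> * t)) = (LINT x|lborel. ?F t x)" .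
    qed
    also have "\<dots> = (LINT x|lborel. (LINT t|lborel. ?F t x))"
      using lborel_pair.Fubini_integral[OF ip] by simp
    also have "\<dots> = (LINT x|lborel. h x * of_real (sqrt (2 * pi) / \<epsilon> * g ((x - x0) / \<epsilon>)))"
    proof (intro Bochner_Integration.integral_cong refl)
      fix x
      define y where "y = (x - x0) / \<epsilon>"
      have xy: "x - x0 = \<epsilon> * y" using \<epsilon> by (simp add: y_def)
      have "(LINT t|lborel. ?F t x) = h x * (LINT t|lborel. of_real (g (\<epsilon> * t)) * iexp (y * (\<epsilon> * t)))"
        unfolding xy by (subst integral_mult_right_zero[symmetric]) (simp add: mult_ac)
      also have "(LINT t|lborel. of_real (g (\<epsilon> * t)) * iexp (y * (\<epsilon> * t))) = (LINT t|lborel. of_real (g t) * iexp (y * t)) / of_real \<epsilon>"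
        using lborel_integral_real_affine[of \<epsilon> "\<lambda>t. of_real (g t) * iexp (y * t)" 0] \<epsilon> by (simp add: scaleR_conv_of_real)
      also have "(LINT t|lborel. of_real (g t) * iexp (y * t)) = of_real (sqrt (2 * pi) * g y)"
        unfolding g_def std_normal_fourier by (simp add: std_normal_density_def exp_of_real[symmetric])
      finally show "(LINT t|lborel. ?F t x) = h x * of_real (sqrt (2 * pi) / \<epsilon> * g ((x - x0) / \<epsilon>))"
        by (simp add: y_def)
    qed
    also have "\<dots> = of_real (sqrt (2 * pi)) * (LINT z|lborel. h (x0 + \<epsilon> * z) * of_real (g z))"
    proof -
      define c where "c = sqrt (2 * pi) / \<epsilon>"
      have "(LINT x|lborel. h x * of_real (c * g ((x - x0) / \<epsilon>))) = \<bar>\<epsilon>\<bar> *\<^sub>R (LINT z|lborel. h (x0 + \<epsilon> * z) * of_real (c * g ((x0 + \<epsilon> * z - x0) / \<epsilon>)))"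
        by (rule lborel_integral_real_affine) (use \<epsilon> in auto)
      also have "(LINT z|lborel. h (x0 + \<epsilon> * z) * of_real (c * g ((x0 + \<epsilon> * z - x0) / \<epsilon>))) = (LINT z|lborel. of_real c * (h (x0 + \<epsilon> * z) * of_real (g z)))"
        using \<epsilon> by (intro Bochner_Integration.integral_cong refl) simp
      also have "\<dots> = of_real c * (LINT z|lborel. h (x0 + \<epsilon> * z) * of_real (g z))" by (rule integral_mult_right_zero)
      finally show ?thesis using \<epsilon> by (simp add: c_def scaleR_conv_of_real)
    qed
    finally show ?thesis .
  qed
  define e where "e n = 1 / real (Suc n)" for n
  have e: "e n > 0" "e \<longlonglongrightarrow> 0" for n
    unfolding e_def using LIMSEQ_inverse_real_of_nat by (auto simp: inverse_eq_divide)
  have gcont: "isCont g x" for x unfolding g_def std_normal_density_def by (auto intro!: continuous_intros)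
  have gle: "g x \<le> g 0" for x by (simp add: g_def std_normal_density_def divide_right_mono)
  have L1: "(\<lambda>n. (LINT t|lborel. H t * iexp (- (t * x0)) * of_real (g (e n * t)))) \<longlonglongrightarrow> (LINT t|lborel. H t * iexp (- (t * x0)) * of_real (g 0))"
  proof (rule integral_dominated_convergence)
    show "integrable lborel (\<lambda>t. norm (H t) * g 0)" using intH by auto
    show "AE t in lborel. (\<lambda>n. H t * iexp (- (t * x0)) * of_real (g (e n * t))) \<longlonglongrightarrow> H t * iexp (- (t * x0)) * of_real (g 0)"
    proof (intro AE_I2 tendsto_intros)
      fix t
      have "(\<lambda>n. e n * t) \<longlonglongrightarrow> 0 * t" by (intro tendsto_intros e)
      thus "(\<lambda>n. g (e n * t)) \<longlonglongrightarrow> g 0" using gcont[of 0] by (auto intro: isCont_tendsto_compose)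
    qed
    show "AE t in lborel. norm (H t * iexp (- (t * x0)) * of_real (g (e n * t))) \<le> norm (H t) * g 0" for n
      by (intro AE_I2) (use g0 gle in \<open>auto simp: norm_mult mult_left_mono\<close>)
  qed measurable
  have L2: "(\<lambda>n. (LINT z|lborel. h (x0 + e n * z) * of_real (g z))) \<longlonglongrightarrow> (LINT z|lborel. h x0 * of_real (g z))"
  proof (rule integral_dominated_convergence)
    show "integrable lborel (\<lambda>z. B * g z)" using gint by auto
    show "AE z in lborel. (\<lambda>n. h (x0 + e n * z) * of_real (g z)) \<longlonglongrightarrow> h x0 * of_real (g z)"
    proof (intro AE_I2 tendsto_intros)
      fix z
      have "(\<lambda>n. x0 + e n * z) \<longlonglongrightarrow> x0 + 0 * z" by (intro tendsto_intros e)
      thus "(\<lambda>n. h (x0 + e n * z)) \<longlonglongrightarrow> h x0" using cont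
        by (auto intro: isCont_tendsto_compose simp: continuous_on_eq_continuous_at)
    qed
    show "AE z in lborel. norm (h (x0 + e n * z) * of_real (g z)) \<le> B * g z" for n
      by (intro AE_I2) (use g0 bdd in \<open>auto simp: norm_mult mult_right_mono\<close>)
  qed measurable
  have "(\<lambda>n. (LINT t|lborel. H t * iexp (- (t * x0)) * of_real (g (e n * t)))) \<longlonglongrightarrow>
      of_real (sqrt (2 * pi)) * (LINT z|lborel. h x0 * of_real (g z))"
    unfolding key[OF e(1)] by (intro tendsto_intros L2)
  with L1 have "(LINT t|lborel. H t * iexp (- (t * x0)) * of_real (g 0)) = of_real (sqrt (2 * pi)) * (LINT z|lborel. h x0 * of_real (g z))"
    by (rule LIMSEQ_unique)
  also have "(LINT z|lborel. h x0 * of_real (g z)) = h x0" using gone by simp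
  finally have "(LINT t|lborel. H t * iexp (- (t * x0))) * of_real (g 0) = of_real (sqrt (2 * pi)) * h x0" by simp
  moreover define J where "J = (LINT t|lborel. H t * iexp (- (t * x0)))"
  ultimately have J: "J * of_real (g 0) = of_real (sqrt (2 * pi)) * h x0" by simp
  have g0: "g 0 * sqrt (2 * pi) = 1" by (simp add: g_def std_normal_density_def)
  have "J = J * of_real (g 0 * sqrt (2 * pi))" unfolding g0 by simp
  also have "\<dots> = J * of_real (g 0) * of_real (sqrt (2 * pi))" by simp
  also have "\<dots> = of_real (sqrt (2 * pi) * sqrt (2 * pi)) * h x0" unfolding J by (simp only: of_real_mult mult_ac)
  also have "sqrt (2 * pi) * sqrt (2 * pi) = 2 * pi" by simp
  finally show ?thesis by (simp add: J_def)
qed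

section \<open>The Dirichlet series of \<open>\<zeta>\<^sup>k\<close>\<close>

text \<open>Index set of the expanded product of k copies of the Dirichlet series. Lists whose
  product is positive contain no 0, so its fibres over n > 0 are the sets counted by
  \<open>divisor_k\<close>.\<close>

definition pos_lists :: "nat \<Rightarrow> nat list set" where
  "pos_lists k = {xs. length xs = k \<and> 0 \<notin> set xs}"

lemma powr_of_nat_mult:
  "complex_of_nat (a * b) powr s = of_nat a powr s * of_nat b powr s"
  using powr_times_real[of "of_nat a" "of_nat b" s] by simp

text \<open>Unordered summation makes the k-fold product a sum over lists, one head entry being
  split off per step. Summability of the norms is carried through the induction because it justifies
  summing over pairs.\<close>

lemma has_sum_pos_lists:
  assumes s: "Re s > 1"
  shows "((\<lambda>xs. 1 / of_nat (prod_list xs) powr s) has_sum riemann_zeta s ^ k) (pos_lists k) \<and>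
    (\<lambda>xs. norm (1 / complex_of_nat (prod_list xs) powr s)) summable_on (pos_lists k)"
proof (induction k)
  case 0
  have "pos_lists 0 = {[]}" by (auto simp: pos_lists_def)
  thus ?case by (intro conjI has_sum_finiteI summable_on_finite) simp_all
next
  case (Suc k)
  define u where "u n = 1 / complex_of_nat (Suc n) powr s" for n
  define w where "w xs = 1 / complex_of_nat (prod_list xs) powr s" for xs
  have nu: "norm (u n) = real (Suc n) powr (- Re s)" for n
    using norm_powr_real_powr[of "of_nat (Suc n)" s] by (simp add: u_def norm_divide powr_minus_divide del: of_nat_Suc)
  have un: "summable (\<lambda>n. norm (u n))" unfolding nu using s by (intro summable_powr_Suc) auto
  have u: "(u has_sum riemann_zeta s) UNIV"
    by (rule norm_summable_imp_has_sum[OF un]) (unfold u_def, rule riemann_zeta_props(2)[OF s])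
  have un': "(\<lambda>n. norm (u n)) summable_on UNIV"
    by (rule summable_nonneg_imp_summable_on[OF un]) auto
  have w: "(w has_sum riemann_zeta s ^ k) (pos_lists k)" "(\<lambda>xs. norm (w xs)) summable_on (pos_lists k)"
    using Suc.IH unfolding w_def[abs_def] by (rule conjunct1, rule conjunct2)
  define f where "f = (\<lambda>(n, xs). u n * w xs)"
  have fn: "(\<lambda>x. norm (f x)) summable_on (UNIV \<times> pos_lists k)"
    using w(2) un' by (intro summable_on_SigmaI[where g = "\<lambda>n. norm (u n) * infsum (\<lambda>xs. norm (w xs)) (pos_lists k)"])
       (simp_all add: f_def norm_mult has_sum_cmult_right summable_on_cmult_left)
  have fs: "(f has_sum (riemann_zeta s * riemann_zeta s ^ k)) (UNIV \<times> pos_lists k)"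
    by (rule has_sum_SigmaI[where g = "\<lambda>n. u n * riemann_zeta s ^ k"])
       (use w(1) u abs_summable_summable[OF fn] in \<open>simp_all add: f_def has_sum_cmult_right has_sum_cmult_left\<close>)
  define j where "j = (\<lambda>(n::nat, xs). Suc n # xs)"
  have bij: "bij_betw j (UNIV \<times> pos_lists k) (pos_lists (Suc k))"
    by (rule bij_betw_byWitness[where f' = "\<lambda>xs. (hd xs - 1, tl xs)"])
       (auto simp: j_def pos_lists_def length_Suc_conv)
  have wj: "w (j x) = f x" for x
    by (cases x) (simp only: w_def j_def f_def u_def prod_list.Cons powr_of_nat_mult prod.case, simp)
  have "(w has_sum (riemann_zeta s ^ Suc k)) (pos_lists (Suc k))"
    using fs by (subst has_sum_reindex_bij_betw[OF bij, symmetric]) (simp add: wj)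
  moreover have "(\<lambda>xs. norm (w xs)) summable_on (pos_lists (Suc k))"
    using fn by (subst summable_on_reindex_bij_betw[OF bij, symmetric]) (simp add: wj)
  ultimately show ?case by (simp add: w_def[abs_def])
qed

text \<open>The sum over lists is regrouped by the value of the product. A fibre is finite because
  every entry divides the product, and its cardinality is the coefficient.\<close>

lemma zeta_power_dirichlet:
  assumes s: "Re s > 1"
  shows "(\<lambda>n. of_nat (divisor_k k (Suc n)) / of_nat (Suc n) powr s) sums (riemann_zeta s ^ k)"
proof -
  define w where "w xs = 1 / complex_of_nat (prod_list xs) powr s" for xs
  define B where "B n = {xs \<in> pos_lists k. prod_list xs = Suc n}" for n
  define j :: "nat \<times> nat list \<Rightarrow> nat list" where "j = snd"
  have bij: "bij_betw j (SIGMA n:UNIV. B n) (pos_lists k)"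
  proof (rule bij_betw_byWitness[where f' = "\<lambda>xs. (prod_list xs - 1, xs)"])
    have "prod_list xs \<noteq> 0" if "xs \<in> pos_lists k" for xs :: "nat list"
      using that by (auto simp: pos_lists_def prod_list_zero_iff)
    thus "(\<lambda>xs. (prod_list xs - 1, xs)) ` pos_lists k \<subseteq> (SIGMA n:UNIV. B n)" by (auto simp: B_def)
  qed (auto simp: j_def B_def)
  have "(w has_sum riemann_zeta s ^ k) (pos_lists k)"
    using has_sum_pos_lists[OF s, of k] by (simp add: w_def[abs_def])
  hence "((\<lambda>x. w (j x)) has_sum riemann_zeta s ^ k) (SIGMA n:UNIV. B n)"
    by (subst has_sum_reindex_bij_betw[OF bij])
  hence "((\<lambda>n. of_nat (divisor_k k (Suc n)) / of_nat (Suc n) powr s) has_sum riemann_zeta s ^ k) UNIV"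
  proof (rule has_sum_Sigma')
    fix n
    have BB: "B n = {xs. length xs = k \<and> prod_list xs = Suc n}"
    proof -
      have "0 \<notin> set xs" if "prod_list xs = Suc n" for xs :: "nat list"
        using that by (metis prod_list_zero_iff Zero_not_Suc)
      thus ?thesis by (auto simp: B_def pos_lists_def)
    qed
    have "finite (B n)"
    proof (rule finite_subset)
      have "x \<le> Suc n" if "x \<in> set xs" "prod_list xs = Suc n" for x and xs :: "nat list"
        using that by (metis dvd_imp_le prod_list_dvd zero_less_Suc)
      thus "B n \<subseteq> {xs. set xs \<subseteq> {..Suc n} \<and> length xs = k}" by (auto simp: B_def pos_lists_def)
    qed (rule finite_lists_length_eq, simp)
    moreover have "(\<Sum>xs\<in>B n. w (j (n, xs))) = (\<Sum>xs\<in>B n. 1 / of_nat (Suc n) powr s)"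
      by (intro sum.cong) (auto simp: B_def w_def j_def)
    moreover have "divisor_k k (Suc n) = card (B n)" by (simp add: BB divisor_k_def)
    ultimately show "((\<lambda>xs. w (j (n, xs))) has_sum of_nat (divisor_k k (Suc n)) / of_nat (Suc n) powr s) (B n)"
      by (intro has_sum_finiteI) auto
  qed
  thus ?thesis by (rule has_sum_imp_sums)
qed

lemma summable_divisor_k:
  assumes "\<sigma> > 1"
  shows "summable (\<lambda>n. real (divisor_k k (Suc n)) * real (Suc n) powr (- \<sigma>))"
proof -
  have "summable (\<lambda>n. of_nat (divisor_k k (Suc n)) / of_nat (Suc n) powr (complex_of_real \<sigma>))"
    using zeta_power_dirichlet[of "of_real \<sigma>" k] assms by (auto simp: sums_iff)
  also have "(\<lambda>n. of_nat (divisor_k k (Suc n)) / of_nat (Suc n) powr (complex_of_real \<sigma>)) =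
     (\<lambda>n. complex_of_real (real (divisor_k k (Suc n)) * real (Suc n) powr (- \<sigma>)))"
  proof
    fix n
    have "of_nat (Suc n) powr (complex_of_real \<sigma>) = of_real (real (Suc n) powr \<sigma>)"
      using powr_of_real[of "real (Suc n)" \<sigma>] by (simp del: of_nat_Suc)
    thus "of_nat (divisor_k k (Suc n)) / of_nat (Suc n) powr (complex_of_real \<sigma>) =
     complex_of_real (real (divisor_k k (Suc n)) * real (Suc n) powr (- \<sigma>))"
      by (simp add: powr_minus_divide del: of_nat_Suc)
  qed
  finally show ?thesis by (simp only: summable_of_real_iff)
qed

section \<open>The kernel of the Riesz means\<close>

text \<open>\<open>(1 - x)\<^sub>+\<^sup>M\<close> in the logarithmic variable; its Mellin transform is the beta function \<open>B(s, M+1)\<close>.\<close>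

definition kern :: "nat \<Rightarrow> real \<Rightarrow> real" where
  "kern M x = (if x < 0 then (1 - exp x) ^ M else 0)"

definition beta_fn :: "nat \<Rightarrow> complex \<Rightarrow> complex" where
  "beta_fn M s = fact M / (\<Prod>j\<le>M. s + of_nat j)"

lemma kern_nonneg: "kern M x \<ge> 0" by (simp add: kern_def)

lemma kern_le_1: "kern M x \<le> 1"
  by (simp add: kern_def power_le_one)

lemma kern_le_exp: "c \<ge> 0 \<Longrightarrow> kern M x \<le> exp (- c * x)"
  using kern_le_1[of M x] mult_nonneg_nonpos[of c x] one_le_exp_iff[of "- c * x"]
  by (cases "x < 0") (auto simp: kern_def intro: order.trans)

lemma kern_measurable [measurable]: "kern M \<in> borel_measurable borel"
  unfolding kern_def by measurable

lemma kern_continuous: "M \<ge> 1 \<Longrightarrow> continuous_on UNIV (kern M)"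
proof -
  assume M: "M \<ge> 1"
  have "kern M = (\<lambda>x. max 0 (1 - exp x) ^ M)"
    using M by (auto simp: kern_def fun_eq_iff max_def)
  thus ?thesis by (auto intro!: continuous_intros)
qed

lemma kern_Suc: "kern (Suc M) x = kern M x - kern M x * exp x"
  by (simp add: kern_def algebra_simps)

lemma beta_fn_denominator:
  assumes "Re s > 0"
  shows "(\<Prod>j\<le>M. s + of_nat j) \<noteq> 0"
proof -
  have "s + of_nat j \<noteq> 0" for j using assms by (auto simp: complex_eq_iff)
  thus ?thesis by simp
qed

text \<open>The counterpart of \<open>kern_Suc\<close> on the transform side: multiplication by e^x
  shifts s to s + 1.\<close>

lemma beta_fn_Suc:
  assumes "Re s > 0"
  shows "beta_fn (Suc M) s = beta_fn M s - beta_fn M (s + 1)"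
proof -
  define Q where "Q = (\<Prod>j<M. (s + 1) + of_nat j)"
  have nz: "s + of_nat j \<noteq> 0" for j using assms by (auto simp: complex_eq_iff)
  have nz': "s \<noteq> 0" using assms by auto
  have Qnz: "Q \<noteq> 0" using nz[of "Suc j" for j] by (auto simp: Q_def add_ac)
  have 1: "(\<Prod>j\<le>M. s + of_nat j) = s * Q"
    unfolding Q_def by (subst prod.atMost_shift) (simp add: add_ac)
  have 2: "(\<Prod>j\<le>M. (s + 1) + of_nat j) = Q * (s + of_nat (Suc M))"
    unfolding Q_def lessThan_Suc_atMost[symmetric] by (simp add: add_ac)
  have 3: "(\<Prod>j\<le>Suc M. s + of_nat j) = s * Q * (s + of_nat (Suc M))"
    by (simp only: prod.atMost_Suc 1)
  show ?thesis unfolding beta_fn_def 1 2 3 using nz' Qnz nz[of "Suc M"]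
    by (simp add: divide_simps del: of_nat_Suc) (simp add: algebra_simps)
qed

lemma exp_half_line:
  assumes "Re s > 0"
  shows "integrable lborel (\<lambda>x. of_real (kern 0 x) * exp (s * of_real x))"
    "(LINT x|lborel. of_real (kern 0 x) * exp (s * of_real x)) = 1 / s"
proof -
  show int: "integrable lborel (\<lambda>x. of_real (kern 0 x) * exp (s * of_real x))"
    by (rule Bochner_Integration.integrable_bound[OF integrable_exp_minus_abs[OF assms]])
       (auto intro!: AE_I2 simp: kern_def norm_exp_eq_Re)
  have s: "s \<noteq> 0" using assms by auto
  have eq: "(\<lambda>x. of_real (kern 0 x) * exp (s * of_real x)) = (\<lambda>x. indicator (einterval (-\<infinity>) 0) x *\<^sub>R exp (s * complex_of_real x))"
    by (auto simp: fun_eq_iff kern_def einterval_def zero_ereal_def split: split_indicator)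
  have "(LBINT x=-\<infinity>..0. exp (s * complex_of_real x)) = exp (s * of_real 0) / s - 0"
  proof (rule interval_integral_FTC_integrable[where F = "\<lambda>x. exp (s * of_real x) / s"])
    show "((\<lambda>x. exp (s * of_real x) / s) has_vector_derivative exp (s * complex_of_real x)) (at x)" for x
      using s by (intro has_vector_derivative_real_field) (auto intro!: derivative_eq_intros)
    show "set_integrable lborel (einterval (-\<infinity>) 0) (\<lambda>x. exp (s * complex_of_real x))"
      using int unfolding eq set_integrable_def .
    have "((\<lambda>x. exp (s * complex_of_real x) / s) \<longlongrightarrow> exp (s * of_real 0) / s) (at_left 0)"
      using s by (intro tendsto_intros) auto
    thus "(((\<lambda>x. exp (s * of_real x) / s) \<circ> real_of_ereal) \<longlongrightarrow> exp (s * of_real 0) / s) (at_left 0)"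
      unfolding zero_ereal_def ereal_tendsto_simps .
    have "((\<lambda>x. exp (s * complex_of_real x) / s) \<longlongrightarrow> 0 / s) at_bot"
    proof (intro tendsto_divide tendsto_const s, rule tendsto_norm_zero_cancel)
      have "((\<lambda>x. exp (Re s * x)) \<longlongrightarrow> 0) at_bot" using assms by real_asymp
      thus "((\<lambda>x. norm (exp (s * complex_of_real x))) \<longlongrightarrow> 0) at_bot" by (simp add: norm_exp_eq_Re)
    qed
    thus "(((\<lambda>x. exp (s * of_real x) / s) \<circ> real_of_ereal) \<longlongrightarrow> 0) (at_right (-\<infinity>))"
      unfolding ereal_tendsto_simps by simp
  qed (auto intro!: continuous_intros)
  thus "(LINT x|lborel. of_real (kern 0 x) * exp (s * of_real x)) = 1 / s"
    unfolding eq interval_lebesgue_integral_def set_lebesgue_integral_def by simp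
qed

text \<open>Induction on M for all s at once, since the step from M to M + 1 calls the hypothesis at
  s and at s + 1.\<close>

lemma kern_laplace:
  assumes "Re s > 0"
  shows "integrable lborel (\<lambda>x. of_real (kern M x) * exp (s * of_real x)) \<and>
    (LINT x|lborel. of_real (kern M x) * exp (s * of_real x)) = beta_fn M s"
  using assms
proof (induction M arbitrary: s)
  case 0
  thus ?case using exp_half_line[of s] by (simp add: beta_fn_def)
next
  case (Suc M)
  have eq: "(\<lambda>x. of_real (kern (Suc M) x) * exp (s * of_real x)) =
     (\<lambda>x. of_real (kern M x) * exp (s * of_real x) - of_real (kern M x) * exp ((s + 1) * of_real x))"
    by (simp add: fun_eq_iff kern_Suc algebra_simps exp_add exp_of_real)
  have "Re (s + 1) > 0" using Suc.prems by simp
  note IH = Suc.IH[OF Suc.prems] Suc.IH[OF this]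
  show ?case unfolding eq beta_fn_Suc[OF Suc.prems] using IH by simp
qed

lemma holomorphic_beta_fn: "beta_fn M holomorphic_on {s. Re s > 0}"
  unfolding beta_fn_def by (intro holomorphic_intros beta_fn_denominator) auto

text \<open>Each of the M + 1 = m factors of the denominator is at least both c and |Im s| in
  modulus, hence at least their average, which dominates d (1 + |Im s|).\<close>

lemma beta_fn_bound:
  assumes c: "c > 0"
  obtains C where "C > 0" "\<And>s. Re s \<ge> c \<Longrightarrow> norm (beta_fn M s) \<le> C * (1 + \<bar>Im s\<bar>) powr (- real (Suc M))"
proof -
  define d where "d = min c 1 / 2"
  have d: "d > 0" using c by (simp add: d_def)
  show ?thesis
  proof (rule that[of "fact M / d ^ Suc M"])
    show "fact M / d ^ Suc M > 0" using d by simp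
    fix s assume s: "Re s \<ge> c"
    define X where "X = 1 + \<bar>Im s\<bar>"
    have X: "X \<ge> 1" by (simp add: X_def)
    have "norm (s + of_nat j) \<ge> d * X" for j
    proof -
      have "norm (s + of_nat j) \<ge> Re (s + of_nat j)" by (rule complex_Re_le_cmod)
      hence 1: "norm (s + of_nat j) \<ge> c" using s by simp
      have 2: "norm (s + of_nat j) \<ge> \<bar>Im s\<bar>" using abs_Im_le_cmod[of "s + of_nat j"] by simp
      have "d * X = min c 1 / 2 + min c 1 * \<bar>Im s\<bar> / 2" by (simp add: d_def X_def field_simps)
      also have "\<dots> \<le> c / 2 + 1 * \<bar>Im s\<bar> / 2" by (intro add_mono divide_right_mono mult_right_mono) auto
      finally show ?thesis using 1 2 by simp
    qed
    hence "(\<Prod>j\<le>M. d * X) \<le> (\<Prod>j\<le>M. norm (s + of_nat j))"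
      using d X by (intro prod_mono) auto
    hence p: "(d * X) ^ Suc M \<le> norm (\<Prod>j\<le>M. s + of_nat j)" by (simp add: prod_norm)
    have "norm (beta_fn M s) = fact M / norm (\<Prod>j\<le>M. s + of_nat j)"
      by (simp add: beta_fn_def norm_divide norm_fact)
    also have "\<dots> \<le> fact M / (d * X) ^ Suc M"
      using p d X by (intro divide_left_mono mult_pos_pos) (use s c beta_fn_denominator[of s M] in auto)
    also have "\<dots> = fact M / d ^ Suc M * X powr (- real (Suc M))"
      using X unfolding powr_minus power_mult_distrib by (subst powr_realpow) (auto simp: field_simps)
    finally show "norm (beta_fn M s) \<le> fact M / d ^ Suc M * (1 + \<bar>Im s\<bar>) powr (- real (Suc M))" by (simp add: X_def)
  qed
qed

abbreviation vline :: "real \<Rightarrow> real \<Rightarrow> complex" where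
  "vline c t \<equiv> of_real c + \<i> * of_real t"

lemma continuous_on_beta_fn_line: "c > 0 \<Longrightarrow> continuous_on UNIV (\<lambda>t. beta_fn M (vline c t))"
  unfolding beta_fn_def by (intro continuous_intros ballI beta_fn_denominator) auto

lemma beta_fn_line_integrable:
  assumes c: "c > 0" and M: "M \<ge> 1"
  shows "integrable lborel (\<lambda>t. beta_fn M (vline c t))"
proof -
  obtain C where C: "C > 0" "\<And>s. Re s \<ge> c \<Longrightarrow> norm (beta_fn M s) \<le> C * (1 + \<bar>Im s\<bar>) powr (- real (Suc M))"
    by (rule beta_fn_bound[OF c]) (rule that)
  have "integrable lborel (\<lambda>t. C * (1 + \<bar>t\<bar>) powr (- real (Suc M)))"
    using M by (intro integrable_mult_right integrable_one_plus_abs_powr) auto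
  thus ?thesis
  proof (rule Bochner_Integration.integrable_bound)
    show "(\<lambda>t. beta_fn M (vline c t)) \<in> borel_measurable lborel"
      using borel_measurable_continuous_onI[OF continuous_on_beta_fn_line[OF c]] by simp
    show "AE t in lborel. norm (beta_fn M (vline c t)) \<le> norm (C * (1 + \<bar>t\<bar>) powr (- real (Suc M)))"
      using C(2)[of "vline c t" for t] C(1) by (intro AE_I2) auto
  qed
qed

text \<open>Perron's formula as Fourier inversion of the damped kernel. M >= 1 provides both
  continuity of the kernel at its corner and integrability of the transform.\<close>

lemma kern_perron:
  assumes c: "c > 0" and M: "M \<ge> 1"
  shows "of_real (kern M x * exp (c * x)) =
    (LINT t|lborel. beta_fn M (vline c t) * iexp (- (t * x))) / (2 * of_real pi)"
proof (rule fourier_inversion[where B = 1])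
  have eq: "of_real (kern M x * exp (c * x)) * iexp (t * x) = of_real (kern M x) * exp ((vline c t) * of_real x)" for x t
    by (simp add: exp_of_real[symmetric] algebra_simps flip: exp_add)
  have "Re (of_real c) > 0" using c by simp
  from kern_laplace[OF this, of M] show "integrable lborel (\<lambda>x. complex_of_real (kern M x * exp (c * x)))"
    by (simp add: exp_of_real[symmetric])
  show "continuous_on UNIV (\<lambda>x. complex_of_real (kern M x * exp (c * x)))"
    by (intro continuous_intros kern_continuous M)
  show "norm (complex_of_real (kern M x * exp (c * x))) \<le> 1" for x
    using c kern_le_exp[of c M x] kern_nonneg[of M x] mult_right_mono[of "kern M x" "exp (- c * x)" "exp (c * x)"]
    by (simp add: norm_mult exp_minus)
  show "beta_fn M (vline c t) = (LINT x|lborel. complex_of_real (kern M x * exp (c * x)) * iexp (t * x))" for t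
    unfolding eq using c kern_laplace[of "vline c t" M] by simp
qed (rule beta_fn_line_integrable[OF c M])

section \<open>Shifting the line of integration\<close>

lemma LINT_symmetric_limit:
  fixes g :: "real \<Rightarrow> complex"
  assumes "integrable lborel g" and cont: "continuous_on UNIV g"
  shows "(\<lambda>n. integral {- real (Suc n)..real (Suc n)} g) \<longlonglongrightarrow> (LINT t|lborel. g t)"
proof -
  let ?h = "\<lambda>n t. indicator {- real (Suc n)..real (Suc n)} t *\<^sub>R g t"
  have "(\<lambda>n. LINT t|lborel. ?h n t) \<longlonglongrightarrow> (LINT t|lborel. g t)"
  proof (rule integral_dominated_convergence)
    show "integrable lborel (\<lambda>t. norm (g t))" using assms by auto
    show "AE t in lborel. (\<lambda>n. ?h n t) \<longlonglongrightarrow> g t"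
    proof (rule AE_I2)
      fix t
      obtain N :: nat where N: "\<bar>t\<bar> \<le> real N" using real_arch_simple by blast
      have "eventually (\<lambda>n. ?h n t = g t) sequentially"
        using eventually_ge_at_top[of N] by eventually_elim (use N in \<open>auto simp: abs_le_iff split: split_indicator\<close>)
      thus "(\<lambda>n. ?h n t) \<longlonglongrightarrow> g t"
        by (rule tendsto_eventually)
    qed
    show "AE t in lborel. norm (?h n t) \<le> norm (g t)" for n
      by (intro AE_I2) (auto split: split_indicator)
  qed (use assms in measurable)
  also have "(\<lambda>n. LINT t|lborel. ?h n t) = (\<lambda>n. integral {- real (Suc n)..real (Suc n)} g)"
  proof
    fix n
    have "set_integrable lborel {- real (Suc n)..real (Suc n)} g"
      by (rule borel_integrable_atLeastAtMost') (rule continuous_on_subset[OF cont], simp)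
    from set_borel_integral_eq_integral(2)[OF this]
    show "(LINT t|lborel. ?h n t) = integral {- real (Suc n)..real (Suc n)} g"
      by (simp add: set_lebesgue_integral_def)
  qed
  finally show ?thesis .
qed

text \<open>The residue theorem on rectangles with vertical sides on Re s = c and Re s = 2 and
  heights T >= 1. The bound is demanded only where such boundaries run, which leaves room for the
  pole at 1. The horizontal sides are O(T^(-p)).\<close>

lemma vertical_shift:
  fixes G :: "complex \<Rightarrow> complex"
  assumes hol: "G holomorphic_on {s. Re s > 0} - {1}" and c: "0 < c" "c < 1" and p: "p > 1"
    and bd: "\<And>s. c \<le> Re s \<Longrightarrow> Re s \<le> 2 \<Longrightarrow> \<bar>Im s\<bar> \<ge> 1 \<or> Re s \<in> {c, 2} \<Longrightarrow> norm (G s) \<le> B * (1 + \<bar>Im s\<bar>) powr (- p)"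
  shows "integrable lborel (\<lambda>t. G (vline c t))" "continuous_on UNIV (\<lambda>t. G (vline c t))"
    "(LINT t|lborel. G (2 + \<i> * of_real t)) - (LINT t|lborel. G (vline c t)) = 2 * of_real pi * residue G 1"
proof -
  have B: "B \<ge> 0"
  proof -
    have "0 \<le> norm (G 2)" by simp
    also have "\<dots> \<le> B" using bd[of 2] c by simp
    finally show ?thesis .
  qed
  have contG: "continuous_on ({s. Re s > 0} - {1}) G" by (rule holomorphic_on_imp_continuous_on[OF hol])
  have cont: "continuous_on UNIV (\<lambda>t. G (vline a t))" if "a > 0" "a \<noteq> 1" for a
    by (rule continuous_on_compose2[OF contG]) (use that in \<open>auto intro!: continuous_intros simp: complex_eq_iff\<close>)
  have int: "integrable lborel (\<lambda>t. G (vline a t))" if "a \<in> {c, 2}" for a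
  proof -
    have a: "a > 0" "a \<noteq> 1" using that c by auto
    have "integrable lborel (\<lambda>t::real. B * (1 + \<bar>t\<bar>) powr (- p))"
      using p by (intro integrable_mult_right integrable_one_plus_abs_powr) auto
    thus ?thesis
    proof (rule Bochner_Integration.integrable_bound)
      show "(\<lambda>t. G (vline a t)) \<in> borel_measurable lborel"
        using borel_measurable_continuous_onI[OF cont[OF a]] by simp
      show "AE t in lborel. norm (G (vline a t)) \<le> norm (B * (1 + \<bar>t\<bar>) powr (- p))"
      proof (rule AE_I2)
        fix t
        show "norm (G (vline a t)) \<le> norm (B * (1 + \<bar>t\<bar>) powr (- p))"
          using bd[of "vline a t"] that c B by auto
      qed
    qed
  qed
  show "integrable lborel (\<lambda>t. G (vline c t))" "continuous_on UNIV (\<lambda>t. G (vline c t))"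
    using int[of c] cont[of c] c by auto
  define T where "T n = real (Suc n)" for n
  define h1 where "h1 n = contour_integral (linepath (Complex c (- T n)) (Complex 2 (- T n))) G" for n
  define h2 where "h2 n = contour_integral (linepath (Complex 2 (T n)) (Complex c (T n))) G" for n
  define v where "v a n = integral {- T n..T n} (\<lambda>x. G (of_real a + \<i> * of_real x))" for a n
  have lim_v: "v a \<longlonglongrightarrow> (LINT t|lborel. G (vline a t))" if "a \<in> {c, 2}" for a
    unfolding v_def T_def using that c by (intro LINT_symmetric_limit int cont) auto
  have hb: "norm (contour_integral (linepath z w) G) \<le> B * (1 + T n) powr (- p) * 2"
    if z: "z = Complex a y" "w = Complex b y" "\<bar>y\<bar> = T n" "a \<in> {c, 2}" "b \<in> {c, 2}" for z w a b y n
  proof -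
    have seg: "c \<le> Re x \<and> Re x \<le> 2 \<and> Im x = y" if "x \<in> closed_segment z w" for x
    proof -
      have "closed_segment z w \<subseteq> cbox (Complex c y) (Complex 2 y)"
        using z c by (intro closed_segment_subset) (auto simp: in_cbox_complex_iff convex_box)
      thus ?thesis using that by (auto simp: in_cbox_complex_iff)
    qed
    have T1: "T n \<ge> 1" by (simp add: T_def)
    have "norm (contour_integral (linepath z w) G) \<le> (B * (1 + T n) powr (- p)) * norm (w - z)"
    proof (rule contour_integral_bound_linepath)
      show "G contour_integrable_on linepath z w"
      proof (rule contour_integrable_continuous_linepath, rule continuous_on_subset[OF contG])
        show "closed_segment z w \<subseteq> {s. 0 < Re s} - {1}"
        proof
          fix x assume "x \<in> closed_segment z w"
          note s = seg[OF this]
          have "Re x > 0" using s c by linarith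
          moreover have "Im x \<noteq> 0" using s z(3) T1 by auto
          ultimately show "x \<in> {s. 0 < Re s} - {1}" by auto
        qed
      qed
      show "0 \<le> B * (1 + T n) powr (- p)" using B by simp
      show "norm (G x) \<le> B * (1 + T n) powr (- p)" if "x \<in> closed_segment z w" for x
        using bd[of x] seg[OF that] z T1 by auto
    qed
    also have "norm (w - z) \<le> 2"
    proof -
      have "w - z = of_real (b - a)" using z by (simp add: complex_eq_iff)
      thus ?thesis using z c by (auto simp: norm_of_real simp del: of_real_diff)
    qed
    finally show ?thesis using B by (simp add: mult_left_mono)
  qed
  have hlim: "(\<lambda>n. B * (1 + T n) powr (- p) * 2) \<longlonglongrightarrow> 0"
  proof -
    have "(\<lambda>n. (1 + real (Suc n)) powr (- p)) \<longlonglongrightarrow> 0" using p by real_asymp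
    hence "(\<lambda>n. B * (1 + T n) powr (- p) * 2) \<longlonglongrightarrow> B * 0 * 2" unfolding T_def by (intro tendsto_intros)
    thus ?thesis by simp
  qed
  have h1: "h1 \<longlonglongrightarrow> 0" unfolding h1_def
    by (rule Lim_null_comparison[OF _ hlim], intro always_eventually allI, rule hb[of _ c "- T n" _ 2 for n]) (auto simp: T_def)
  have h2: "h2 \<longlonglongrightarrow> 0" unfolding h2_def
    by (rule Lim_null_comparison[OF _ hlim], intro always_eventually allI, rule hb[of _ 2 "T n" _ c for n]) (auto simp: T_def)
  have rect: "h1 n + \<i> * v 2 n + h2 n - \<i> * v c n = 2 * of_real pi * \<i> * residue G 1" for n
  proof -
    define a1 where "a1 = Complex c (- T n)"
    define a2 where "a2 = Complex 2 (- T n)"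
    define a3 where "a3 = Complex 2 (T n)"
    define a4 where "a4 = Complex c (T n)"
    note a_defs = a1_def a2_def a3_def a4_def
    have T1: "T n \<ge> 1" by (simp add: T_def)
    have rp: "rectpath a1 a3 = linepath a1 a2 +++ linepath a2 a3 +++ linepath a3 a4 +++ linepath a4 a1"
      by (simp add: rectpath_def Let_def a_defs)
    have pi_sub: "path_image (rectpath a1 a3) \<subseteq> {s. Re s > 0} - {1}"
      using T1 c by (subst path_image_rectpath) (auto simp: a_defs)
    have sub: "closed_segment a1 a2 \<subseteq> {s. Re s > 0} - {1}" "closed_segment a2 a3 \<subseteq> {s. Re s > 0} - {1}"
        "closed_segment a3 a4 \<subseteq> {s. Re s > 0} - {1}" "closed_segment a4 a1 \<subseteq> {s. Re s > 0} - {1}"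
      using pi_sub unfolding rp by (auto simp: path_image_join)
    have ci: "G contour_integrable_on linepath a1 a2" "G contour_integrable_on linepath a2 a3"
       "G contour_integrable_on linepath a3 a4" "G contour_integrable_on linepath a4 a1"
      by (intro contour_integrable_continuous_linepath continuous_on_subset[OF contG] sub)+
    have "contour_integral (rectpath a1 a3) G = of_real (2 * pi) * \<i> * (\<Sum>p\<in>{1}. winding_number (rectpath a1 a3) p * residue G p)"
    proof (rule Residue_theorem[where S = "{s. Re s > 0}"])
      show "\<forall>z. z \<notin> {s. 0 < Re s} \<longrightarrow> winding_number (rectpath a1 a3) z = 0"
      proof (intro allI impI)
        fix z assume "z \<notin> {s. 0 < Re s}"
        thus "winding_number (rectpath a1 a3) z = 0"
          using T1 c by (intro winding_number_rectpath_outside) (auto simp: a_defs in_cbox_complex_iff)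
      qed
    qed (use hol pi_sub in \<open>auto intro: open_halfspace_Re_gt convex_connected convex_halfspace_Re_gt\<close>)
    also have "winding_number (rectpath a1 a3) 1 = 1"
      using T1 c by (intro winding_number_rectpath) (auto simp: a_defs in_box_complex_iff)
    hence "(\<Sum>p\<in>{1}. winding_number (rectpath a1 a3) p * residue G p) = residue G 1" by simp
    also have "contour_integral (rectpath a1 a3) G = contour_integral (linepath a1 a2) G + contour_integral (linepath a2 a3) G +
       contour_integral (linepath a3 a4) G + contour_integral (linepath a4 a1) G"
      unfolding rp using ci by (simp add: contour_integral_join contour_integrable_joinI valid_path_join)
    also have "contour_integral (linepath a2 a3) G = \<i> * v 2 n"
      unfolding v_def by (subst contour_integral_linepath_same_Re[of _ 2 _ "- T n" "T n"])
        (use T1 in \<open>auto simp: a_defs Complex_eq\<close>)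
    also have "contour_integral (linepath a4 a1) G = - (\<i> * v c n)"
    proof -
      have "contour_integral (linepath a4 a1) G = - contour_integral (linepath a1 a4) G"
        using contour_integral_reversepath[of "linepath a1 a4" G] by simp
      also have "contour_integral (linepath a1 a4) G = \<i> * v c n"
        unfolding v_def by (subst contour_integral_linepath_same_Re[of _ c _ "- T n" "T n"])
          (use T1 in \<open>auto simp: a_defs Complex_eq\<close>)
      finally show ?thesis .
    qed
    finally show ?thesis by (simp add: h1_def h2_def a_defs)
  qed
  have "(\<lambda>n. h1 n + \<i> * v 2 n + h2 n - \<i> * v c n) \<longlonglongrightarrow>
     0 + \<i> * (LINT t|lborel. G (of_real 2 + \<i> * of_real t)) + 0 - \<i> * (LINT t|lborel. G (vline c t))"
    by (intro tendsto_intros h1 h2 lim_v) auto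
  hence "(\<lambda>n::nat. 2 * of_real pi * \<i> * residue G 1) \<longlonglongrightarrow>
     0 + \<i> * (LINT t|lborel. G (of_real 2 + \<i> * of_real t)) + 0 - \<i> * (LINT t|lborel. G (vline c t))"
    unfolding rect .
  hence "2 * of_real pi * \<i> * residue G 1 = 0 + \<i> * (LINT t|lborel. G (of_real 2 + \<i> * of_real t)) + 0 - \<i> * (LINT t|lborel. G (vline c t))"
    by (rule LIMSEQ_unique[OF tendsto_const])
  hence "\<i> * (2 * of_real pi * residue G 1) = \<i> * ((LINT t|lborel. G (2 + \<i> * of_real t)) - (LINT t|lborel. G (vline c t)))"
    by (simp add: algebra_simps)
  thus "(LINT t|lborel. G (2 + \<i> * of_real t)) - (LINT t|lborel. G (vline c t)) = 2 * of_real pi * residue G 1"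
    by simp
qed

section \<open>Residues at 1 as integrals over a circle\<close>

definition circ :: "real \<Rightarrow> real \<Rightarrow> complex" where
  "circ r u = 1 + of_real r * exp (2 * of_real pi * \<i> * of_real u)"

lemma norm_circ: "r \<ge> 0 \<Longrightarrow> norm (circ r u - 1) = r"
  by (simp add: circ_def norm_mult norm_exp_eq_Re)

lemma Re_circ: "r \<ge> 0 \<Longrightarrow> \<bar>Re (circ r u) - 1\<bar> \<le> r"
  using abs_Re_le_cmod[of "circ r u - 1"] norm_circ[of r u] by simp

lemma Re_circ_pos:
  assumes "0 \<le> r" "r < 1"
  shows "Re (circ r u) > 0"
proof -
  have "1 - Re (circ r u) \<le> r" using Re_circ[of r u] assms unfolding abs_le_iff by linarith
  thus ?thesis using assms by linarith
qed

lemma circ_neq_1: "r > 0 \<Longrightarrow> circ r u \<noteq> 1"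
  using norm_circ[of r u] by auto

lemma continuous_circ [continuous_intros]: "continuous_on A (circ r)"
  unfolding circ_def by (intro continuous_intros)

text \<open>Writing the residue as a Lebesgue integral over the parameter makes Fubini applicable.
  The factor \<open>circ r u - 1\<close> is what remains of the velocity of the circle after
  cancelling 2 pi i.\<close>

lemma residue_circle:
  assumes hol: "f holomorphic_on {s. Re s > 0} - {1}" and r: "0 < r" "r < 1"
  shows "residue f 1 = (LINT u|lborel. indicator {0..1} u *\<^sub>R (f (circ r u) * (circ r u - 1)))"
proof -
  have "cball 1 r \<subseteq> {s::complex. Re s > 0}"
  proof
    fix z :: complex assume "z \<in> cball 1 r"
    hence "\<bar>Re (1 - z)\<bar> \<le> r" using abs_Re_le_cmod[of "1 - z"] by (simp add: dist_norm)
    hence "1 - Re z \<le> r" unfolding abs_le_iff by simp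
    thus "z \<in> {s. Re s > 0}" using r by simp
  qed
  hence "(f has_contour_integral of_real (2 * pi) * \<i> * (residue f 1)) (circlepath 1 r)"
    using hol r by (intro base_residue[of "{s. Re s > 0}"]) (auto intro: open_halfspace_Re_gt)
  hence "((\<lambda>u. f (circlepath 1 r u) * vector_derivative (circlepath 1 r) (at u within {0..1})) has_integral of_real (2 * pi) * \<i> * (residue f 1)) {0..1}"
    by (simp add: has_contour_integral_def)
  hence "((\<lambda>u. of_real (2 * pi) * \<i> * (f (circ r u) * (circ r u - 1))) has_integral of_real (2 * pi) * \<i> * (residue f 1)) {0..1}"
  proof (rule has_integral_eq[rotated])
    fix u :: real assume u: "u \<in> {0..1}"
    have "circlepath 1 r u = circ r u" by (simp add: circlepath circ_def mult_ac)
    moreover have "vector_derivative (circlepath 1 r) (at u within {0..1}) = of_real (2 * pi) * \<i> * (circ r u - 1)"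
      using u by (subst vector_derivative_circlepath01) (auto simp: circ_def mult_ac)
    ultimately show "f (circlepath 1 r u) * vector_derivative (circlepath 1 r) (at u within {0..1}) = of_real (2 * pi) * \<i> * (f (circ r u) * (circ r u - 1))"
      by simp
  qed
  from has_integral_mult_right[OF this, of "1 / (of_real (2 * pi) * \<i>)"]
  have hi: "((\<lambda>u. f (circ r u) * (circ r u - 1)) has_integral residue f 1) {0..1}" by simp
  have "continuous_on {0..1} (\<lambda>u. f (circ r u) * (circ r u - 1))"
    using Re_circ_pos circ_neq_1 r
    by (intro continuous_intros continuous_on_compose2[OF holomorphic_on_imp_continuous_on[OF hol] continuous_circ])
       auto
  hence "set_integrable lborel {0..1} (\<lambda>u. f (circ r u) * (circ r u - 1))"
    by (rule borel_integrable_atLeastAtMost')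
  from set_borel_integral_eq_integral(2)[OF this] show ?thesis
    using hi by (simp add: has_integral_iff set_lebesgue_integral_def)
qed

section \<open>The kernel case of the theorem\<close>

definition zeta_beta :: "nat \<Rightarrow> nat \<Rightarrow> complex \<Rightarrow> complex" where
  "zeta_beta k M s = riemann_zeta s ^ k * beta_fn M s"

lemma holomorphic_zeta_beta: "zeta_beta k M holomorphic_on {s. Re s > 0} - {1}"
  unfolding zeta_beta_def
  by (intro holomorphic_intros holomorphic_on_subset[OF holomorphic_beta_fn] holomorphic_on_subset[OF riemann_zeta_props(1)]) auto

text \<open>The place where m >= 1 + k/2 acts: with p = m - k\<theta> and \<theta> < 1/2, k >= 1,
  one gets p > 1. Away from the pole, division by s - 1 removes the extra power 1 in the bound for
  \<open>reg_zeta\<close>.\<close>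

lemma zeta_beta_bound:
  assumes c: "0 < c" "c < 1" and km: "real (Suc M) \<ge> 1 + real k / 2" and k: "k \<ge> 1" and \<eta>: "\<eta> > 0"
  obtains B p where "B > 0" "p > 1"
    "\<And>s. c \<le> Re s \<Longrightarrow> Re s \<le> 2 \<Longrightarrow> norm (s - 1) \<ge> \<eta> \<Longrightarrow> norm (zeta_beta k M s) \<le> B * (1 + \<bar>Im s\<bar>) powr (- p)"
proof -
  obtain \<theta> C where \<theta>: "0 \<le> \<theta>" "\<theta> < 1 / 2" "C > 0"
    "\<And>s. c \<le> Re s \<Longrightarrow> Re s \<le> 2 \<Longrightarrow> norm (reg_zeta s) \<le> C * (1 + \<bar>Im s\<bar>) powr (1 + \<theta>)"
    by (rule zeta_growth[OF c]) (rule that)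
  obtain C' where C': "C' > 0" "\<And>s. Re s \<ge> c \<Longrightarrow> norm (beta_fn M s) \<le> C' * (1 + \<bar>Im s\<bar>) powr (- real (Suc M))"
    by (rule beta_fn_bound[OF c(1)]) (rule that)
  define d where "d = min \<eta> 1 / 2"
  have d: "d > 0" using \<eta> by (simp add: d_def)
  define p where "p = real (Suc M) - real k * \<theta>"
  show ?thesis
  proof (rule that[of "(C / d) ^ k * C'" p])
    show "(C / d) ^ k * C' > 0" using \<theta>(3) d C'(1) by simp
    have "real k * \<theta> < real k * (1 / 2)" using \<theta> k by (intro mult_strict_left_mono) auto
    thus "p > 1" using km by (simp add: p_def)
    fix s assume s: "c \<le> Re s" "Re s \<le> 2" "norm (s - 1) \<ge> \<eta>"
    define X where "X = 1 + \<bar>Im s\<bar>"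
    have X: "X \<ge> 1" by (simp add: X_def)
    have s1: "s \<noteq> 1" using s \<eta> by auto
    have dX: "norm (s - 1) \<ge> d * X"
    proof -
      have 2: "norm (s - 1) \<ge> \<bar>Im s\<bar>" using abs_Im_le_cmod[of "s - 1"] by simp
      have "d * X = min \<eta> 1 / 2 + min \<eta> 1 * \<bar>Im s\<bar> / 2" by (simp add: d_def X_def field_simps)
      also have "\<dots> \<le> \<eta> / 2 + 1 * \<bar>Im s\<bar> / 2" by (intro add_mono divide_right_mono mult_right_mono) auto
      finally show ?thesis using s(3) 2 by simp
    qed
    have "norm (riemann_zeta s) = norm (reg_zeta s) / norm (s - 1)"
      using s c s1 by (subst riemann_zeta_reg_zeta) (auto simp: norm_divide)
    also have "\<dots> \<le> (C * X powr (1 + \<theta>)) / (d * X)"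
      using \<theta>(4)[OF s(1,2)] dX d X \<theta>(3) by (intro frac_le) (auto simp: X_def)
    also have "\<dots> = C / d * X powr \<theta>"
      using X d by (simp add: powr_add)
    finally have z: "norm (riemann_zeta s) \<le> C / d * X powr \<theta>" .
    have "norm (zeta_beta k M s) = norm (riemann_zeta s) ^ k * norm (beta_fn M s)"
      by (simp add: zeta_beta_def norm_mult norm_power)
    also have "\<dots> \<le> (C / d * X powr \<theta>) ^ k * (C' * X powr (- real (Suc M)))"
      using z C'(2)[OF s(1)] \<theta>(3) d by (intro mult_mono power_mono zero_le_power) (auto simp: X_def)
    also have "\<dots> = (C / d) ^ k * C' * ((X powr \<theta>) ^ k * X powr (- real (Suc M)))"
      by (simp only: power_mult_distrib mult_ac)
    also have "(X powr \<theta>) ^ k * X powr (- real (Suc M)) = X powr (- p)"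
    proof -
      have "(X powr \<theta>) ^ k = X powr (real k * \<theta>)" using X by (simp add: powr_power mult.commute)
      moreover have "real k * \<theta> + (- real (Suc M)) = - p" by (simp add: p_def)
      ultimately show ?thesis by (metis powr_add)
    qed
    finally show "norm (zeta_beta k M s) \<le> (C / d) ^ k * C' * (1 + \<bar>Im s\<bar>) powr (- p)" by (simp add: X_def)
  qed
qed

lemma integrable_pair_mult:
  fixes a b :: "real \<Rightarrow> real"
  assumes a: "integrable lborel a" and b: "integrable lborel b"
  shows "integrable (lborel \<Otimes>\<^sub>M lborel) (\<lambda>(x, y). a x * b y)"
proof (rule lborel_pair.Fubini_integrable)
  note [measurable] = borel_measurable_integrable[OF a] borel_measurable_integrable[OF b]
  show "(\<lambda>(x, y). a x * b y) \<in> borel_measurable (lborel \<Otimes>\<^sub>M lborel)" by measurable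
  show "integrable lborel (\<lambda>x. LINT y|lborel. norm (case (x, y) of (x, y) \<Rightarrow> a x * b y))"
    using a by (simp add: abs_mult)
  show "AE x in lborel. integrable lborel (\<lambda>y. case (x, y) of (x, y) \<Rightarrow> a x * b y)"
    using b by simp
qed

lemma kern_shift_laplace:
  assumes "Re s > 0"
  shows "integrable lborel (\<lambda>y. of_real (kern M (x + y)) * exp (s * of_real y))"
    "(LINT y|lborel. of_real (kern M (x + y)) * exp (s * of_real y)) = exp (- s * of_real x) * beta_fn M s"
proof -
  have eq: "of_real (kern M (x + y)) * exp (s * of_real y) = exp (- s * of_real x) * (of_real (kern M (x + 1 * y)) * exp (s * of_real (x + 1 * y)))" for y
    by (simp add: algebra_simps flip: exp_add)
  note k = kern_laplace[OF assms, of M]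
  show "integrable lborel (\<lambda>y. of_real (kern M (x + y)) * exp (s * of_real y))"
    unfolding eq using k by (intro integrable_mult_right lborel_integrable_real_affine[where f = "\<lambda>y. of_real (kern M y) * exp (s * of_real y)"]) auto
  have "(LINT y|lborel. of_real (kern M (x + 1 * y)) * exp (s * of_real (x + 1 * y))) = (LINT y|lborel. of_real (kern M y) * exp (s * of_real y))"
    using lborel_integral_real_affine[of 1 "\<lambda>y. of_real (kern M y) * exp (s * of_real y)" x] by simp
  thus "(LINT y|lborel. of_real (kern M (x + y)) * exp (s * of_real y)) = exp (- s * of_real x) * beta_fn M s"
    unfolding eq using k by simp
qed

lemma kern_shift_exp_integrable:
  assumes "p > 0"
  shows "integrable lborel (\<lambda>y. kern M (x + y) * exp (p * y))"
proof -
  have "integrable lborel (\<lambda>y. norm (of_real (kern M (x + y)) * exp (of_real p * complex_of_real y)))"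
    using assms by (intro integrable_norm kern_shift_laplace) auto
  thus ?thesis by (simp add: norm_mult norm_exp_eq_Re kern_nonneg)
qed

definition circ_weight :: "real \<Rightarrow> nat \<Rightarrow> real \<Rightarrow> complex" where
  "circ_weight r k u = riemann_zeta (circ r u) ^ k * (circ r u - 1)"

lemma continuous_circ_weight: "r > 0 \<Longrightarrow> continuous_on A (circ_weight r k)"
  unfolding circ_weight_def
  by (intro continuous_intros continuous_on_compose2[OF holomorphic_on_imp_continuous_on[OF riemann_zeta_props(1)] continuous_circ])
     (use circ_neq_1 in auto)

lemma circ_measurable [measurable]: "circ r \<in> borel_measurable borel"
  by (intro borel_measurable_continuous_onI continuous_circ)

lemma circ_weight_measurable: "r > 0 \<Longrightarrow> circ_weight r k \<in> borel_measurable borel"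
  by (intro borel_measurable_continuous_onI continuous_circ_weight)

lemma circ_weight_bound:
  assumes "r > 0"
  obtains B where "B > 0" "\<And>u. u \<in> {0..1} \<Longrightarrow> norm (circ_weight r k u) \<le> B"
proof -
  have "compact (circ_weight r k ` {0..1})"
    using assms by (intro compact_continuous_image continuous_circ_weight compact_Icc)
  then obtain B where "B > 0" "\<forall>x\<in>circ_weight r k ` {0..1}. norm x \<le> B"
    using compact_imp_bounded bounded_pos by blast
  thus ?thesis by (intro that[of B]) auto
qed

text \<open>This form supplies measurability and growth of the residue kernel without determining
  the polynomial.\<close>

lemma P_kernel_exp:
  assumes r: "0 < r" "r < 1"
  shows "P_kernel k (exp y) = (LINT u|lborel. indicator {0..1} u *\<^sub>R (circ_weight r k u * exp ((circ r u - 1) * of_real y)))"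
proof -
  have pw: "of_real (exp y) powr (s - 1) = exp ((s - 1) * of_real y)" for s :: complex
  proof -
    have "Ln (of_real (exp y)) = of_real y" by (subst Ln_of_real) auto
    thus ?thesis by (simp add: powr_def)
  qed
  have "P_kernel k (exp y) = residue (\<lambda>s. riemann_zeta s ^ k * exp ((s - 1) * of_real y)) 1"
    unfolding P_kernel_def pw ..
  also have "\<dots> = (LINT u|lborel. indicator {0..1} u *\<^sub>R ((riemann_zeta (circ r u) ^ k * exp ((circ r u - 1) * of_real y)) * (circ r u - 1)))"
    by (intro residue_circle holomorphic_intros holomorphic_on_subset[OF riemann_zeta_props(1)] r) auto
  finally show ?thesis by (simp add: circ_weight_def mult_ac)
qed

lemma P_kernel_exp_measurable [measurable]: "(\<lambda>y. P_kernel k (exp y)) \<in> borel_measurable borel"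
proof -
  note [measurable] = circ_weight_measurable[of "1 / 2" k]
  show ?thesis by (subst P_kernel_exp[of "1 / 2"], simp, simp) measurable
qed

lemma norm_exp_circ_le:
  assumes r: "r \<ge> 0"
  shows "norm (exp ((circ r u - 1) * of_real y)) \<le> exp (r * y) + exp (- r * y)"
proof -
  have "norm (exp ((circ r u - 1) * of_real y)) = exp ((Re (circ r u) - 1) * y)" by (simp add: norm_exp_eq_Re)
  also have "\<dots> \<le> exp (r * \<bar>y\<bar>)"
  proof -
    have "(Re (circ r u) - 1) * y \<le> \<bar>Re (circ r u) - 1\<bar> * \<bar>y\<bar>" by (metis abs_ge_self abs_mult)
    also have "\<dots> \<le> r * \<bar>y\<bar>"
      using Re_circ[OF r] by (intro mult_right_mono) auto
    finally show ?thesis by simp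
  qed
  also have "\<dots> \<le> exp (r * y) + exp (- r * y)" by (cases "y \<ge> 0") auto
  finally show ?thesis .
qed

text \<open>On the circle the exponent s - 1 has real part at most r in modulus. The resulting
  growth e^(r|y|), with r as small as desired, stands in for polynomial growth in y.\<close>

lemma P_kernel_exp_bound:
  assumes r: "0 < r" "r < 1"
  obtains B where "B > 0" "\<And>y. norm (P_kernel k (exp y)) \<le> B * (exp (r * y) + exp (- r * y))"
proof -
  obtain B where B: "B > 0" "\<And>u. u \<in> {0..1} \<Longrightarrow> norm (circ_weight r k u) \<le> B"
    by (rule circ_weight_bound[OF r(1), of k]) (rule that)
  show ?thesis
  proof (rule that[OF B(1)])
    fix y :: real
    define E where "E = B * (exp (r * y) + exp (- r * y))"
    define f where "f u = indicator {0..1} u *\<^sub>R (circ_weight r k u * exp ((circ r u - 1) * of_real y))" for u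
    note [measurable] = circ_weight_measurable[OF r(1), of k]
    have f [measurable]: "f \<in> borel_measurable lborel" unfolding f_def by measurable
    have int: "integrable lborel (\<lambda>u::real. indicator {0..1} u *\<^sub>R E)" by (intro integrable_scaleR_left) auto
    have fE: "norm (f u) \<le> indicator {0..1} u *\<^sub>R E" for u
      using norm_exp_circ_le[of r u y] r B(2)[of u] B(1)
      by (auto simp: f_def norm_mult E_def split: split_indicator intro!: mult_mono)
    have intf: "integrable lborel f"
    proof (rule Bochner_Integration.integrable_bound[OF int f], rule AE_I2)
      show "norm (f u) \<le> norm (indicator {0..1} u *\<^sub>R E)" for u using fE[of u] by simp
    qed
    have "norm (P_kernel k (exp y)) = norm (LINT u|lborel. f u)" by (simp add: P_kernel_exp[OF r] f_def)
    also have "\<dots> \<le> (LINT u|lborel. norm (f u))" by (rule integral_norm_bound)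
    also have "\<dots> \<le> (LINT u|lborel. indicator {0..1} (u :: real) *\<^sub>R E)"
      by (rule Bochner_Integration.integral_mono[OF integrable_norm[OF intf] int fE])
    also have "\<dots> = E" by simp
    finally show "norm (P_kernel k (exp y)) \<le> B * (exp (r * y) + exp (- r * y))" by (simp add: E_def)
  qed
qed

text \<open>After exchanging the circle integral with the y-integral, the latter is the transform of
  the translated kernel at a point of the circle, so the circle integral is again a residue. It is
  exactly the term picked up by the line shift.\<close>

lemma kern_P_kernel_integral:
  "(LINT y|lborel. of_real (kern M (x + y)) * P_kernel k (exp y) * of_real (exp y)) = residue (\<lambda>s. zeta_beta k M s * exp (- s * of_real x)) 1"
proof -
  \<comment> \<open>The exponents 1 + r and 1 - r must be positive for the kernel integrals to
    converge; here they are 3/2 and 1/2.\<close>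
  define r :: real where "r = 1 / 2"
  have r: "0 < r" "r < 1" by (auto simp: r_def)
  note [measurable] = circ_weight_measurable[OF r(1), of k]
  obtain B where B: "B > 0" "\<And>u. u \<in> {0..1} \<Longrightarrow> norm (circ_weight r k u) \<le> B"
    by (rule circ_weight_bound[OF r(1), of k]) (rule that)
  define F where "F y u = indicator {0..1} u *\<^sub>R (of_real (kern M (x + y)) * (circ_weight r k u * exp (circ r u * of_real y)))" for y u
  define a where "a y = B * (kern M (x + y) * exp (3 / 2 * y) + kern M (x + y) * exp (1 / 2 * y))" for y
  have exp1: "exp (circ r u * of_real y) = exp ((circ r u - 1) * of_real y) * of_real (exp y)" for u y
    by (simp add: exp_of_real[symmetric] algebra_simps flip: exp_add)
  have int: "integrable (lborel \<Otimes>\<^sub>M lborel) (\<lambda>(y, u). F y u)"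
  proof (rule Bochner_Integration.integrable_bound)
    show "integrable (lborel \<Otimes>\<^sub>M lborel) (\<lambda>(y::real, u::real). a y * indicator {0..1} u)"
      unfolding a_def by (intro integrable_pair_mult integrable_mult_right Bochner_Integration.integrable_add kern_shift_exp_integrable) auto
    show "(\<lambda>(y, u). F y u) \<in> borel_measurable (lborel \<Otimes>\<^sub>M lborel)"
      unfolding F_def by measurable
    have "norm (F y u) \<le> a y * indicator {0..1} u" for y u
    proof (cases "u \<in> {0..1}")
      case True
      have "norm (F y u) = kern M (x + y) * (norm (circ_weight r k u) * (norm (exp ((circ r u - 1) * of_real y)) * exp y))"
        using True by (simp add: F_def exp1 norm_mult kern_nonneg)
      also have "\<dots> \<le> kern M (x + y) * (B * ((exp (r * y) + exp (- r * y)) * exp y))"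
        using B True norm_exp_circ_le[of r u y] r by (intro mult_left_mono mult_mono mult_right_mono kern_nonneg) auto
      also have "(exp (r * y) + exp (- r * y)) * exp y = exp (3 / 2 * y) + exp (1 / 2 * y)"
        by (simp add: r_def distrib_right flip: exp_add)
      finally show ?thesis using True by (simp add: a_def algebra_simps)
    qed (simp add: F_def)
    thus "AE z in lborel \<Otimes>\<^sub>M lborel. norm (case z of (y, u) \<Rightarrow> F y u) \<le> norm (case z of (y, u) \<Rightarrow> a y * indicator {0..1} u)"
      by (intro AE_I2) (auto intro: order.trans[OF _ abs_ge_self])
  qed
  have "(LINT y|lborel. of_real (kern M (x + y)) * P_kernel k (exp y) * of_real (exp y)) = (LINT y|lborel. LINT u|lborel. F y u)"
  proof (intro Bochner_Integration.integral_cong refl)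
    fix y
    define w where "w = complex_of_real (kern M (x + y)) * of_real (exp y)"
    have "(LINT u|lborel. F y u) = (LINT u|lborel. w * (indicator {0..1} u *\<^sub>R (circ_weight r k u * exp ((circ r u - 1) * of_real y))))"
      unfolding F_def exp1 w_def by (intro Bochner_Integration.integral_cong refl) (simp add: scaleR_conv_of_real mult_ac)
    also have "\<dots> = w * P_kernel k (exp y)" unfolding P_kernel_exp[OF r] by (rule integral_mult_right_zero)
    finally show "of_real (kern M (x + y)) * P_kernel k (exp y) * of_real (exp y) = (LINT u|lborel. F y u)"
      by (simp add: w_def mult_ac)
  qed
  also have "\<dots> = (LINT u|lborel. LINT y|lborel. F y u)"
    using lborel_pair.Fubini_integral[OF int] by simp
  also have "\<dots> = (LINT u|lborel. indicator {0..1} u *\<^sub>R ((zeta_beta k M (circ r u) * exp (- circ r u * of_real x)) * (circ r u - 1)))"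
  proof (intro Bochner_Integration.integral_cong refl)
    fix u
    have "(LINT y|lborel. F y u) = (LINT y|lborel. (indicator {0..1} u *\<^sub>R circ_weight r k u) * (of_real (kern M (x + y)) * exp (circ r u * of_real y)))"
      by (intro Bochner_Integration.integral_cong refl) (simp add: F_def scaleR_conv_of_real mult_ac)
    also have "\<dots> = (indicator {0..1} u *\<^sub>R circ_weight r k u) * (exp (- circ r u * of_real x) * beta_fn M (circ r u))"
      using Re_circ_pos[of r u] r by (subst integral_mult_right_zero, subst kern_shift_laplace(2)) auto
    finally show "(LINT y|lborel. F y u) = indicator {0..1} u *\<^sub>R ((zeta_beta k M (circ r u) * exp (- circ r u * of_real x)) * (circ r u - 1))"
      by (simp add: circ_weight_def zeta_beta_def scaleR_conv_of_real mult_ac)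
  qed
  also have "\<dots> = residue (\<lambda>s. zeta_beta k M s * exp (- s * of_real x)) 1"
    by (intro residue_circle[symmetric] holomorphic_intros holomorphic_zeta_beta r)
  finally show ?thesis .
qed

text \<open>\<open>line_integral k M c x\<close> is the inverse Mellin transform of \<open>\<zeta>\<^sup>k(s) B(s, M+1)\<close> along \<open>Re s = c\<close>,
  evaluated at \<open>e\<^sup>x\<close>.\<close>

definition line_integral :: "nat \<Rightarrow> nat \<Rightarrow> real \<Rightarrow> real \<Rightarrow> complex" where
  "line_integral k M c x = (LINT t|lborel. zeta_beta k M (vline c t) * exp (- (vline c t) * of_real x)) / (2 * of_real pi)"

lemma summable_divisor_k_kern:
  fixes c :: real
  assumes c: "c > 1"
  shows "summable (\<lambda>n. real (divisor_k k (Suc n)) * kern M (x + ln (real (Suc n))))"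
proof (rule summable_comparison_test'[where N = 0])
  show "summable (\<lambda>n. exp (- c * x) * (real (divisor_k k (Suc n)) * real (Suc n) powr (- c)))"
    by (intro summable_mult summable_divisor_k c)
  fix n
  have "kern M (x + ln (real (Suc n))) \<le> exp (- c * (x + ln (real (Suc n))))" using c by (intro kern_le_exp) auto
  also have "\<dots> = exp (- c * x) * real (Suc n) powr (- c)" by (simp add: powr_def algebra_simps flip: exp_add)
  finally have "real (divisor_k k (Suc n)) * kern M (x + ln (real (Suc n))) \<le> real (divisor_k k (Suc n)) * (exp (- c * x) * real (Suc n) powr (- c))"
    by (rule mult_left_mono) auto
  thus "norm (real (divisor_k k (Suc n)) * kern M (x + ln (real (Suc n)))) \<le> exp (- c * x) * (real (divisor_k k (Suc n)) * real (Suc n) powr (- c))"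
    by (simp add: kern_nonneg mult_ac)
qed

text \<open>On Re s = 2 the Dirichlet series converges absolutely, and |n^s| does not depend on t.
  Hence the series may be integrated term by term, each term being an instance of Perron's
  formula.\<close>

lemma divisor_k_kern_sum:
  assumes M: "M \<ge> 1"
  shows "of_real (\<Sum>n. real (divisor_k k (Suc n)) * kern M (x + ln (real (Suc n)))) = line_integral k M 2 x"
proof -
  define s where "s t = 2 + \<i> * complex_of_real t" for t
  have Re_s: "Re (s t) = 2" for t by (simp add: s_def)
  define b where "b t = beta_fn M (s t) * exp (- s t * of_real x)" for t
  define f where "f n t = b t * (of_nat (divisor_k k (Suc n)) / of_nat (Suc n) powr s t)" for n t
  have scont: "continuous_on UNIV s" unfolding s_def by (intro continuous_intros)
  have int0: "integrable lborel (\<lambda>t. beta_fn M (s t))"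
    using beta_fn_line_integrable[of 2 M] M by (simp add: s_def)
  have meas [measurable]: "s \<in> borel_measurable borel" using scont by (rule borel_measurable_continuous_onI)
  have nb: "norm (b t) = norm (beta_fn M (s t)) * exp (- 2 * x)" for t
    by (simp add: b_def norm_mult norm_exp_eq_Re Re_s)
  have [measurable]: "b \<in> borel_measurable borel" unfolding b_def using borel_measurable_integrable[OF int0] by measurable
  have intb: "integrable lborel b"
    by (rule Bochner_Integration.integrable_bound[OF integrable_mult_left[OF integrable_norm[OF int0]], where c1 = "exp (- 2 * x)"])
       (auto simp: nb)
  have npw: "norm (of_nat (Suc n) powr s t) = real (Suc n) powr 2" for n t
    using norm_powr_real_powr[of "of_nat (Suc n)" "s t"] by (simp add: Re_s del: of_nat_Suc)
  have nf: "norm (f n t) = norm (b t) * (real (divisor_k k (Suc n)) * real (Suc n) powr (-2))" for n t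
    unfolding f_def norm_mult norm_divide npw by (simp add: powr_minus_divide)
  have pw: "of_nat (Suc n) powr s t = exp (s t * of_real (ln (real (Suc n))))" for n t
  proof -
    have "Ln (of_nat (Suc n)) = of_real (ln (real (Suc n)))"
      using Ln_of_real[of "real (Suc n)"] by (simp del: of_nat_Suc)
    thus ?thesis by (simp add: powr_def del: of_nat_Suc)
  qed
  have [measurable]: "f n \<in> borel_measurable borel" for n
    unfolding f_def pw by measurable
  have intf: "integrable lborel (f n)" for n
    by (rule Bochner_Integration.integrable_bound[OF integrable_mult_left[OF integrable_norm[OF intb]], where c1 = "real (divisor_k k (Suc n)) * real (Suc n) powr (-2)"])
       (auto simp: nf)
  have sd: "summable (\<lambda>n. real (divisor_k k (Suc n)) * real (Suc n) powr (-2))" by (rule summable_divisor_k) simp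
  have "(\<lambda>n. LINT t|lborel. f n t) sums (LINT t|lborel. (\<Sum>n. f n t))"
  proof (rule sums_integral[OF intf])
    show "AE t in lborel. summable (\<lambda>n. norm (f n t))"
      unfolding nf by (intro AE_I2 summable_mult sd)
    show "summable (\<lambda>n. LINT t|lborel. norm (f n t))"
      unfolding nf integral_mult_left_zero by (intro summable_mult sd)
  qed
  also have "(\<lambda>t. (\<Sum>n. f n t)) = (\<lambda>t. zeta_beta k M (s t) * exp (- s t * of_real x))"
  proof
    fix t
    have "(\<lambda>n. f n t) sums (b t * riemann_zeta (s t) ^ k)"
      unfolding f_def by (intro sums_mult zeta_power_dirichlet) (simp add: Re_s)
    thus "(\<Sum>n. f n t) = zeta_beta k M (s t) * exp (- s t * of_real x)"
      by (simp add: sums_iff b_def zeta_beta_def mult_ac)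
  qed
  finally have 1: "(\<lambda>n. (LINT t|lborel. f n t) / (2 * of_real pi)) sums line_integral k M 2 x"
    unfolding line_integral_def s_def by (intro sums_divide) simp
  have "(LINT t|lborel. f n t) / (2 * of_real pi) = of_real (real (divisor_k k (Suc n)) * kern M (x + ln (real (Suc n))))" for n
  proof -
    define y where "y = x + ln (real (Suc n))"
    have "f n t = of_real (real (divisor_k k (Suc n)) * exp (- 2 * y)) * (beta_fn M (of_real 2 + \<i> * of_real t) * iexp (- (t * y)))" for t
    proof -
      have "exp (- s t * of_real x) / of_nat (Suc n) powr s t = of_real (exp (- 2 * y)) * iexp (- (t * y))"
        unfolding pw by (simp add: s_def y_def exp_of_real[symmetric] algebra_simps flip: exp_add exp_diff)
      moreover have "f n t = of_nat (divisor_k k (Suc n)) * beta_fn M (s t) * (exp (- s t * of_real x) / of_nat (Suc n) powr s t)"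
        by (simp add: f_def b_def)
      ultimately show ?thesis by (simp add: s_def mult_ac)
    qed
    hence "(LINT t|lborel. f n t) / (2 * of_real pi) = of_real (real (divisor_k k (Suc n)) * exp (- 2 * y)) * ((LINT t|lborel. beta_fn M (of_real 2 + \<i> * of_real t) * iexp (- (t * y))) / (2 * of_real pi))"
      by (simp only: integral_mult_right_zero times_divide_eq_right)
    also have "(LINT t|lborel. beta_fn M (of_real 2 + \<i> * of_real t) * iexp (- (t * y))) / (2 * of_real pi) = of_real (kern M y * exp (2 * y))"
      by (rule kern_perron[symmetric]) (use M in auto)
    also have "of_real (real (divisor_k k (Suc n)) * exp (- 2 * y)) * complex_of_real (kern M y * exp (2 * y)) = of_real (real (divisor_k k (Suc n)) * kern M y)"
      by (simp add: exp_minus flip: of_real_mult)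
    finally show ?thesis by (simp add: y_def)
  qed
  with 1 have "(\<lambda>n. complex_of_real (real (divisor_k k (Suc n)) * kern M (x + ln (real (Suc n))))) sums line_integral k M 2 x" by simp
  moreover have "(\<lambda>n. complex_of_real (real (divisor_k k (Suc n)) * kern M (x + ln (real (Suc n))))) sums
     of_real (\<Sum>n. real (divisor_k k (Suc n)) * kern M (x + ln (real (Suc n))))"
    unfolding sums_of_real_iff by (intro summable_sums summable_divisor_k_kern[of 2]) simp
  ultimately show ?thesis by (rule sums_unique2[symmetric])
qed

text \<open>The bracket of the theorem at \<open>e\<^sup>x\<close>, with \<open>(1 - x)\<^sub>+\<^sup>M\<close> in place of \<open>f\<close>.\<close>

definition kern_remainder :: "nat \<Rightarrow> nat \<Rightarrow> real \<Rightarrow> complex" where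
  "kern_remainder k M x = of_real (\<Sum>n. real (divisor_k k (Suc n)) * kern M (x + ln (real (Suc n))))
     - (LINT y|lborel. of_real (kern M (x + y)) * P_kernel k (exp y) * of_real (exp y))"

text \<open>Moving the line from 2 to c subtracts the residue, that is, the second term of
  \<open>kern_remainder\<close>. Integrability, continuity and boundedness on the line are recorded
  because Fourier inversion will be applied to this function of t.\<close>

lemma zeta_beta_line:
  assumes c: "0 < c" "c < 1" and km: "real (Suc M) \<ge> 1 + real k / 2" and k: "k \<ge> 1"
  shows "kern_remainder k M x = line_integral k M c x"
    "integrable lborel (\<lambda>t. zeta_beta k M (vline c t))"
    "continuous_on UNIV (\<lambda>t. zeta_beta k M (vline c t))"
    "\<exists>B. \<forall>t. norm (zeta_beta k M (vline c t)) \<le> B"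
proof -
  have M: "M \<ge> 1" using km k by auto
  \<comment> \<open>Distance from the pole to the line Re s = c. Being at most 1, it also bounds the
    distance from below on Re s = 2 and at heights at least 1.\<close>
  define \<eta> where "\<eta> = 1 - c"
  have \<eta>: "\<eta> > 0" using c by (simp add: \<eta>_def)
  obtain B p where B: "B > 0" "p > 1"
    "\<And>s. c \<le> Re s \<Longrightarrow> Re s \<le> 2 \<Longrightarrow> norm (s - 1) \<ge> \<eta> \<Longrightarrow> norm (zeta_beta k M s) \<le> B * (1 + \<bar>Im s\<bar>) powr (- p)"
    by (rule zeta_beta_bound[OF c km k \<eta>]) (rule that)
  have far: "norm (s - 1) \<ge> \<eta>" if "\<bar>Im s\<bar> \<ge> 1 \<or> Re s \<in> {c, 2}" for s
    using that abs_Im_le_cmod[of "s - 1"] abs_Re_le_cmod[of "s - 1"] c by (auto simp: \<eta>_def)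
  have bd: "norm (zeta_beta k M s * exp (- s * of_real x)) \<le> (B * exp (2 * \<bar>x\<bar>)) * (1 + \<bar>Im s\<bar>) powr (- p)"
    if "c \<le> Re s" "Re s \<le> 2" "\<bar>Im s\<bar> \<ge> 1 \<or> Re s \<in> {c, 2}" for s x
  proof -
    have "- Re s * x \<le> \<bar>Re s\<bar> * \<bar>x\<bar>" by (metis abs_ge_minus_self abs_mult mult_minus_left)
    also have "\<dots> \<le> 2 * \<bar>x\<bar>" using that c by (intro mult_right_mono) auto
    finally have "norm (exp (- s * of_real x)) \<le> exp (2 * \<bar>x\<bar>)" by (simp add: norm_exp_eq_Re)
    hence "norm (zeta_beta k M s * exp (- s * of_real x)) \<le> (B * (1 + \<bar>Im s\<bar>) powr (- p)) * exp (2 * \<bar>x\<bar>)"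
      unfolding norm_mult using B that far by (intro mult_mono) auto
    thus ?thesis by (simp add: mult_ac)
  qed
  have hol: "(\<lambda>s. zeta_beta k M s * exp (- s * of_real x)) holomorphic_on {s. Re s > 0} - {1}" for x
    by (intro holomorphic_intros holomorphic_zeta_beta)
  note vs = vertical_shift[OF hol c B(2) bd]
  have two: "of_real 2 + \<i> * complex_of_real t = 2 + \<i> * of_real t" for t by simp
  show "kern_remainder k M x = line_integral k M c x"
    unfolding kern_remainder_def divisor_k_kern_sum[OF M] kern_P_kernel_integral line_integral_def two
    using vs(3)[of x] by (simp add: field_simps)
  show "integrable lborel (\<lambda>t. zeta_beta k M (vline c t))"
    using vs(1)[of 0] by simp
  show "continuous_on UNIV (\<lambda>t. zeta_beta k M (vline c t))"
    using vs(2)[of 0] by simp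
  have "norm (zeta_beta k M (vline c t)) \<le> B" for t
  proof -
    have "norm (zeta_beta k M (vline c t)) \<le> B * (1 + \<bar>t\<bar>) powr (- p)"
      using bd[of "vline c t" 0] c by simp
    also have "\<dots> \<le> B * 1"
    proof (rule mult_left_mono)
      have "(1 + \<bar>t\<bar>) powr (- p) \<le> (1 + \<bar>t\<bar>) powr 0" using B by (intro powr_mono) auto
      moreover have "1 + \<bar>t\<bar> > 0" by simp
      ultimately show "(1 + \<bar>t\<bar>) powr (- p) \<le> 1" by simp
    qed (use B in simp)
    finally show ?thesis by simp
  qed
  thus "\<exists>B. \<forall>t. norm (zeta_beta k M (vline c t)) \<le> B" by blast
qed

lemma kern_remainder_measurable:
  fixes c :: real
  assumes c: "0 < c" "c < 1" and km: "real (Suc M) \<ge> 1 + real k / 2" and k: "k \<ge> 1"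
  shows "kern_remainder k M \<in> borel_measurable borel"
proof -
  have [measurable]: "(\<lambda>t. zeta_beta k M (vline c t)) \<in> borel_measurable borel"
    by (rule borel_measurable_continuous_onI[OF zeta_beta_line(3)[OF assms]])
  have "(\<lambda>x. line_integral k M c x) \<in> borel_measurable borel"
    unfolding line_integral_def by measurable
  thus ?thesis by (simp add: zeta_beta_line(1)[OF assms, abs_def] cong: measurable_cong)
qed

text \<open>Absolute values inside the line integral. Since c is free in (0, 1), different choices
  give decay at both ends after multiplication by e^(cx).\<close>

lemma kern_remainder_bound:
  assumes c: "0 < c" "c < 1" and km: "real (Suc M) \<ge> 1 + real k / 2" and k: "k \<ge> 1"
  obtains B where "B \<ge> 0" "\<And>x. norm (kern_remainder k M x) \<le> B * exp (- c * x)"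
proof
  define B where "B = (LINT t|lborel. norm (zeta_beta k M (vline c t))) / (2 * pi)"
  show "B \<ge> 0" by (simp add: B_def)
  fix x
  have "norm (kern_remainder k M x) \<le> (LINT t|lborel. norm (zeta_beta k M (vline c t) * exp (- (vline c t) * of_real x))) / (2 * pi)"
    unfolding zeta_beta_line(1)[OF assms] line_integral_def norm_divide
  proof -
    have n2: "norm (2 * complex_of_real pi) = 2 * pi" by (simp add: norm_mult)
    show "norm (LINT t|lborel. zeta_beta k M (vline c t) * exp (- (vline c t) * of_real x)) / norm (2 * complex_of_real pi)
      \<le> (LINT t|lborel. norm (zeta_beta k M (vline c t) * exp (- (vline c t) * of_real x))) / (2 * pi)"
      unfolding n2 by (intro divide_right_mono integral_norm_bound) simp
  qed
  also have "(LINT t|lborel. norm (zeta_beta k M (vline c t) * exp (- (vline c t) * of_real x)))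
      = (LINT t|lborel. norm (zeta_beta k M (vline c t)) * exp (- c * x))"
    by (intro Bochner_Integration.integral_cong refl) (simp add: norm_mult norm_exp_eq_Re)
  finally show "norm (kern_remainder k M x) \<le> B * exp (- c * x)" by (simp add: B_def)
qed

text \<open>The bounds with c - \<delta> on the left and c + \<delta> on the right make the
  transform at Re s = c absolutely convergent. The line integral already presents the remainder as a
  Fourier transform in t, and inverting it recovers the value at t = Im s.\<close>

lemma kern_remainder_mellin:
  assumes s: "0 < Re s" "Re s < 1" and km: "real (Suc M) \<ge> 1 + real k / 2" and k: "k \<ge> 1"
  shows "integrable lborel (\<lambda>x. kern_remainder k M x * exp (s * of_real x))"
    "(LINT x|lborel. kern_remainder k M x * exp (s * of_real x)) = riemann_zeta s ^ k * beta_fn M s"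
proof -
  define c where "c = Re s"
  have c: "0 < c" "c < 1" using s by (auto simp: c_def)
  define \<delta> where "\<delta> = min c (1 - c) / 2"
  have \<delta>: "\<delta> > 0" "0 < c - \<delta>" "c - \<delta> < 1" "0 < c + \<delta>" "c + \<delta> < 1" using c by (auto simp: \<delta>_def min_def field_simps)
  obtain B1 where B1: "B1 \<ge> 0" "\<And>x. norm (kern_remainder k M x) \<le> B1 * exp (- (c - \<delta>) * x)"
    by (rule kern_remainder_bound[OF \<delta>(2,3) km k]) (rule that)
  obtain B2 where B2: "B2 \<ge> 0" "\<And>x. norm (kern_remainder k M x) \<le> B2 * exp (- (c + \<delta>) * x)"
    by (rule kern_remainder_bound[OF \<delta>(4,5) km k]) (rule that)
  have meas [measurable]: "kern_remainder k M \<in> borel_measurable borel"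
    by (rule kern_remainder_measurable[OF c km k])
  have int: "integrable lborel (\<lambda>x. kern_remainder k M x * exp (w * of_real x))" if w: "Re w = c" for w
  proof (rule Bochner_Integration.integrable_bound)
    show "integrable lborel (\<lambda>x::real. (B1 + B2) * exp (- \<delta> * \<bar>x\<bar>))"
      by (intro integrable_mult_right integrable_exp_minus_abs \<delta>)
    have "norm (kern_remainder k M x * exp (w * of_real x)) \<le> (B1 + B2) * exp (- \<delta> * \<bar>x\<bar>)" for x
    proof (cases "x \<ge> 0")
      case True
      have "norm (kern_remainder k M x * exp (w * of_real x)) = norm (kern_remainder k M x) * exp (c * x)"
        using w by (simp add: norm_mult norm_exp_eq_Re)
      also have "\<dots> \<le> B2 * exp (- (c + \<delta>) * x) * exp (c * x)" by (intro mult_right_mono B2) auto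
      also have "\<dots> = B2 * exp (- \<delta> * x)" by (simp add: algebra_simps flip: exp_add)
      also have "\<dots> \<le> (B1 + B2) * exp (- \<delta> * \<bar>x\<bar>)" using True B1(1) B2(1) by (intro mult_mono) auto
      finally show ?thesis .
    next
      case False
      have "norm (kern_remainder k M x * exp (w * of_real x)) = norm (kern_remainder k M x) * exp (c * x)"
        using w by (simp add: norm_mult norm_exp_eq_Re)
      also have "\<dots> \<le> B1 * exp (- (c - \<delta>) * x) * exp (c * x)" by (intro mult_right_mono B1) auto
      also have "\<dots> = B1 * exp (\<delta> * x)" by (simp add: algebra_simps flip: exp_add)
      also have "\<dots> \<le> (B1 + B2) * exp (- \<delta> * \<bar>x\<bar>)" using False B1(1) B2(1) by (intro mult_mono) auto
      finally show ?thesis .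
    qed
    thus "AE x in lborel. norm (kern_remainder k M x * exp (w * of_real x)) \<le> norm ((B1 + B2) * exp (- \<delta> * \<bar>x\<bar>))"
      by (intro AE_I2) (auto intro: order.trans[OF _ abs_ge_self])
  qed measurable
  show "integrable lborel (\<lambda>x. kern_remainder k M x * exp (s * of_real x))"
    by (rule int) (simp add: c_def)
  \<comment> \<open>The Fourier transform of \<open>zeta_beta\<close> along the line: 2 pi undoes
    the normalisation of \<open>line_integral\<close>, and the reflection of x matches the sign in
    the exponent of the inversion formula. It is undone by the substitution of -x for x
    below.\<close>
  define H where "H x = of_real (2 * pi) * (kern_remainder k M (- x) * exp (of_real c * of_real (- x)))" for x
  obtain B where B: "\<And>t. norm (zeta_beta k M (vline c t)) \<le> B" using zeta_beta_line(4)[OF c km k] by blast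
  have "zeta_beta k M (of_real c + \<i> * of_real (Im s)) = (LINT x|lborel. H x * iexp (- (x * Im s))) / (2 * of_real pi)"
  proof (rule fourier_inversion[OF zeta_beta_line(2,3)[OF c km k] B])
    show "integrable lborel H" unfolding H_def
      using lborel_integrable_real_affine[OF int[of "of_real c"], of "-1" 0]
      by (intro integrable_mult_right) simp
    show "H x = (LINT t|lborel. zeta_beta k M (vline c t) * iexp (x * t))" for x
    proof -
      have "H x = (LINT t|lborel. zeta_beta k M (vline c t) * exp (- (vline c t) * of_real (- x))) * exp (of_real c * of_real (- x))"
        unfolding H_def zeta_beta_line(1)[OF c km k] line_integral_def by simp
      also have "\<dots> = (LINT t|lborel. zeta_beta k M (vline c t) * exp (- (vline c t) * of_real (- x)) * exp (of_real c * of_real (- x)))"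
        by (rule integral_mult_left_zero[symmetric])
      also have "\<dots> = (LINT t|lborel. zeta_beta k M (vline c t) * iexp (x * t))"
        by (intro Bochner_Integration.integral_cong refl) (simp add: mult.assoc algebra_simps flip: exp_add)
      finally show ?thesis .
    qed
  qed
  also have "(LINT x|lborel. H x * iexp (- (x * Im s))) = (LINT x|lborel. of_real (2 * pi) * (kern_remainder k M (0 + (-1) * x) * exp (s * of_real (0 + (-1) * x))))"
  proof (intro Bochner_Integration.integral_cong refl)
    fix x
    have "s * of_real (- x) = of_real c * of_real (- x) + \<i> * of_real (- (x * Im s))"
      by (simp add: c_def complex_eq_iff)
    hence e: "exp (s * of_real (- x)) = exp (of_real c * of_real (- x)) * iexp (- (x * Im s))" by (simp only: exp_add)
    show "H x * iexp (- (x * Im s)) = of_real (2 * pi) * (kern_remainder k M (0 + (-1) * x) * exp (s * of_real (0 + (-1) * x)))"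
      using e unfolding H_def by (simp add: mult.assoc)
  qed
  also have "\<dots> = of_real (2 * pi) * (LINT x|lborel. kern_remainder k M (0 + (-1) * x) * exp (s * of_real (0 + (-1) * x)))"
    by (rule integral_mult_right_zero)
  also have "(LINT x|lborel. kern_remainder k M (0 + (-1) * x) * exp (s * of_real (0 + (-1) * x))) = (LINT x|lborel. kern_remainder k M x * exp (s * of_real x))"
    using lborel_integral_real_affine[of "-1" "\<lambda>x. kern_remainder k M x * exp (s * of_real x)" 0] by simp
  finally have "zeta_beta k M (of_real c + \<i> * of_real (Im s)) = (LINT x|lborel. kern_remainder k M x * exp (s * of_real x))" by simp
  moreover have "of_real c + \<i> * of_real (Im s) = s" by (simp add: c_def complex_eq_iff)
  ultimately show "(LINT x|lborel. kern_remainder k M x * exp (s * of_real x)) = riemann_zeta s ^ k * beta_fn M s"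
    by (simp add: zeta_beta_def)
qed

section \<open>Superposition of kernels\<close>

text \<open>The bridge from absolutely convergent integrals in the logarithmic variable to the
  integrals over (0, \<infinity>) of the theorem; real and imaginary parts are substituted
  separately.\<close>

lemma exp_substitution:
  fixes \<phi> :: "real \<Rightarrow> complex"
  assumes int: "integrable lborel (\<lambda>x. \<phi> (exp x) * of_real (exp x))"
  shows "(\<phi> has_integral (LINT x|lborel. \<phi> (exp x) * of_real (exp x))) {0<..}"
proof -
  have im: "(exp :: real \<Rightarrow> real) ` UNIV = {0<..}"
  proof -
    have "x \<in> range exp" if "x > 0" for x :: real
      using that by (intro image_eqI[of _ _ "ln x"]) auto
    thus ?thesis by auto
  qed
  have real: "(\<psi> has_integral (LINT x|lborel. \<psi> (exp x) * exp x)) {0<..}"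
    if int: "integrable lborel (\<lambda>x. \<psi> (exp x) * exp x)" for \<psi> :: "real \<Rightarrow> real"
  proof -
    have "integrable lebesgue (\<lambda>x. \<psi> (exp x) * exp x)"
      using int by (subst integrable_completion) auto
    hence ai: "(\<lambda>x. \<psi> (exp x) * exp x) absolutely_integrable_on UNIV"
      by (simp add: set_integrable_def)
    have eq: "integral UNIV (\<lambda>x. \<psi> (exp x) * exp x) = (LINT x|lborel. \<psi> (exp x) * exp x)"
      using has_integral_integral_lborel[OF int] by (simp add: has_integral_iff)
    have "(\<lambda>x. \<bar>exp x\<bar> * \<psi> (exp x)) absolutely_integrable_on UNIV \<and>
        integral UNIV (\<lambda>x. \<bar>exp x\<bar> * \<psi> (exp x)) = (LINT x|lborel. \<psi> (exp x) * exp x)"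
      using ai eq by (simp add: mult.commute)
    hence "\<psi> absolutely_integrable_on exp ` UNIV \<and> integral (exp ` UNIV) \<psi> = (LINT x|lborel. \<psi> (exp x) * exp x)"
      by (subst (asm) has_absolute_integral_change_of_variables_1') (auto intro!: derivative_eq_intros inj_onI)
    thus ?thesis unfolding im using has_integral_iff set_lebesgue_integral_eq_integral(1) by blast
  qed
  have R: "integrable lborel (\<lambda>x. Re (\<phi> (exp x)) * exp x)" "integrable lborel (\<lambda>x. Im (\<phi> (exp x)) * exp x)"
    using integrable_Re[OF int] integrable_Im[OF int] by simp_all
  have "((\<lambda>x. of_real (Re (\<phi> x)) + \<i> * of_real (Im (\<phi> x))) has_integral
      of_real (LINT x|lborel. Re (\<phi> (exp x)) * exp x) + \<i> * of_real (LINT x|lborel. Im (\<phi> (exp x)) * exp x)) {0<..}"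
    by (intro has_integral_add has_integral_mult_right has_integral_of_real real R)
  also have "(\<lambda>x. of_real (Re (\<phi> x)) + \<i> * of_real (Im (\<phi> x))) = \<phi>" by (simp add: fun_eq_iff complex_eq_iff)
  also have "of_real (LINT x|lborel. Re (\<phi> (exp x)) * exp x) + \<i> * of_real (LINT x|lborel. Im (\<phi> (exp x)) * exp x) = (LINT x|lborel. \<phi> (exp x) * of_real (exp x))"
    using integral_Re[OF int] integral_Im[OF int] by (simp add: complex_eq_iff)
  finally show ?thesis .
qed

text \<open>Applied to functions already multiplied by e^(sx), this says that the Mellin transform
  of a superposition of dilates is a product.\<close>

lemma convolution_integral:
  fixes u v :: "real \<Rightarrow> complex"
  assumes u: "integrable lborel u" and v: "integrable lborel v"
  shows "integrable lborel (\<lambda>x. LINT y|lborel. u (x - y) * v y)"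
    "(LINT x|lborel. LINT y|lborel. u (x - y) * v y) = (LINT x|lborel. u x) * (LINT y|lborel. v y)"
proof -
  note [measurable] = borel_measurable_integrable[OF u] borel_measurable_integrable[OF v]
  have sh: "integrable lborel (\<lambda>x. u (x - y))" "(LINT x|lborel. u (x - y)) = (LINT x|lborel. u x)" for y
    using lborel_integrable_real_affine[OF u, of 1 "-y"] lborel_integral_real_affine[of 1 u "-y"] by simp_all
  have shn: "(LINT x|lborel. norm (u (x - y))) = (LINT x|lborel. norm (u x))" for y
    using lborel_integral_real_affine[of 1 "\<lambda>x. norm (u x)" "-y"] by simp
  have ip: "integrable (lborel \<Otimes>\<^sub>M lborel) (\<lambda>(y, x). u (x - y) * v y)"
  proof (rule lborel_pair.Fubini_integrable)
    show "integrable lborel (\<lambda>y. LINT x|lborel. norm (case (y, x) of (y, x) \<Rightarrow> u (x - y) * v y))"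
      using v by (simp add: norm_mult shn)
    show "AE y in lborel. integrable lborel (\<lambda>x. case (y, x) of (y, x) \<Rightarrow> u (x - y) * v y)"
      using sh by simp
  qed measurable
  show "integrable lborel (\<lambda>x. LINT y|lborel. u (x - y) * v y)"
    using lborel_pair.integrable_snd[OF ip] by simp
  have "(LINT x|lborel. LINT y|lborel. u (x - y) * v y) = (LINT y|lborel. LINT x|lborel. u (x - y) * v y)"
    using lborel_pair.Fubini_integral[OF ip] by simp
  also have "\<dots> = (LINT x|lborel. u x) * (LINT y|lborel. v y)"
    by (simp add: sh)
  finally show "(LINT x|lborel. LINT y|lborel. u (x - y) * v y) = (LINT x|lborel. u x) * (LINT y|lborel. v y)" .
qed

text \<open>Fixes the derivatives witnessing membership in \<open>M_class\<close> for m = M + 1, so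
  that the density can be defined from the last of them.\<close>

locale taylor_data =
  fixes \<alpha> :: real and M :: nat and f :: "real \<Rightarrow> complex" and g :: "nat \<Rightarrow> real \<Rightarrow> complex"
  assumes \<alpha>: "\<alpha> > 1"
    and g0: "\<And>x. x \<ge> 0 \<Longrightarrow> g 0 x = f x"
    and gcont: "\<And>j. j \<le> Suc M \<Longrightarrow> continuous_on {0..} (g j)"
    and gder: "\<And>j x. j \<le> M \<Longrightarrow> x \<ge> 0 \<Longrightarrow> (g j has_vector_derivative g (Suc j) x) (at x within {0..})"
    and gbd: "\<And>j. j \<le> Suc M \<Longrightarrow> \<exists>C X. \<forall>x\<ge>X. norm (g j x) \<le> C * x powr (- \<alpha> - real j)"
begin

text \<open>By Taylor's formula with base point at infinity, \<open>f(e\<^sup>x)\<close> is the convolution of \<^const>\<open>kern\<close> with this density.\<close>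

definition omega :: "real \<Rightarrow> complex" where
  "omega y = of_real ((-1) ^ Suc M / fact M * exp (real (Suc M) * y)) * g (Suc M) (exp y)"

lemma omega_measurable [measurable]: "omega \<in> borel_measurable borel"
proof -
  have "continuous_on UNIV (\<lambda>y::real. g (Suc M) (exp y))"
    by (rule continuous_on_compose2[OF gcont]) (auto intro!: continuous_intros)
  hence "continuous_on UNIV omega" unfolding omega_def by (intro continuous_intros)
  thus ?thesis by (rule borel_measurable_continuous_onI)
qed

text \<open>The class prescribes decay only from some unspecified point on; compactness of the
  initial segment extends the bound to the whole half-line.\<close>

lemma g_bound:
  obtains K where "K \<ge> 0" "\<And>v. v \<ge> 0 \<Longrightarrow> norm (g (Suc M) v) \<le> K"
    "\<And>v. v \<ge> 1 \<Longrightarrow> norm (g (Suc M) v) \<le> K * v powr (- \<alpha> - real (Suc M))"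
proof -
  obtain C X0 where CX: "\<And>x. x \<ge> X0 \<Longrightarrow> norm (g (Suc M) x) \<le> C * x powr (- \<alpha> - real (Suc M))"
    using gbd[of "Suc M"] by auto
  define X where "X = max 1 X0"
  have "compact (g (Suc M) ` {0..X})"
    by (intro compact_continuous_image continuous_on_subset[OF gcont]) auto
  then obtain K0 where K0: "K0 > 0" "\<forall>x\<in>g (Suc M) ` {0..X}. norm x \<le> K0"
    using compact_imp_bounded bounded_pos by blast
  define p where "p = \<alpha> + real (Suc M)"
  have p: "p > 0" using \<alpha> by (simp add: p_def)
  \<comment> \<open>On [1, X] the bound K0 is multiplied by X^p to outweigh v^(-p) >=
    X^(-p).\<close>
  define K where "K = K0 * X powr p + \<bar>C\<bar>"
  have X: "X \<ge> 1" by (simp add: X_def)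
  have Xp: "X powr p \<ge> 1" using X p by (intro ge_one_powr_ge_zero) auto
  have K0K: "K0 \<le> K" 
  proof -
    have "K0 * 1 \<le> K0 * X powr p" using K0(1) Xp by (intro mult_left_mono) auto
    thus ?thesis by (simp add: K_def)
  qed
  have big: "norm (g (Suc M) v) \<le> K * v powr (- p)" if v: "v \<ge> 1" for v
  proof (cases "v \<le> X")
    case True
    have "norm (g (Suc M) v) \<le> K0 * 1" using K0 v True by auto
    also have "1 = X powr p * X powr (- p)" using X by (simp flip: powr_add)
    also have "\<dots> \<le> X powr p * v powr (- p)" using v True p by (intro mult_left_mono powr_mono2') auto
    also have "K0 * (X powr p * v powr (- p)) \<le> K * v powr (- p)"
      by (simp add: K_def distrib_right)
    finally show ?thesis using K0 by simp
  next
    case False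
    hence "norm (g (Suc M) v) \<le> C * v powr (- \<alpha> - real (Suc M))" by (intro CX) (auto simp: X_def)
    also have "- \<alpha> - real (Suc M) = - p" by (simp add: p_def)
    also have "C * v powr (- p) \<le> K * v powr (- p)"
      using K0 by (intro mult_right_mono) (auto simp: K_def intro: order.trans[OF abs_ge_self])
    finally show ?thesis .
  qed
  show ?thesis
  proof (rule that[of K])
    show K: "K \<ge> 0" using K0 K0K by linarith
    show "norm (g (Suc M) v) \<le> K" if v: "v \<ge> 0" for v
    proof (cases "v \<le> X")
      case True
      hence "norm (g (Suc M) v) \<le> K0" using K0(2) v by auto
      thus ?thesis using K0K by linarith
    next
      case False
      hence "v \<ge> 1" using X by linarith
      have "norm (g (Suc M) v) \<le> K * v powr (- p)" by (rule big) fact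
      also have "\<dots> \<le> K * v powr 0" using K \<open>v \<ge> 1\<close> p by (intro mult_left_mono powr_mono) auto
      finally show ?thesis using \<open>v \<ge> 1\<close> by simp
    qed
    show "norm (g (Suc M) v) \<le> K * v powr (- \<alpha> - real (Suc M))" if "v \<ge> 1" for v
    proof -
      have "- p = - \<alpha> - real (Suc M)" by (simp add: p_def)
      thus ?thesis using big[OF that] by (simp only:)
    qed
  qed
qed

text \<open>Towards -\<infinity> the m-th derivative is bounded and e^(\<sigma>y) decays. Towards
  +\<infinity> the factor e^(my) cancels the extra decay of that derivative, leaving
  e^(-(\<alpha>-\<sigma>)y). Hence the range 0 < \<sigma> < \<alpha>.\<close>

lemma omega_integrable:
  assumes \<sigma>: "0 < \<sigma>" "\<sigma> < \<alpha>"
  shows "integrable lborel (\<lambda>y. norm (omega y) * exp (\<sigma> * y))"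
proof -
  obtain K where K: "K \<ge> 0" "\<And>v. v \<ge> 0 \<Longrightarrow> norm (g (Suc M) v) \<le> K"
    "\<And>v. v \<ge> 1 \<Longrightarrow> norm (g (Suc M) v) \<le> K * v powr (- \<alpha> - real (Suc M))"
    by (rule g_bound) (rule that)
  define \<delta> where "\<delta> = min \<sigma> (\<alpha> - \<sigma>)"
  have \<delta>: "\<delta> > 0" using \<sigma> by (simp add: \<delta>_def)
  have no: "norm (omega y) \<le> exp (real (Suc M) * y) * norm (g (Suc M) (exp y))" for y
  proof -
    have "norm (omega y) = (1 / fact M) * (exp (real (Suc M) * y) * norm (g (Suc M) (exp y)))"
      by (simp add: omega_def norm_mult norm_divide norm_power)
    also have "\<dots> \<le> 1 * (exp (real (Suc M) * y) * norm (g (Suc M) (exp y)))"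
      by (intro mult_right_mono) (auto simp: fact_ge_1)
    finally show ?thesis by simp
  qed
  have bound: "norm (omega y) * exp (\<sigma> * y) \<le> K * exp (- \<delta> * \<bar>y\<bar>)" for y
  proof (cases "y \<ge> 0")
    case True
    have "norm (omega y) * exp (\<sigma> * y) \<le> exp (real (Suc M) * y) * (K * exp y powr (- \<alpha> - real (Suc M))) * exp (\<sigma> * y)"
      using True by (intro mult_right_mono order.trans[OF no] mult_left_mono K) auto
    also have "\<dots> = K * exp (- (\<alpha> - \<sigma>) * y)"
      by (simp add: powr_def algebra_simps flip: exp_add)
    also have "\<dots> \<le> K * exp (- \<delta> * \<bar>y\<bar>)"
    proof -
      have "\<delta> * y \<le> (\<alpha> - \<sigma>) * y" using True by (intro mult_right_mono) (auto simp: \<delta>_def)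
      thus ?thesis using True K(1) by (intro mult_left_mono) (simp_all add: algebra_simps)
    qed
    finally show ?thesis .
  next
    case False
    have "norm (omega y) * exp (\<sigma> * y) \<le> exp (real (Suc M) * y) * K * exp (\<sigma> * y)"
      by (intro mult_right_mono order.trans[OF no] mult_left_mono K) auto
    also have "\<dots> \<le> 1 * K * exp (\<sigma> * y)"
      using False K(1) by (intro mult_right_mono) (auto simp: mult_nonneg_nonpos)
    also have "\<dots> \<le> K * exp (- \<delta> * \<bar>y\<bar>)"
    proof -
      have "\<sigma> * y \<le> \<delta> * y" using False by (intro mult_right_mono_neg) (auto simp: \<delta>_def)
      thus ?thesis using False K(1) by (auto intro!: mult_left_mono)
    qed
    finally show ?thesis .
  qed
  show ?thesis
  proof (rule Bochner_Integration.integrable_bound)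
    show "integrable lborel (\<lambda>y::real. K * exp (- \<delta> * \<bar>y\<bar>))"
      by (intro integrable_mult_right integrable_exp_minus_abs \<delta>)
    show "AE y in lborel. norm (norm (omega y) * exp (\<sigma> * y)) \<le> norm (K * exp (- \<delta> * \<bar>y\<bar>))"
      using bound K(1) by (intro AE_I2) (simp add: abs_mult)
  qed measurable
qed

lemma omega_exp_integrable:
  assumes "0 < Re s" "Re s < \<alpha>"
  shows "integrable lborel (\<lambda>y. omega y * exp (s * of_real y))"
  by (rule Bochner_Integration.integrable_bound[OF omega_integrable[OF assms]])
     (auto intro!: AE_I2 simp: norm_mult norm_exp_eq_Re)

lemma kern_omega_integrable:
  shows "integrable lborel (\<lambda>y. of_real (kern M (x - y)) * omega y)"
proof (rule Bochner_Integration.integrable_bound)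
  show "integrable lborel (\<lambda>y. exp (- x) * (norm (omega y) * exp (1 * y)))"
    using \<alpha> by (intro integrable_mult_right omega_integrable) auto
  have "norm (of_real (kern M (x - y)) * omega y) \<le> exp (- x) * (norm (omega y) * exp (1 * y))" for y
  proof -
    have "kern M (x - y) * norm (omega y) \<le> exp (- 1 * (x - y)) * norm (omega y)"
      by (intro mult_right_mono kern_le_exp) auto
    also have "\<dots> = exp (- x) * (norm (omega y) * exp (1 * y))"
      by (simp add: exp_diff exp_minus field_simps)
    finally show ?thesis by (simp add: norm_mult kern_nonneg)
  qed
  thus "AE y in lborel. norm (of_real (kern M (x - y)) * omega y) \<le> norm (exp (- x) * (norm (omega y) * exp (1 * y)))"
    by (intro AE_I2) (auto intro: order.trans[OF _ abs_ge_self])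
qed measurable

text \<open>Expanding at the right end point T amounts to expanding t -> g(-t) at its left end point
  -T; the reflection is the source of the signs (-1)^i.\<close>

lemma taylor_from_right:
  assumes x: "0 \<le> x" "x \<le> T"
  shows "((\<lambda>v. ((v - x) ^ M / fact M) *\<^sub>R ((-1) ^ Suc M * g (Suc M) v)) has_integral
     f x - (\<Sum>i\<le>M. ((T - x) ^ i / fact i) *\<^sub>R ((-1) ^ i * g i T))) {x..T}"
proof -
  define Df where "Df j t = (-1) ^ j * g j (- t)" for j t
  have "((\<lambda>t. ((- x - t) ^ (Suc M - 1) / fact (Suc M - 1)) *\<^sub>R Df (Suc M) t) has_integral
     Df 0 (- x) - (\<Sum>i<Suc M. ((- x - (- T)) ^ i / fact i) *\<^sub>R Df i (- T))) {- T..- x}"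
  proof (rule Taylor_has_integral)
    fix j t assume j: "j < Suc M" and t: "- T \<le> t" "t \<le> - x"
    have "(g j has_vector_derivative g (Suc j) (- t)) (at (- t) within uminus ` {- T..- x})"
      by (rule has_vector_derivative_within_subset[OF gder]) (use j t x in auto)
    hence "(g j \<circ> uminus has_vector_derivative (-1) *\<^sub>R g (Suc j) (- t)) (at t within {- T..- x})"
      by (intro vector_diff_chain_within) (auto intro!: derivative_eq_intros)
    hence "((\<lambda>t. (-1) ^ j * (g j \<circ> uminus) t) has_vector_derivative (-1) ^ j * ((-1) *\<^sub>R g (Suc j) (- t))) (at t within {- T..- x})"
      by (rule has_vector_derivative_mult_right)
    thus "(Df j has_vector_derivative Df (Suc j) t) (at t within {- T..- x})"
      by (simp add: Df_def[abs_def] o_def)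
  qed (use x in auto)
  also have "Df 0 (- x) - (\<Sum>i<Suc M. ((- x - (- T)) ^ i / fact i) *\<^sub>R Df i (- T)) =
     f x - (\<Sum>i\<le>M. ((T - x) ^ i / fact i) *\<^sub>R ((-1) ^ i * g i T))"
    using x g0 by (simp add: Df_def lessThan_Suc_atMost)
  finally have "((\<lambda>t. (\<lambda>v. ((v - x) ^ M / fact M) *\<^sub>R ((-1) ^ Suc M * g (Suc M) v)) (- t)) has_integral
     f x - (\<Sum>i\<le>M. ((T - x) ^ i / fact i) *\<^sub>R ((-1) ^ i * g i T))) {- T..- x}"
    by (simp add: Df_def minus_diff_commute)
  thus ?thesis by (subst (asm) has_integral_reflect_real)
qed

text \<open>The power T^i is offset exactly by the decay T^(-\<alpha>-i) of the i-th derivative,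
  leaving T^(-\<alpha>).\<close>

lemma taylor_remainder_tendsto:
  assumes x: "x \<ge> 0"
  shows "((\<lambda>T. \<Sum>i\<le>M. ((T - x) ^ i / fact i) *\<^sub>R ((-1) ^ i * g i T)) \<longlongrightarrow> 0) at_top"
proof (rule tendsto_null_sum)
  fix i assume i: "i \<in> {..M}"
  obtain C X where CX: "\<And>x. x \<ge> X \<Longrightarrow> norm (g i x) \<le> C * x powr (- \<alpha> - real i)"
    using gbd[of i] i by auto
  have "((\<lambda>T. C * T powr (- \<alpha>)) \<longlongrightarrow> C * 0) at_top"
    using \<alpha> by (intro tendsto_mult tendsto_const tendsto_neg_powr filterlim_ident) auto
  hence lim: "((\<lambda>T. C * T powr (- \<alpha>)) \<longlongrightarrow> 0) at_top" by simp
  show "((\<lambda>T. ((T - x) ^ i / fact i) *\<^sub>R ((-1) ^ i * g i T)) \<longlongrightarrow> 0) at_top"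
  proof (rule Lim_null_comparison[OF _ lim])
    show "eventually (\<lambda>T. norm (((T - x) ^ i / fact i) *\<^sub>R ((-1) ^ i * g i T)) \<le> C * T powr (- \<alpha>)) at_top"
      using eventually_ge_at_top[of X] eventually_ge_at_top[of "max 1 x"]
    proof eventually_elim
      case (elim T)
      have T: "T \<ge> 1" "T \<ge> x" using elim by auto
      have "norm (((T - x) ^ i / fact i) *\<^sub>R ((-1) ^ i * g i T)) = (T - x) ^ i / fact i * norm (g i T)"
        using T by (simp add: norm_mult norm_power)
      also have "\<dots> \<le> T ^ i / 1 * (C * T powr (- \<alpha> - real i))"
        using T x elim by (intro mult_mono frac_le power_mono CX) (auto simp: fact_ge_1)
      also have "\<dots> = C * (T powr real i * T powr (- \<alpha> - real i))"
        using T by (simp add: powr_realpow)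
      also have "T powr real i * T powr (- \<alpha> - real i) = T powr (- \<alpha>)" by (simp flip: powr_add)
      finally show ?case .
    qed
  qed
qed

text \<open>With v = e^y the Taylor integrand (v - e^x)^M dv becomes e^((M+1)y) (1 - e^(x-y))^M dy,
  a translate of the kernel times the weight in \<open>omega\<close>. The truncation at e^t leaves a
  Taylor polynomial that vanishes as t grows.\<close>

lemma f_exp: "f (exp x) = (LINT y|lborel. of_real (kern M (x - y)) * omega y)"
proof -
  let ?h = "\<lambda>y. of_real (kern M (x - y)) * omega y"
  define S where "S T = (\<Sum>i\<le>M. ((T - exp x) ^ i / fact i) *\<^sub>R ((-1) ^ i * g i T))" for T
  have *: "(LINT y|lborel. indicator {..t} y *\<^sub>R (?h y)) = f (exp x) - S (exp t)"
    if t: "t \<ge> x" for t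
  proof -
    define \<psi> where "\<psi> v = (if v \<in> {exp x..exp t} then ((v - exp x) ^ M / fact M) *\<^sub>R ((-1) ^ Suc M * g (Suc M) v) else 0)" for v
    \<comment> \<open>The point y = x is excluded because for M = 0 the power 0^0 is 1 while
      \<open>kern\<close> vanishes at 0; a single point does not affect the integral.\<close>
    have eq: "\<psi> (exp y) * of_real (exp y) = indicator {..t} y *\<^sub>R (?h y)" if "y \<noteq> x" for y
    proof (cases "y \<in> {x<..t}")
      case True
      have "exp y - exp x = exp y * (1 - exp (x - y))" by (simp add: algebra_simps flip: exp_add)
      hence "(exp y - exp x) ^ M * exp y = exp (real (Suc M) * y) * kern M (x - y)"
      proof -
        have e: "exp (real (Suc M) * y) = exp y * exp y ^ M" using exp_of_nat_mult[of "Suc M" y] by simp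
        show ?thesis using True unfolding e \<open>exp y - exp x = exp y * (1 - exp (x - y))\<close>
          by (simp add: kern_def power_mult_distrib)
      qed
      moreover have "\<psi> (exp y) * of_real (exp y) = of_real ((exp y - exp x) ^ M * exp y) * (of_real ((-1) ^ Suc M / fact M) * g (Suc M) (exp y))"
        using True by (simp add: \<psi>_def scaleR_conv_of_real)
      ultimately have "\<psi> (exp y) * of_real (exp y) = of_real (exp (real (Suc M) * y) * kern M (x - y)) * (of_real ((-1) ^ Suc M / fact M) * g (Suc M) (exp y))"
        by (simp only:)
      thus ?thesis using True by (simp add: omega_def)
    qed (use that in \<open>auto simp: \<psi>_def kern_def\<close>)
    have int: "integrable lborel (\<lambda>y. indicator {..t} y *\<^sub>R (?h y))"
      using kern_omega_integrable by (intro integrable_mult_indicator) auto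
    have ae: "AE y in lborel. \<psi> (exp y) * of_real (exp y) = indicator {..t} y *\<^sub>R (?h y)"
      using AE_lborel_singleton[of x] by eventually_elim (rule eq)
    have hi: "((\<lambda>v. ((v - exp x) ^ M / fact M) *\<^sub>R ((-1) ^ Suc M * g (Suc M) v)) has_integral f (exp x) - S (exp t)) {exp x..exp t}"
      unfolding S_def using t by (intro taylor_from_right) auto
    have "(\<lambda>y. \<psi> (exp y) * of_real (exp y)) \<in> borel_measurable lborel"
    proof -
      have "continuous_on UNIV (\<lambda>y::real. g (Suc M) (exp y))"
        by (rule continuous_on_compose2[OF gcont]) (auto intro!: continuous_intros)
      hence [measurable]: "(\<lambda>y::real. g (Suc M) (exp y)) \<in> borel_measurable borel"
        by (rule borel_measurable_continuous_onI)
      show ?thesis unfolding \<psi>_def by measurable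
    qed
    hence int': "integrable lborel (\<lambda>y. \<psi> (exp y) * of_real (exp y))"
      by (rule integrable_cong_AE_imp[OF int]) (use ae in \<open>eventually_elim, simp only:\<close>)
    have "(\<psi> has_integral (LINT y|lborel. \<psi> (exp y) * of_real (exp y))) {0<..}"
      by (rule exp_substitution[OF int'])
    moreover have "(\<psi> has_integral f (exp x) - S (exp t)) {0<..}"
    proof -
      have "{exp x..exp t} \<subseteq> {0<..}" using less_le_trans[OF exp_gt_zero[of x]] by auto
      thus ?thesis unfolding \<psi>_def using hi by (subst has_integral_restrict) auto
    qed
    ultimately have "(LINT y|lborel. \<psi> (exp y) * of_real (exp y)) = f (exp x) - S (exp t)"
      by (rule has_integral_unique)
    moreover have "(LINT y|lborel. \<psi> (exp y) * of_real (exp y)) = (LINT y|lborel. indicator {..t} y *\<^sub>R (?h y))"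
      using int int' ae by (intro integral_cong_AE) auto
    ultimately show ?thesis by simp
  qed
  have "(\<lambda>n. LINT y|lborel. indicator {..real n} y *\<^sub>R (?h y)) \<longlonglongrightarrow> (LINT y|lborel. ?h y)"
  proof (rule integral_dominated_convergence)
    show "integrable lborel (\<lambda>y. norm (?h y))" by (intro integrable_norm kern_omega_integrable)
    show "AE y in lborel. (\<lambda>n. indicator {..real n} y *\<^sub>R (?h y)) \<longlonglongrightarrow> ?h y"
    proof (rule AE_I2)
      fix y :: real
      obtain N :: nat where N: "y \<le> real N" using real_arch_simple by blast
      have "eventually (\<lambda>n. indicator {..real n} y *\<^sub>R (?h y) = ?h y) sequentially"
        using eventually_ge_at_top[of N] by eventually_elim (use N in \<open>auto split: split_indicator\<close>)
      thus "(\<lambda>n. indicator {..real n} y *\<^sub>R (?h y)) \<longlonglongrightarrow> ?h y"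
        by (rule tendsto_eventually)
    qed
    show "AE y in lborel. norm (indicator {..real n} y *\<^sub>R (?h y)) \<le> norm (?h y)" for n
      by (intro AE_I2) (auto split: split_indicator)
  qed measurable
  moreover have "(\<lambda>n. LINT y|lborel. indicator {..real n} y *\<^sub>R (?h y)) \<longlonglongrightarrow> f (exp x) - 0"
  proof (rule Lim_transform_eventually)
    have "filterlim (\<lambda>n. exp (real n)) at_top sequentially"
      by (intro filterlim_compose[OF exp_at_top] filterlim_real_sequentially)
    hence "(\<lambda>n. S (exp (real n))) \<longlonglongrightarrow> 0"
      unfolding S_def by (rule filterlim_compose[OF taylor_remainder_tendsto[OF exp_ge_zero]])
    thus "(\<lambda>n. f (exp x) - S (exp (real n))) \<longlonglongrightarrow> f (exp x) - 0" by (intro tendsto_intros)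
    obtain N :: nat where N: "x \<le> real N" using real_arch_simple by blast
    show "eventually (\<lambda>n. f (exp x) - S (exp (real n)) = (LINT y|lborel. indicator {..real n} y *\<^sub>R (?h y))) sequentially"
      using eventually_ge_at_top[of N] by eventually_elim (rule *[symmetric], use N in simp)
  qed
  ultimately show ?thesis using LIMSEQ_unique by fastforce
qed

text \<open>The Mellin transform of f acquires the transform of \<open>omega\<close> as a factor
  beside that of the kernel. The same factor will carry the kernel identity over to f.\<close>

lemma mellin_f:
  assumes s: "0 < Re s" "Re s < \<alpha>"
  shows "mellin f s = beta_fn M s * (LINT y|lborel. omega y * exp (s * of_real y))"
proof -
  define u where "u y = of_real (kern M y) * exp (s * complex_of_real y)" for y
  define v where "v y = omega y * exp (s * complex_of_real y)" for y
  have u: "integrable lborel u" "(LINT y|lborel. u y) = beta_fn M s"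
    using kern_laplace[OF s(1), of M] by (simp_all add: u_def[abs_def])
  have v: "integrable lborel v" using omega_exp_integrable[OF s] by (simp add: v_def[abs_def])
  have eq: "f (exp x) * of_real (exp x) powr (s - 1) * of_real (exp x) = (LINT y|lborel. u (x - y) * v y)" for x
  proof -
    have "of_real (exp x) powr (s - 1) * of_real (exp x) = exp (s * complex_of_real x)"
    proof -
      have "Ln (of_real (exp x)) = of_real x" by (subst Ln_of_real) auto
      thus ?thesis by (simp add: powr_def algebra_simps exp_of_real[symmetric] flip: exp_add)
    qed
    hence "f (exp x) * of_real (exp x) powr (s - 1) * of_real (exp x) = (LINT y|lborel. of_real (kern M (x - y)) * omega y) * exp (s * complex_of_real x)"
      by (simp add: f_exp)
    also have "\<dots> = (LINT y|lborel. of_real (kern M (x - y)) * omega y * exp (s * complex_of_real x))"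
      by (rule integral_mult_left_zero[symmetric])
    also have "\<dots> = (LINT y|lborel. u (x - y) * v y)"
      by (intro Bochner_Integration.integral_cong refl) (simp add: u_def v_def algebra_simps flip: exp_add)
    finally show ?thesis .
  qed
  have "((\<lambda>x. f x * of_real x powr (s - 1)) has_integral (LINT x|lborel. f (exp x) * of_real (exp x) powr (s - 1) * of_real (exp x))) {0<..}"
    by (rule exp_substitution) (simp only: eq convolution_integral(1)[OF u(1) v])
  hence "mellin f s = (LINT x|lborel. LINT y|lborel. u (x - y) * v y)"
    unfolding mellin_def eq by (simp add: has_integral_iff)
  also have "\<dots> = beta_fn M s * (LINT y|lborel. v y)" using convolution_integral(2)[OF u(1) v] u(2) by simp
  finally show ?thesis by (simp add: v_def)
qed

end

lemma kern_shift_exp_integral: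
  "(LINT y|lborel. kern M (x + y) * exp (p * y)) = exp (- p * x) * (LINT y|lborel. kern M y * exp (p * y))"
proof -
  have eq: "kern M (x + y) * exp (p * y) = exp (- p * x) * (kern M (x + 1 * y) * exp (p * (x + 1 * y)))" for y
    by (simp add: algebra_simps flip: exp_add)
  show ?thesis unfolding eq integral_mult_right_zero
    using lborel_integral_real_affine[of 1 "\<lambda>y. kern M y * exp (p * y)" x] by simp
qed

context taylor_data
begin

text \<open>The sum over n and the superposition may be exchanged because the norms are dominated by
  a product of a function of y and a summable sequence in n.\<close>

lemma divisor_sum_part:
  defines "D \<equiv> \<lambda>k z. \<Sum>n. real (divisor_k k (Suc n)) * kern M (z + ln (real (Suc n)))"
  shows "integrable lborel (\<lambda>y. of_real (D k (x - y)) * omega y)"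
    "(\<Sum>n. of_nat (divisor_k k (Suc n)) * f (real (Suc n) * exp x)) = (LINT y|lborel. of_real (D k (x - y)) * omega y)"
proof -
  \<comment> \<open>A point between 1 and \<alpha>: above 1 the divisor series converges, below
    \<alpha> the moment of \<open>omega\<close> is finite. This is where \<alpha> > 1 provides
    room.\<close>
  define c where "c = (1 + \<alpha>) / 2"
  have c: "c > 1" "c < \<alpha>" using \<alpha> by (auto simp: c_def)
  define h where "h n y = of_nat (divisor_k k (Suc n)) * (of_real (kern M (x + ln (real (Suc n)) - y)) * omega y)" for n y
  have inth: "integrable lborel (h n)" for n
    unfolding h_def by (intro integrable_mult_right kern_omega_integrable)
  define w where "w y = exp (- c * x) * (norm (omega y) * exp (c * y))" for y
  have intw: "integrable lborel w" unfolding w_def using c by (intro integrable_mult_right omega_integrable) auto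
  have nh: "norm (h n y) \<le> w y * (real (divisor_k k (Suc n)) * real (Suc n) powr (- c))" for n y
  proof -
    have "norm (h n y) = real (divisor_k k (Suc n)) * (kern M (x + ln (real (Suc n)) - y) * norm (omega y))"
      by (simp add: h_def norm_mult kern_nonneg)
    also have "\<dots> \<le> real (divisor_k k (Suc n)) * (exp (- c * (x + ln (real (Suc n)) - y)) * norm (omega y))"
      using c by (intro mult_left_mono mult_right_mono kern_le_exp) auto
    also have "exp (- c * (x + ln (real (Suc n)) - y)) = exp (- c * x) * exp (c * y) * real (Suc n) powr (- c)"
      by (simp add: powr_def algebra_simps flip: exp_add)
    finally show ?thesis by (simp add: w_def mult_ac)
  qed
  have sd: "summable (\<lambda>n. real (divisor_k k (Suc n)) * real (Suc n) powr (- c))" by (rule summable_divisor_k[OF c(1)])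
  have s1: "AE y in lborel. summable (\<lambda>n. norm (h n y))"
  proof (rule AE_I2)
    fix y
    show "summable (\<lambda>n. norm (h n y))"
      by (rule summable_comparison_test'[OF summable_mult[OF sd, of "w y"], where N = 0]) (use nh in auto)
  qed
  have s2: "summable (\<lambda>n. LINT y|lborel. norm (h n y))"
  proof (rule summable_comparison_test'[OF summable_mult[OF sd, of "LINT y|lborel. w y"], where N = 0])
    fix n
    have "norm (LINT y|lborel. norm (h n y)) = (LINT y|lborel. norm (h n y))" by simp
    also have "\<dots> \<le> (LINT y|lborel. w y * (real (divisor_k k (Suc n)) * real (Suc n) powr (- c)))"
      by (rule Bochner_Integration.integral_mono[OF integrable_norm[OF inth] integrable_mult_left[OF intw] nh])
    also have "\<dots> = (LINT y|lborel. w y) * (real (divisor_k k (Suc n)) * real (Suc n) powr (- c))"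
      by (rule integral_mult_left_zero)
    finally show "norm (LINT y|lborel. norm (h n y)) \<le> (LINT y|lborel. w y) * (real (divisor_k k (Suc n)) * real (Suc n) powr (- c))" .
  qed
  have sumh: "(\<Sum>n. h n y) = of_real (D k (x - y)) * omega y" for y
  proof -
    have "(\<lambda>n. complex_of_real (real (divisor_k k (Suc n)) * kern M ((x - y) + ln (real (Suc n)))) * omega y) sums (of_real (D k (x - y)) * omega y)"
      unfolding D_def by (intro sums_mult2 sums_of_real summable_sums summable_divisor_k_kern[OF c(1)])
    thus ?thesis by (simp add: sums_iff h_def algebra_simps)
  qed
  show "integrable lborel (\<lambda>y. of_real (D k (x - y)) * omega y)"
    using integrable_suminf[OF inth s1 s2] unfolding sumh .
  have "(LINT y|lborel. h n y) = of_nat (divisor_k k (Suc n)) * f (real (Suc n) * exp x)" for n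
  proof -
    have "real (Suc n) * exp x = exp (x + ln (real (Suc n)))" by (simp add: exp_add)
    thus ?thesis unfolding h_def by (simp only: f_exp integral_mult_right_zero)
  qed
  thus "(\<Sum>n. of_nat (divisor_k k (Suc n)) * f (real (Suc n) * exp x)) = (LINT y|lborel. of_real (D k (x - y)) * omega y)"
    using integral_suminf[OF inth s1 s2] unfolding sumh by simp
qed

lemma omega_kern_pair_integrable:
  assumes p: "0 < p" "p < \<alpha>"
  shows "integrable (lborel \<Otimes>\<^sub>M lborel) (\<lambda>(\<eta>, y). norm (omega \<eta>) * (kern M (x - \<eta> + y) * exp (p * y)))"
proof (rule lborel_pair.Fubini_integrable)
  let ?h = "\<lambda>\<eta> y. norm (omega \<eta>) * (kern M (x - \<eta> + y) * exp (p * y))"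
  define A where "A = (LINT y|lborel. kern M y * exp (p * y))"
  have "(LINT y|lborel. norm (case (\<eta>, y) of (\<eta>, y) \<Rightarrow> ?h \<eta> y)) =
     (A * exp (- p * x)) * (norm (omega \<eta>) * exp (p * \<eta>))" for \<eta>
  proof -
    have "(LINT y|lborel. norm (case (\<eta>, y) of (\<eta>, y) \<Rightarrow> ?h \<eta> y)) =
       (LINT y|lborel. ?h \<eta> y)"
      by (intro Bochner_Integration.integral_cong refl) (simp add: abs_mult kern_nonneg)
    also have "\<dots> = norm (omega \<eta>) * (exp (- p * (x - \<eta>)) * A)"
      by (simp only: integral_mult_right_zero kern_shift_exp_integral A_def)
    also have "exp (- p * (x - \<eta>)) = exp (- p * x) * exp (p * \<eta>)" by (simp add: algebra_simps flip: exp_add)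
    finally show ?thesis by (simp add: mult_ac)
  qed
  moreover have "integrable lborel (\<lambda>\<eta>. (A * exp (- p * x)) * (norm (omega \<eta>) * exp (p * \<eta>)))"
    by (intro integrable_mult_right omega_integrable p)
  ultimately show "integrable lborel (\<lambda>\<eta>. LINT y|lborel. norm (case (\<eta>, y) of (\<eta>, y) \<Rightarrow> ?h \<eta> y))"
    by simp
  show "AE \<eta> in lborel. integrable lborel (\<lambda>y. case (\<eta>, y) of (\<eta>, y) \<Rightarrow> ?h \<eta> y)"
    using p by (intro AE_I2) (simp add: integrable_mult_right kern_shift_exp_integrable)
qed measurable

text \<open>The Fubini argument for the second term of the bracket: integrating over the density
  first reproduces f, integrating over y first gives the kernel case.\<close>

lemma residue_part:
  defines "R \<equiv> \<lambda>k z. (LINT y|lborel. of_real (kern M (z + y)) * P_kernel k (exp y) * of_real (exp y))"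
  shows "integrable lborel (\<lambda>\<eta>. R k (x - \<eta>) * omega \<eta>)"
    "integral {0<..} (\<lambda>y. f (exp x * y) * P_kernel k y) = (LINT \<eta>|lborel. R k (x - \<eta>) * omega \<eta>)"
proof -
  \<comment> \<open>Small enough that both exponents 1 + r and 1 - r lie in (0, \<alpha>), where the
    moments of \<open>omega\<close> are finite.\<close>
  define r where "r = min (1 / 2) ((\<alpha> - 1) / 2)"
  have r: "0 < r" "r < 1" "1 + r < \<alpha>" using \<alpha> by (auto simp: r_def min_def field_simps)
  obtain B where B: "B > 0" "\<And>y. norm (P_kernel k (exp y)) \<le> B * (exp (r * y) + exp (- r * y))"
    by (rule P_kernel_exp_bound[OF r(1,2), of k]) (rule that)
  define h where "h \<eta> y = of_real (kern M (x - \<eta> + y)) * P_kernel k (exp y) * of_real (exp y) * omega \<eta>" for \<eta> y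
  define H where "H p \<eta> y = norm (omega \<eta>) * (kern M (x - \<eta> + y) * exp (p * y))" for p \<eta> y
  have intH: "integrable (lborel \<Otimes>\<^sub>M lborel) (\<lambda>(\<eta>, y). H p \<eta> y)" if "0 < p" "p < \<alpha>" for p
    unfolding H_def by (rule omega_kern_pair_integrable[OF that])
  have ip: "integrable (lborel \<Otimes>\<^sub>M lborel) (\<lambda>(\<eta>, y). h \<eta> y)"
  proof (rule Bochner_Integration.integrable_bound)
    show "integrable (lborel \<Otimes>\<^sub>M lborel) (\<lambda>z. B * ((case z of (\<eta>, y) \<Rightarrow> H (1 + r) \<eta> y) + (case z of (\<eta>, y) \<Rightarrow> H (1 - r) \<eta> y)))"
      using r by (intro integrable_mult_right Bochner_Integration.integrable_add intH) auto
    show "(\<lambda>(\<eta>, y). h \<eta> y) \<in> borel_measurable (lborel \<Otimes>\<^sub>M lborel)"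
      unfolding h_def by measurable
    have "norm (h \<eta> y) \<le> B * (H (1 + r) \<eta> y + H (1 - r) \<eta> y)" for \<eta> y
    proof -
      have "norm (h \<eta> y) = norm (omega \<eta>) * (kern M (x - \<eta> + y) * (norm (P_kernel k (exp y)) * exp y))"
        by (simp add: h_def norm_mult kern_nonneg mult_ac)
      also have "\<dots> \<le> norm (omega \<eta>) * (kern M (x - \<eta> + y) * (B * (exp (r * y) + exp (- r * y)) * exp y))"
        by (intro mult_left_mono mult_right_mono B kern_nonneg) auto
      also have "B * (exp (r * y) + exp (- r * y)) * exp y = B * (exp ((1 + r) * y) + exp ((1 - r) * y))"
        by (simp add: algebra_simps flip: exp_add)
      finally show ?thesis by (simp add: H_def algebra_simps)
    qed
    thus "AE z in lborel \<Otimes>\<^sub>M lborel. norm (case z of (\<eta>, y) \<Rightarrow> h \<eta> y) \<le> norm (B * ((case z of (\<eta>, y) \<Rightarrow> H (1 + r) \<eta> y) + (case z of (\<eta>, y) \<Rightarrow> H (1 - r) \<eta> y)))"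
      by (intro AE_I2) (auto intro: order.trans[OF _ abs_ge_self])
  qed
  have inner1: "(LINT y|lborel. h \<eta> y) = R k (x - \<eta>) * omega \<eta>" for \<eta>
    unfolding h_def R_def by (rule integral_mult_left_zero)
  have inner2: "(LINT \<eta>|lborel. h \<eta> y) = f (exp x * exp y) * P_kernel k (exp y) * of_real (exp y)" for y
  proof -
    have "(LINT \<eta>|lborel. h \<eta> y) = (LINT \<eta>|lborel. (P_kernel k (exp y) * of_real (exp y)) * (of_real (kern M (x + y - \<eta>)) * omega \<eta>))"
      by (intro Bochner_Integration.integral_cong refl) (simp add: h_def algebra_simps)
    also have "\<dots> = (P_kernel k (exp y) * of_real (exp y)) * f (exp (x + y))"
      by (simp only: integral_mult_right_zero f_exp)
    finally show ?thesis by (simp add: exp_add mult_ac)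
  qed
  show "integrable lborel (\<lambda>\<eta>. R k (x - \<eta>) * omega \<eta>)"
    using lborel_pair.integrable_fst[OF ip] by (simp add: inner1)
  have "integrable lborel (\<lambda>y. f (exp x * exp y) * P_kernel k (exp y) * of_real (exp y))"
    using lborel_pair.integrable_snd[OF ip] by (simp add: inner2)
  hence "integral {0<..} (\<lambda>y. f (exp x * y) * P_kernel k y) = (LINT y|lborel. f (exp x * exp y) * P_kernel k (exp y) * of_real (exp y))"
    by (intro integral_unique exp_substitution)
  also have "\<dots> = (LINT y|lborel. LINT \<eta>|lborel. h \<eta> y)" by (simp add: inner2)
  also have "\<dots> = (LINT \<eta>|lborel. LINT y|lborel. h \<eta> y)" using lborel_pair.Fubini_integral[OF ip] by simp
  also have "\<dots> = (LINT \<eta>|lborel. R k (x - \<eta>) * omega \<eta>)" by (simp add: inner1)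
  finally show "integral {0<..} (\<lambda>y. f (exp x * y) * P_kernel k y) = (LINT \<eta>|lborel. R k (x - \<eta>) * omega \<eta>)" .
qed

text \<open>By linearity the bracket at e^x is the convolution of \<open>kern_remainder\<close> with
  \<open>omega\<close>. Its transform is zeta^k(s) times the transforms of the kernel and of
  \<open>omega\<close>, and by \<open>mellin_f\<close> the last two multiply to the Mellin transform
  of f.\<close>

lemma muntz_formula:
  assumes km: "real (Suc M) \<ge> 1 + real k / 2" and k: "k \<ge> 1" and s: "0 < Re s" "Re s < 1"
  shows "((\<lambda>x. ((\<Sum>n. of_nat (divisor_k k (Suc n)) * f (real (Suc n) * x))
              - integral {0<..} (\<lambda>y. f (x * y) * P_kernel k y))
             * (of_real x) powr (s - 1))
          has_integral (riemann_zeta s ^ k * mellin f s)) {0<..}"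
proof -
  define F where "F x = ((\<Sum>n. of_nat (divisor_k k (Suc n)) * f (real (Suc n) * x)) - integral {0<..} (\<lambda>y. f (x * y) * P_kernel k y))" for x
  define u where "u y = kern_remainder k M y * exp (s * complex_of_real y)" for y
  define v where "v y = omega y * exp (s * complex_of_real y)" for y
  have u: "integrable lborel u" "(LINT y|lborel. u y) = riemann_zeta s ^ k * beta_fn M s"
    using kern_remainder_mellin[OF s km k] by (simp_all add: u_def[abs_def])
  have v: "integrable lborel v" using omega_exp_integrable[of s] s \<alpha> by (simp add: v_def[abs_def])
  have F: "F (exp x) = (LINT y|lborel. kern_remainder k M (x - y) * omega y)" for x
    unfolding F_def divisor_sum_part(2) residue_part(2) kern_remainder_def left_diff_distrib
    by (rule Bochner_Integration.integral_diff[symmetric, OF divisor_sum_part(1) residue_part(1)])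
  have eq: "F (exp x) * of_real (exp x) powr (s - 1) * of_real (exp x) = (LINT y|lborel. u (x - y) * v y)" for x
  proof -
    have "Ln (of_real (exp x)) = of_real x" by (subst Ln_of_real) auto
    hence "of_real (exp x) powr (s - 1) * of_real (exp x) = exp (s * complex_of_real x)"
      by (simp add: powr_def algebra_simps exp_of_real[symmetric] flip: exp_add)
    hence "F (exp x) * of_real (exp x) powr (s - 1) * of_real (exp x) = (LINT y|lborel. kern_remainder k M (x - y) * omega y) * exp (s * complex_of_real x)"
      by (simp add: F)
    also have "\<dots> = (LINT y|lborel. kern_remainder k M (x - y) * omega y * exp (s * complex_of_real x))"
      by (rule integral_mult_left_zero[symmetric])
    also have "\<dots> = (LINT y|lborel. u (x - y) * v y)"
      by (intro Bochner_Integration.integral_cong refl) (simp add: u_def v_def algebra_simps flip: exp_add)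
    finally show ?thesis .
  qed
  have "((\<lambda>x. F x * of_real x powr (s - 1)) has_integral (LINT x|lborel. F (exp x) * of_real (exp x) powr (s - 1) * of_real (exp x))) {0<..}"
    by (rule exp_substitution) (simp only: eq convolution_integral(1)[OF u(1) v])
  also have "(LINT x|lborel. F (exp x) * of_real (exp x) powr (s - 1) * of_real (exp x)) = riemann_zeta s ^ k * mellin f s"
    unfolding eq convolution_integral(2)[OF u(1) v] u(2) using s \<alpha> by (subst mellin_f) (auto simp: v_def[abs_def])
  finally show ?thesis unfolding F_def .
qed

end

theorem theorem4:
  fixes \<alpha> :: real and k m :: nat and f :: "real \<Rightarrow> complex" and s :: complex
  assumes "\<alpha> > 1" and "k \<ge> 1" and "real m \<ge> 1 + real k / 2"
    and "f \<in> M_class \<alpha> m"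
    and "0 < Re s" and "Re s < 1"
  shows "((\<lambda>x. ((\<Sum>n. of_nat (divisor_k k (Suc n)) * f (real (Suc n) * x))
              - integral {0<..} (\<lambda>y. f (x * y) * P_kernel k y))
             * (of_real x) powr (s - 1))
          has_integral (riemann_zeta s ^ k * mellin f s)) {0<..}"
proof -
  from assms(3) obtain M where M: "m = Suc M" by (cases m) auto
  from assms(4) obtain g where g: "\<forall>x\<ge>0. g 0 x = f x" "\<forall>j\<le>m. continuous_on {0..} (g j)"
      "\<forall>j<m. \<forall>x\<ge>0. (g j has_vector_derivative g (Suc j) x) (at x within {0..})"
      "\<forall>j\<le>m. \<exists>C X. \<forall>x\<ge>X. norm (g j x) \<le> C * x powr (- \<alpha> - real j)"
    unfolding M_class_def by blast
  interpret taylor_data \<alpha> M f g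
    by unfold_locales (use assms(1) g M in auto)
  show ?thesis using assms M by (intro muntz_formula) auto
qed

end
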